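(* Let $N\subset T^d$ be a subtorus satisfying the basis hypothesis. For generic $\zeta\in\mathbb R^3\otimes\mathfrak n^*$, the tangent cone at infinity of the hyperkähler metric on $M_\zeta=\mu_N^{-1}(-\zeta)/N$ is the hyperkähler cone $M_0=\mu_N^{-1}(0)/N$ (with its quotient metric).
   Context: Identify $\mathbb H^d=\mathbb C^d\times\mathbb C^d$ via $(z,w)\mapsto z+wj$, with Euclidean metric and complex structures given by left multiplication by $i,j,k$. The diagonal torus $T^d$ (Lie algebra $\mathfrak t^d\cong\mathbb R^d$, canonical basis $e_1,\dots,e_d$) acts by $z_k\mapsto e^{-it_k}z_k$, $w_k\mapsto e^{it_k}w_k$, with moment map $\mu:\mathbb H^d\to\mathbb R^3\otimes(\mathfrak t^d)^*$, $\mu_1=\frac12\sum_k(|w_k|^2-|z_k|^2)e_k^*$, $\mu_2+\sqrt{-1}\mu_3=\sqrt{-1}\sum_k z_kw_ke_k^*$. $N\subset T^d$ is a subtorus with Lie algebra $\iota:\mathfrak n\hookrightarrow\mathfrak t^d$, $n=d-\dim N$, given by an exact sequence $0\to\mathfrak n\to\mathfrak t^d\xrightarrow{\beta}\mathbb R^n\to0$ with $\beta(e_i)=u_i$, where $u_1,\dots,u_d\in\mathbb Z^n$ are primitive vectors spanning $\mathbb R^n$ and $T^d/N\cong\mathbb R^n/\mathbb Z^n$. $\mu_N=(\mathrm{Id}\otimes\iota^* )\circ\mu$, and $M_\zeta=\mu_N^{-1}(-\zeta)/N$ carries the quotient metric. Basis hypothesis: every subset of $n$ linearly independent vectors of $\{u_1,\dots,u_d\}$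 is a basis of $\mathbb Z^n$. "Generic" means outside a finite union of proper linear subspaces. A tangent cone at infinity of a complete Riemannian manifold $(M,g)$ is a pointed Gromov–Hausdorff limit of $(M,g/\lambda_i^2,p)$ with $p$ fixed and $\lambda_i\nearrow\infty$. *)

theory Defs
  imports "HOL-Analysis.Analysis"
begin

section \<open>The flat space and the diagonal torus\<close>

text \<open>The pair \<open>(z, w)\<close> stands for \<open>z + w j\<close>; the product norm is the Euclidean one.\<close>

type_synonym 'd quat = "(complex ^ 'd) \<times> (complex ^ 'd)"

text \<open>\<open>T\<^sup>d\<close> is realised as \<open>U(1)\<^sup>d\<close>, with exponential map \<open>t \<mapsto> (e\<^sup>i\<^sup>t)\<close> of period \<open>2\<pi>\<close> in each
  coordinate.\<close>

definition torus_exp :: "real ^ 'd \<Rightarrow> complex ^ 'd::finite" where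
  "torus_exp t = (\<chi> k. cis (t $ k))"

definition torus :: "(complex ^ 'd::finite) set" where
  "torus = range torus_exp"

definition torus_act :: "complex ^ 'd \<Rightarrow> 'd quat \<Rightarrow> 'd::finite quat" where
  "torus_act \<tau> p = ((\<chi> k. inverse (\<tau> $ k) * fst p $ k), (\<chi> k. \<tau> $ k * snd p $ k))"

definition subtorus :: "(complex ^ 'd::finite) set \<Rightarrow> bool" where
  "subtorus N \<longleftrightarrow> N \<subseteq> torus \<and> 1 \<in> N \<and>
     (\<forall>\<sigma>\<in>N. \<forall>\<tau>\<in>N. \<sigma> * \<tau> \<in> N) \<and> (\<forall>\<tau>\<in>N. (\<chi> k. inverse (\<tau> $ k)) \<in> N) \<and>
     closed N \<and> connected N"

definition lie_algebra :: "(complex ^ 'd::finite) set \<Rightarrow> (real ^ 'd) set" where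
  "lie_algebra N = {x. \<forall>s::real. torus_exp (s *\<^sub>R x) \<in> N}"


section \<open>Lattice data\<close>

definition int_lattice :: "(real ^ 'n::finite) set" where
  "int_lattice = {v. \<forall>j. v $ j \<in> \<int>}"

definition primitive_vector :: "real ^ 'n::finite \<Rightarrow> bool" where
  "primitive_vector v \<longleftrightarrow> v \<in> int_lattice \<and> v \<noteq> 0 \<and>
     (\<forall>(m::nat) w. w \<in> int_lattice \<and> v = real m *\<^sub>R w \<longrightarrow> m = 1)"

definition lattice_basis :: "(real ^ 'n::finite) set \<Rightarrow> bool" where
  "lattice_basis S \<longleftrightarrow> finite S \<and> independent S \<and>
     {\<Sum>s\<in>S. of_int (a s) *\<^sub>R s |a::real ^ 'n \<Rightarrow> int. True} = int_lattice"

definition basis_hypothesis :: "('d::finite \<Rightarrow> real ^ 'n::finite) \<Rightarrow> bool" where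
  "basis_hypothesis u \<longleftrightarrow>
     (\<forall>S. S \<subseteq> range u \<and> independent S \<and> card S = CARD('n) \<longrightarrow> lattice_basis S)"

definition beta :: "('d::finite \<Rightarrow> real ^ 'n::finite) \<Rightarrow> real ^ 'd \<Rightarrow> real ^ 'n" where
  "beta u x = (\<Sum>k\<in>UNIV. x $ k *\<^sub>R u k)"

text \<open>The Lie algebra of \<open>N\<close> is parametrised by an abstract vector space \<open>'l\<close> through the injection
  \<open>\<iota>\<close>. In the last clause the factor \<open>2\<pi>\<close> turns the period lattice of \<open>torus_exp\<close> into the integer
  lattice: the clause says that \<open>N\<close> is the kernel of \<open>T\<^sup>d \<rightarrow> \<real>\<^sup>n / \<int>\<^sup>n\<close> induced by \<open>\<beta>\<close>.\<close>

definition torus_data ::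
  "('l::real_normed_vector \<Rightarrow> real ^ 'd::finite) \<Rightarrow> ('d \<Rightarrow> real ^ 'n::finite) \<Rightarrow>
   (complex ^ 'd) set \<Rightarrow> bool" where
  "torus_data \<iota> u N \<longleftrightarrow>
     (\<forall>k. primitive_vector (u k)) \<and> span (range u) = UNIV \<and>
     subtorus N \<and> lie_algebra N = range \<iota> \<and>
     linear \<iota> \<and> inj \<iota> \<and> range \<iota> = {x. beta u x = 0} \<and>
     (\<forall>x. torus_exp ((2 * pi) *\<^sub>R x) \<in> N \<longleftrightarrow> beta u x \<in> int_lattice)"


section \<open>Moment maps and level sets\<close>

text \<open>The three components of \<open>\<mu>\<close> are the coordinates of \<open>\<real>\<^sup>3\<close>; \<open>moment_coeff p k\<close> is the coefficient
  of \<open>e\<^sub>k\<^sup>*\<close>, and \<open>\<real>\<^sup>3 \<otimes> V\<^sup>*\<close> is \<open>Hom(V, \<real>\<^sup>3)\<close>, so that \<open>Id \<otimes> \<iota>\<^sup>*\<close> is precomposition with \<open>\<iota>\<close>.\<close>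

definition moment_coeff :: "'d::finite quat \<Rightarrow> 'd \<Rightarrow> real ^ 3" where
  "moment_coeff p k =
     vector [((cmod (snd p $ k))\<^sup>2 - (cmod (fst p $ k))\<^sup>2) / 2,
             Re (\<i> * (fst p $ k * snd p $ k)),
             Im (\<i> * (fst p $ k * snd p $ k))]"

definition moment :: "'d::finite quat \<Rightarrow> real ^ 'd \<Rightarrow> real ^ 3" where
  "moment p x = (\<Sum>k\<in>UNIV. x $ k *\<^sub>R moment_coeff p k)"

definition moment_N :: "('l \<Rightarrow> real ^ 'd) \<Rightarrow> 'd::finite quat \<Rightarrow> 'l \<Rightarrow> real ^ 3" where
  "moment_N \<iota> p = moment p \<circ> \<iota>"

definition level_set ::
  "('l::real_normed_vector \<Rightarrow> real ^ 'd) \<Rightarrow> ('l \<Rightarrow>\<^sub>L (real ^ 3)) \<Rightarrow> 'd::finite quat set" where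
  "level_set \<iota> \<zeta> = {p. moment_N \<iota> p = blinfun_apply (- \<zeta>)}"

definition orbit :: "(complex ^ 'd) set \<Rightarrow> 'd quat \<Rightarrow> 'd::finite quat set" where
  "orbit N p = (\<lambda>\<tau>. torus_act \<tau> p) ` N"

definition hk_quotient ::
  "('l::real_normed_vector \<Rightarrow> real ^ 'd) \<Rightarrow> (complex ^ 'd) set \<Rightarrow> ('l \<Rightarrow>\<^sub>L (real ^ 3)) \<Rightarrow>
   'd::finite quat set set" where
  "hk_quotient \<iota> N \<zeta> = orbit N ` level_set \<iota> \<zeta>"


section \<open>The quotient metric\<close>

definition fundamental_field :: "real ^ 'd \<Rightarrow> 'd quat \<Rightarrow> 'd::finite quat" where
  "fundamental_field x p =
     vector_derivative (\<lambda>s. torus_act (torus_exp (s *\<^sub>R x)) p) (at (0::real))"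

definition vertical_space :: "(complex ^ 'd) set \<Rightarrow> 'd quat \<Rightarrow> 'd::finite quat set" where
  "vertical_space N p = (\<lambda>x. fundamental_field x p) ` lie_algebra N"

text \<open>The length of a tangent vector of the quotient is that of the component of any lift \<open>v\<close>
  orthogonal to the \<open>N\<close>-orbit, that is, the distance of \<open>v\<close> from the vertical subspace. A curve in
  the quotient is given by a piecewise \<open>C\<^sup>1\<close> lift to the level set. Its length is extended
  real-valued since \<open>valid_path\<close> permits derivatives that are unbounded near a break point.\<close>

definition quotient_length ::
  "(complex ^ 'd) set \<Rightarrow> (real \<Rightarrow> 'd::finite quat) \<Rightarrow> ennreal" where
  "quotient_length N c =
     (\<integral>\<^sup>+ t\<in>{0..1}. ennreal (infdist (vector_derivative c (at t)) (vertical_space N (c t))) \<partial>lborel)"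

text \<open>If no curve of finite length joins two distinct orbits, the value \<open>0\<close> below makes
  \<open>Metric_space\<close> fail.\<close>

definition quotient_dist ::
  "('l::real_normed_vector \<Rightarrow> real ^ 'd) \<Rightarrow> (complex ^ 'd) set \<Rightarrow> ('l \<Rightarrow>\<^sub>L (real ^ 3)) \<Rightarrow>
   'd::finite quat set \<Rightarrow> 'd quat set \<Rightarrow> real" where
  "quotient_dist \<iota> N \<zeta> P Q =
     enn2real (INF c\<in>{c. valid_path c \<and> path_image c \<subseteq> level_set \<iota> \<zeta> \<and>
                          pathstart c \<in> P \<and> pathfinish c \<in> Q}. quotient_length N c)"


section \<open>Pointed Gromov--Hausdorff limits and tangent cones at infinity\<close>

text \<open>Pointed convergence in the sense of Burago, Burago and Ivanov, A Course in Metric Geometry,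
  Definition 8.1.1.\<close>

definition pointed_GH_limit ::
  "(nat \<Rightarrow> 'a set) \<Rightarrow> (nat \<Rightarrow> 'a \<Rightarrow> 'a \<Rightarrow> real) \<Rightarrow> (nat \<Rightarrow> 'a) \<Rightarrow>
   'b set \<Rightarrow> ('b \<Rightarrow> 'b \<Rightarrow> real) \<Rightarrow> 'b \<Rightarrow> bool" where
  "pointed_GH_limit X d p Y e q \<longleftrightarrow>
     (\<forall>i. Metric_space (X i) (d i) \<and> p i \<in> X i) \<and> Metric_space Y e \<and> q \<in> Y \<and>
     (\<forall>r>0. \<forall>\<epsilon>>0. \<forall>\<^sub>F i in sequentially.
        \<exists>f. f ` Metric_space.mball (X i) (d i) (p i) r \<subseteq> Y \<and> f (p i) = q \<and>
            (\<forall>x \<in> Metric_space.mball (X i) (d i) (p i) r.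
             \<forall>y \<in> Metric_space.mball (X i) (d i) (p i) r. \<bar>e (f x) (f y) - d i x y\<bar> < \<epsilon>) \<and>
            Metric_space.mball Y e q (r - \<epsilon>)
              \<subseteq> (\<Union>x \<in> Metric_space.mball (X i) (d i) (p i) r. Metric_space.mball Y e (f x) \<epsilon>))"

text \<open>For distance functions, rescaling the Riemannian metric by \<open>1 / \<rho>\<^sup>2\<close> is division by \<open>\<rho>\<close>.
  Requiring convergence for every base point and every sequence of scales expresses that the
  pointed space \<open>Y\<close> is the tangent cone, and not merely one of several.\<close>

definition the_tangent_cone_at_infinity ::
  "'a set \<Rightarrow> ('a \<Rightarrow> 'a \<Rightarrow> real) \<Rightarrow> 'b set \<Rightarrow> ('b \<Rightarrow> 'b \<Rightarrow> real) \<Rightarrow> 'b \<Rightarrow> bool" where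
  "the_tangent_cone_at_infinity M d Y e q \<longleftrightarrow> M \<noteq> {} \<and>
     (\<forall>p\<in>M. \<forall>\<rho>::nat \<Rightarrow> real. (\<forall>i. 0 < \<rho> i) \<and> incseq \<rho> \<and> filterlim \<rho> at_top sequentially \<longrightarrow>
        pointed_GH_limit (\<lambda>_. M) (\<lambda>i x y. d x y / \<rho> i) (\<lambda>_. p) Y e q)"

end

theory Submission
  imports Defs "HOL-Complex_Analysis.Great_Picard"
begin

text \<open>Rescaling by \<open>1 / \<rho>\<close> turns \<open>M\<^sub>\<zeta>\<close> into \<open>M\<close> at the parameter \<open>\<zeta> / \<rho>\<^sup>2\<close>, so the theorem
  follows once the quotient distance, as a function of \<open>\<zeta>\<close> and of two points of the level set, is
  continuous, also where the level set is singular. For lower semicontinuity, curves are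
  replaced by nearly horizontal Lipschitz curves close to the level sets, and Arzela-Ascoli gives a
  Lipschitz limit curve \<open>\<gamma>\<close> in the limiting level set. For upper semicontinuity it has to be shown
  that the length of such a \<open>\<gamma>\<close> bounds the distance in all nearby level sets. Level sets are given
  by affine conditions on the values of the \<open>d\<close> Hopf maps, so two of their points are joined by
  lifting straight segments. Near \<open>\<gamma> t\<close> the lift is almost as short as the chord, except for the
  coordinates \<open>k\<close> with \<open>\<gamma>\<^sub>k t = 0\<close>, whose lifts are only bounded by a multiple of the size of
  the coordinate. The latter is controlled by the time that \<open>\<gamma>\<^sub>k\<close> spends away from \<open>0\<close> near
  \<open>t\<close>, and the measure of these times near the zero set of \<open>\<gamma>\<^sub>k\<close> can be made arbitrarily small.
  All of this works for every \<open>\<zeta>\<close>, whence the empty exceptional set.\<close>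

section \<open>The Hopf map\<close>

text \<open>Length counts only the horizontal part of a velocity, so curves of bounded length may
  run along orbits at no cost and are not equicontinuous. Making them horizontal exactly would need
  a connection, which degenerates where stabilisers are not discrete. Instead, one torus element
  near each time corrects the curve; the result leaves the level set, but by an arbitrarily small
  amount that disappears in the limit. In the other direction the obstacle is that the Hopf map is
  no submersion at 0. A coordinate near 0 is lifted with integrable but unbounded speed, so only a
  fixed multiple of its size bounds the cost, and a curve may return to 0 on a Cantor set of times.
  Charging only for the time off the zero set turns this error into a measure, which outer
  regularity makes small. Both arguments rest on local estimates with additive costs and are
  assembled by induction over intervals (\<open>Bolzano\<close>). Since the Hopf map is quadratic,
  points of neighbouring level sets are compared at the scale of a square root.\<close>

definition hopf :: "complex \<times> complex \<Rightarrow> real ^ 3" where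
  "hopf h = vector [((cmod (snd h))\<^sup>2 - (cmod (fst h))\<^sup>2) / 2,
                    Re (\<i> * (fst h * snd h)), Im (\<i> * (fst h * snd h))]"

definition rot :: "real \<Rightarrow> complex \<times> complex \<Rightarrow> complex \<times> complex" where
  "rot \<theta> h = (cis (- \<theta>) * fst h, cis \<theta> * snd h)"

definition rot_gen :: "complex \<times> complex \<Rightarrow> complex \<times> complex" where
  "rot_gen h = (- \<i> * fst h, \<i> * snd h)"

lemma rot_eq: "rot \<theta> h = cos \<theta> *\<^sub>R h + sin \<theta> *\<^sub>R rot_gen h"
  by (simp add: rot_def rot_gen_def prod_eq_iff complex_eq_iff algebra_simps)

lemma linear_rot_gen: "linear rot_gen"
  by (rule linearI) (simp_all add: rot_gen_def prod_eq_iff algebra_simps scaleR_conv_of_real)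

lemma norm_rot [simp]: "norm (rot \<theta> h) = norm h"
  by (simp add: rot_def norm_prod_def norm_mult)

lemma rot_zero [simp]: "rot 0 h = h"
  by (simp add: rot_def)

lemma hopf_rot [simp]: "hopf (rot \<theta> h) = hopf h"
proof -
  have "cis (- \<theta>) * fst h * (cis \<theta> * snd h) = fst h * snd h"
    using cis_mult[of "- \<theta>" \<theta>] by (simp add: algebra_simps)
  then show ?thesis
    unfolding hopf_def rot_def fst_conv snd_conv by (simp only: norm_mult norm_cis mult_1)
qed

lemma norm_hopf: "norm (hopf h) = (norm h)\<^sup>2 / 2"
proof (rule power2_eq_imp_eq)
  obtain a b c d where h: "h = (Complex a b, Complex c d)"
    by (metis complex.exhaust surj_pair)
  show "(norm (hopf h))\<^sup>2 = ((norm h)\<^sup>2 / 2)\<^sup>2"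
    by (simp add: hopf_def h norm_vec_def L2_set_def sum_3 norm_prod_def cmod_def)
       (simp add: power2_eq_square field_simps)
qed auto

lemma hopf_zero [simp]: "hopf 0 = 0"
  by (metis norm_hopf norm_zero norm_eq_zero power_zero_numeral div_0)

lemma continuous_on_hopf [continuous_intros]:
  fixes f :: "'a::topological_space \<Rightarrow> complex \<times> complex"
  assumes "continuous_on S f"
  shows "continuous_on S (\<lambda>x. hopf (f x))"
proof -
  have "continuous_on S (\<lambda>x. hopf (f x) $ i)" for i
  proof -
    consider "i = 1" | "i = 2" | "i = 3" using exhaust_3 by blast
    then show ?thesis
      by cases (simp_all add: hopf_def, auto intro!: continuous_intros assms)
  qed
  then have "continuous_on S (\<lambda>x. \<chi> i. hopf (f x) $ i)"
    by (rule continuous_on_vec_lambda)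
  then show ?thesis by simp
qed

lemma hopf_surj: "\<exists>h. hopf h = y"
proof -
  define r where "r = norm y"
  have r: "r\<^sup>2 = (y$1)\<^sup>2 + (y$2)\<^sup>2 + (y$3)\<^sup>2"
    by (simp add: r_def norm_vec_def L2_set_def sum_3)
  have r1: "\<bar>y$1\<bar> \<le> r" by (simp add: r_def component_le_norm_cart)
  define B where "B = Complex (y$2) (y$3)"
  have B: "(cmod B)\<^sup>2 = (y$2)\<^sup>2 + (y$3)\<^sup>2" by (simp add: B_def cmod_def)
  show ?thesis
  proof (cases "r + y$1 = 0")
    case True
    then have "r = - y$1" by linarith
    then have "(y$2)\<^sup>2 + (y$3)\<^sup>2 = 0" using r by simp
    then have "y$2 = 0" "y$3 = 0" by (auto simp: sum_power2_eq_zero_iff)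
    moreover have "y$1 \<le> 0" using True r1 by linarith
    ultimately have "hopf (of_real (sqrt (-2 * y$1)), 0) = y"
      by (simp add: hopf_def vec_eq_iff forall_3)
    then show ?thesis by blast
  next
    case False
    \<comment> \<open>A preimage (z, w) satisfies |w|^2 + |z|^2 = 2 r by \<open>norm_hopf\<close>
      and |w|^2 - |z|^2 = 2 y$1, which determines |w|; the phase is chosen so that w > 0. The other
      case is w = 0.\<close>
    define w where "w = sqrt (r + y$1)"
    have w: "w > 0" "w\<^sup>2 = r + y$1" using False r1 by (auto simp: w_def)
    have "(cmod B)\<^sup>2 = (r - y$1) * w\<^sup>2" unfolding B w using r by (simp add: algebra_simps power2_eq_square)
    then have "(cmod (B / (\<i> * of_real w)))\<^sup>2 = r - y$1"
      using w(1) by (simp add: norm_divide norm_mult power_divide)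
    moreover have "\<i> * (B / (\<i> * of_real w) * of_real w) = B" using w by simp
    ultimately have "hopf (B / (\<i> * of_real w), of_real w) = y"
      using w by (simp add: hopf_def vec_eq_iff forall_3 B_def)
    then show ?thesis by blast
  qed
qed

text \<open>The phase of c is invisible to the Hopf map, so after a rotation c lies in a real plane
  through b that is orthogonal to its own image under \<open>rot_gen\<close>. On such a plane
  \<open>hopf\<close> is complex squaring followed by a linear map. The coordinate s of c can
  moreover be put into the closed first quadrant, where squaring is injective with values in the
  upper half plane.\<close>

lemma hopf_frame:
  fixes b c :: "complex \<times> complex"
  assumes "b \<noteq> 0"
  obtains J :: "complex \<Rightarrow> complex \<times> complex" and M :: "complex \<Rightarrow> real ^ 3" and s \<theta>
  where "linear J" "linear M"
    "\<And>x y \<tau>. (norm (J x + \<tau> *\<^sub>R rot_gen (J y)))\<^sup>2 = (cmod x)\<^sup>2 + \<tau>\<^sup>2 * (cmod y)\<^sup>2"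
    "\<And>x. hopf (J x) = M (x\<^sup>2)" "J (of_real (norm b)) = b"
    "c = rot \<theta> (J s)" "\<bar>\<theta>\<bar> \<le> pi" "0 \<le> Re s" "0 \<le> Im s"
proof -
  define z w where "z = fst b / of_real (norm b)" and "w = snd b / of_real (norm b)"
  have nb: "norm b > 0" using assms by simp
  have zw: "(cmod z)\<^sup>2 + (cmod w)\<^sup>2 = 1"
  proof -
    have "(norm b)\<^sup>2 = (cmod (fst b))\<^sup>2 + (cmod (snd b))\<^sup>2" by (simp add: norm_prod_def)
    moreover have "(norm b)\<^sup>2 \<noteq> 0" using nb by simp
    ultimately show ?thesis
      by (simp only: z_def w_def norm_divide power_divide norm_of_real abs_norm_cancel
           add_divide_distrib [symmetric]) simp
  qed
  have zw': "z * cnj z + w * cnj w = 1"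
    using arg_cong[OF zw, of complex_of_real] by (simp only: of_real_add complex_norm_square of_real_1)
  \<comment> \<open>Coordinates of c in the quaternionic frame of the unit vector (z, w): fst c = p
    z - q w and snd c = cnj p w + cnj q z.\<close>
  define p q where "p = fst c * cnj z + cnj (snd c) * w" and "q = - fst c * cnj w + cnj (snd c) * z"
  \<comment> \<open>\<theta> removes the phase of p. The second axis of the plane can still be
    turned by the unit number \<omega>, which removes the phase of q; for q = 0 any unit number
    serves.\<close>
  define \<theta> where "\<theta> = - Arg p"
  define \<omega> where "\<omega> = (if q = 0 then 1 else sgn q * cis \<theta>)"
  have om: "cmod \<omega> = 1" by (simp add: \<omega>_def norm_mult norm_sgn)
  then have om': "\<omega> * cnj \<omega> = 1" by (simp add: complex_norm_square [symmetric])
  define J where "J x = (Re x *\<^sub>R z - Im x *\<^sub>R (\<omega> * w), Re x *\<^sub>R w + Im x *\<^sub>R (cnj \<omega> * z))" for x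
  \<comment> \<open>The mixed term of the quadratic map \<open>hopf\<close> on the two orthonormal
    axes of the plane. Its values on the axes themselves are opposite, which is why only x^2
    enters.\<close>
  define B where "B = (vector [2 * Re (\<omega> * cnj z * w), Re (\<i> * (cnj \<omega> * z\<^sup>2 - \<omega> * w\<^sup>2)),
      Im (\<i> * (cnj \<omega> * z\<^sup>2 - \<omega> * w\<^sup>2))] :: real ^ 3)"
  define M where "M Y = Re Y *\<^sub>R hopf (z, w) + (Im Y / 2) *\<^sub>R B" for Y
  define s where "s = Complex (cmod p) (cmod q)"
  obtain z1 z2 w1 w2 o1 o2 where co: "z = Complex z1 z2" "w = Complex w1 w2" "\<omega> = Complex o1 o2"
    by (metis complex.exhaust)
  have e1: "z1\<^sup>2 + z2\<^sup>2 + w1\<^sup>2 + w2\<^sup>2 = 1" using zw by (simp add: co cmod_def)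
  have e2: "o1\<^sup>2 + o2\<^sup>2 = 1" using om by (simp add: co cmod_def)
  have "linear J" by (rule linearI) (simp_all add: J_def prod_eq_iff algebra_simps)
  moreover have "linear M" by (rule linearI) (simp_all add: M_def algebra_simps add_divide_distrib)
  moreover have "(norm (J x + \<tau> *\<^sub>R rot_gen (J y)))\<^sup>2 = (cmod x)\<^sup>2 + \<tau>\<^sup>2 * (cmod y)\<^sup>2" for x y \<tau>
  proof -
    have "(norm (J x + \<tau> *\<^sub>R rot_gen (J y)))\<^sup>2 =
       (z1\<^sup>2 + z2\<^sup>2 + w1\<^sup>2 + w2\<^sup>2) * ((Re x)\<^sup>2 + \<tau>\<^sup>2 * (Re y)\<^sup>2) +
       (o1\<^sup>2 + o2\<^sup>2) * (z1\<^sup>2 + z2\<^sup>2 + w1\<^sup>2 + w2\<^sup>2) * ((Im x)\<^sup>2 + \<tau>\<^sup>2 * (Im y)\<^sup>2)"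
      by (simp add: J_def rot_gen_def co norm_prod_def cmod_def) algebra
    then show ?thesis unfolding e1 e2 by (simp add: cmod_def algebra_simps)
  qed
  moreover have "hopf (J x) = M (x\<^sup>2)" for x
  proof -
    have "hopf (J x) $ 1 = M (x\<^sup>2) $ 1"
      using e1 e2 unfolding hopf_def M_def J_def B_def
      by (simp add: co cmod_def power2_eq_square [of x] Re_power2) algebra
    moreover have "hopf (J x) $ 2 = M (x\<^sup>2) $ 2" "hopf (J x) $ 3 = M (x\<^sup>2) $ 3"
      using e1 e2 unfolding hopf_def M_def J_def B_def
      by (simp_all add: co power2_eq_square) (algebra, algebra)
    ultimately show ?thesis by (simp add: vec_eq_iff forall_3)
  qed
  moreover have "J (of_real (norm b)) = b"
    using nb by (simp add: J_def z_def w_def prod_eq_iff scaleR_conv_of_real)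
  moreover have "c = rot \<theta> (J s)"
  proof -
    have p: "p = of_real (cmod p) * cis (- \<theta>)"
      using rcis_cmod_Arg[of p] by (simp add: rcis_def \<theta>_def)
    have q: "q = of_real (cmod q) * (\<omega> * cis (- \<theta>))"
      by (auto simp: \<omega>_def cis_mult mult.assoc sgn_div_norm scaleR_conv_of_real field_simps)
    have p': "cnj p = of_real (cmod p) * cis \<theta>"
      using arg_cong[OF p, of cnj] by (simp add: cis_cnj)
    have q': "cnj q = of_real (cmod q) * (cnj \<omega> * cis \<theta>)"
      using arg_cong[OF q, of cnj] by (simp add: cis_cnj)
    have "fst c = fst c * (z * cnj z + w * cnj w)" by (simp add: zw')
    also have "\<dots> = p * z - q * w" by (simp add: p_def q_def algebra_simps)
    also have "\<dots> = fst (rot \<theta> (J s))"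
      by (subst p, subst q) (simp add: rot_def J_def s_def scaleR_conv_of_real algebra_simps)
    finally have 1: "fst c = fst (rot \<theta> (J s))" .
    have "snd c = snd c * (z * cnj z + w * cnj w)" by (simp add: zw')
    also have "\<dots> = cnj p * w + cnj q * z" by (simp add: p_def q_def algebra_simps)
    also have "\<dots> = snd (rot \<theta> (J s))"
      unfolding p' q' by (simp add: rot_def J_def s_def scaleR_conv_of_real algebra_simps)
    finally show ?thesis using 1 by (simp add: prod_eq_iff)
  qed
  moreover have "\<bar>\<theta>\<bar> \<le> pi" using Arg_bounded[of p] by (auto simp: \<theta>_def)
  ultimately show thesis by (intro that[of J M \<theta> s]) (auto simp: s_def)
qed

section \<open>Lifting segments along the Hopf map\<close>

lemma nn_integral_inverse_sqrt_le:
  fixes t0 :: real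
  shows "(\<integral>\<^sup>+t\<in>{0..1}. ennreal (1 / sqrt \<bar>t - t0\<bar>) \<partial>lborel) \<le> 4"
proof -
  \<comment> \<open>An antiderivative that is continuous across the singularity, so that t0 is
    merely an exceptional point for the fundamental theorem. t0 may lie outside the unit interval,
    and the bound must not depend on it.\<close>
  define g where "g t = 2 * sgn (t - t0) * sqrt \<bar>t - t0\<bar>" for t
  have g_alt: "g t = (if t \<ge> t0 then 2 * sqrt (t - t0) else - 2 * sqrt (t0 - t))" for t
    by (simp add: g_def sgn_if)
  have "continuous_on ({t0..} \<union> {..t0}) (\<lambda>t. if t \<ge> t0 then 2 * sqrt (t - t0) else - 2 * sqrt (t0 - t))"
    by (rule continuous_on_If) (auto intro!: continuous_intros simp: not_le)
  then have cont: "continuous_on {0..1} g"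
    unfolding g_alt [abs_def] by (rule continuous_on_subset) auto
  have der: "(g has_vector_derivative 1 / sqrt \<bar>t - t0\<bar>) (at t)" if "t \<noteq> t0" for t
  proof (cases "t > t0")
    case True
    have "((\<lambda>t. 2 * sqrt (t - t0)) has_real_derivative 1 / sqrt \<bar>t - t0\<bar>) (at t)"
      using True by (auto intro!: derivative_eq_intros simp: field_simps)
    then have "(g has_real_derivative 1 / sqrt \<bar>t - t0\<bar>) (at t)"
      by (rule has_field_derivative_transform_within_open[of _ _ _ "{t0<..}"]) (use True in \<open>auto simp: g_alt\<close>)
    then show ?thesis by (simp add: has_real_derivative_iff_has_vector_derivative)
  next
    case False
    have "((\<lambda>t. - 2 * sqrt (t0 - t)) has_real_derivative 1 / sqrt \<bar>t - t0\<bar>) (at t)"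
      using False that by (auto intro!: derivative_eq_intros simp: field_simps)
    then have "(g has_real_derivative 1 / sqrt \<bar>t - t0\<bar>) (at t)"
      by (rule has_field_derivative_transform_within_open[of _ _ _ "{..<t0}"])
         (use False that in \<open>auto simp: g_alt\<close>)
    then show ?thesis by (simp add: has_real_derivative_iff_has_vector_derivative)
  qed
  have I: "((\<lambda>t. 1 / sqrt \<bar>t - t0\<bar>) has_integral (g 1 - g 0)) {0..1}"
    by (rule fundamental_theorem_of_calculus_interior_strong[of "{t0}"]) (use cont der in auto)
  have "g 1 - g 0 \<le> 4"
  proof (cases "t0 < 0")
    case True
    have "sqrt (1 - t0) \<le> sqrt 1 + sqrt (- t0)"
      using sqrt_add_le_add_sqrt[of 1 "-t0"] True by simp
    then show ?thesis using True by (simp add: g_alt)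
  next
    case False
    show ?thesis
    proof (cases "t0 > 1")
      case True
      have "sqrt t0 \<le> sqrt 1 + sqrt (t0 - 1)"
        using sqrt_add_le_add_sqrt[of 1 "t0 - 1"] True by simp
      then show ?thesis using True by (simp add: g_alt)
    next
      case F: False
      have "sqrt (1 - t0) \<le> 1" "sqrt t0 \<le> 1" using False F by auto
      then have "2 * sqrt (1 - t0) + 2 * sqrt t0 \<le> 4" by linarith
      then show ?thesis using False F by (auto simp: g_alt)
    qed
  qed
  moreover have "(\<integral>\<^sup>+t\<in>{0..1}. ennreal (1 / sqrt \<bar>t - t0\<bar>) \<partial>lborel) = ennreal (g 1 - g 0)"
    by (rule nn_integral_has_integral_lebesgue' [OF _ I]) simp
  ultimately show ?thesis by (simp add: ennreal_leI flip: ennreal_numeral)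
qed

text \<open>The factor \<open>1 - (1 - cos \<theta>) / 2\<close> is \<open>cos\<^sup>2 (\<theta> / 2)\<close>, so this is \<open>\<phi> \<le> tan \<phi>\<close> for \<open>\<phi> = \<theta> / 2\<close>.\<close>

lemma square_le_one_minus_cos:
  fixes \<theta> :: real
  assumes "\<bar>\<theta>\<bar> \<le> pi"
  shows "\<theta>\<^sup>2 * (1 - (1 - cos \<theta>) / 2) \<le> 2 * (1 - cos \<theta>)"
proof -
  define \<phi> where "\<phi> = \<bar>\<theta>\<bar> / 2"
  have ph: "0 \<le> \<phi>" "\<phi> \<le> pi / 2" using assms by (auto simp: \<phi>_def)
  have c: "cos \<theta> = 1 - 2 * (sin \<phi>)\<^sup>2"
  proof -
    have "cos \<theta> = cos (2 * \<phi>)" by (simp add: \<phi>_def)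
    then show ?thesis by (simp only: cos_double_sin)
  qed
  have "\<phi> * cos \<phi> \<le> sin \<phi>"
  proof (cases "\<phi> = pi / 2")
    case False
    then have lt: "\<phi> < pi / 2" using ph by simp
    have cp: "cos \<phi> > 0" by (rule cos_gt_zero_pi) (use ph lt in auto)
    have "tan \<phi> \<ge> 0" using lt ph by (metis tan_gt_zero order_less_le tan_zero)
    then have "arctan (tan \<phi>) \<le> tan \<phi>" by (rule arctan_le_self)
    then have "\<phi> \<le> tan \<phi>" using ph lt by (simp add: arctan_tan)
    then show ?thesis using cp by (simp add: tan_def field_simps)
  next
    case True
    then show ?thesis by (simp only: cos_pi_half sin_pi_half mult_zero_right zero_le_one)
  qed
  moreover have "0 \<le> \<phi> * cos \<phi>" using ph by (simp add: cos_ge_zero)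
  ultimately have "(\<phi> * cos \<phi>)\<^sup>2 \<le> (sin \<phi>)\<^sup>2" by (rule power_mono)
  then have "\<phi>\<^sup>2 * (1 - (sin \<phi>)\<^sup>2) \<le> (sin \<phi>)\<^sup>2" by (simp add: power_mult_distrib cos_squared_eq)
  moreover have "\<theta>\<^sup>2 = 4 * \<phi>\<^sup>2" by (simp add: \<phi>_def power_divide)
  ultimately show ?thesis unfolding c by (simp add: algebra_simps)
qed

lemma csqrt_first_quadrant:
  assumes "0 \<le> Im z"
  shows "0 \<le> Re (csqrt z)" "0 \<le> Im (csqrt z)"
proof -
  have "Im z = 2 * Re (csqrt z) * Im (csqrt z)"
    by (metis Im_power2 power2_csqrt)
  moreover have "0 < Re (csqrt z) \<or> Re (csqrt z) = 0 \<and> 0 \<le> Im (csqrt z)" by (rule csqrt_principal)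
  ultimately show "0 \<le> Im (csqrt z)"
    using assms by (metis mult_pos_neg not_less zero_less_numeral mult_pos_pos)
  show "0 \<le> Re (csqrt z)"
    using csqrt_principal[of z] by linarith
qed

text \<open>Here |a - b| <= |a + b|, so one factor of (a - b)(a + b) may be replaced by the smaller
  one. Square roots with values in the first quadrant are thus Hoelder continuous with exponent 1/2,
  also at 0 and along the branch cut of \<open>csqrt\<close>.\<close>

lemma first_quadrant_diff_le:
  fixes a b :: complex
  assumes "0 \<le> Re a" "0 \<le> Im a" "0 \<le> Re b" "0 \<le> Im b"
  shows "(cmod (a - b))\<^sup>2 \<le> cmod (a\<^sup>2 - b\<^sup>2)"
proof -
  have "cmod (a - b) \<le> cmod (a + b)"
    unfolding cmod_def using assms
    by (intro real_sqrt_le_mono add_mono) (auto simp: abs_le_square_iff [symmetric])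
  then have "cmod (a - b) * cmod (a - b) \<le> cmod (a - b) * cmod (a + b)"
    by (rule mult_left_mono) auto
  also have "\<dots> = cmod (a\<^sup>2 - b\<^sup>2)"
    by (simp add: norm_mult [symmetric] power2_eq_square algebra_simps)
  finally show ?thesis by (simp add: power2_eq_square)
qed

lemma csqrt_first_quadrant_square:
  assumes "0 \<le> Re s" "0 \<le> Im s"
  shows "csqrt (s\<^sup>2) = s"
  by (rule csqrt_square) (use assms in auto)

lemma has_vector_derivative_iff_Lim:
  fixes f :: "real \<Rightarrow> 'a::real_normed_vector"
  shows "(f has_vector_derivative D) (at t) \<longleftrightarrow> ((\<lambda>x. (f x - f t) /\<^sub>R (x - t)) \<longlongrightarrow> D) (at t)"
proof -
  have "(f has_vector_derivative D) (at t) \<longleftrightarrow>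
      ((\<lambda>x. (f x - f t - (x - t) *\<^sub>R D) /\<^sub>R norm (x - t)) \<longlongrightarrow> 0) (at t)" (is "_ = (?F \<longlongrightarrow> 0) _")
    by (simp add: has_vector_derivative_def has_derivative_def has_derivative_at_within bounded_linear_scaleR_left)
  also have "\<dots> \<longleftrightarrow> ((\<lambda>x. norm (?F x)) \<longlongrightarrow> 0) (at t)"
    by (rule tendsto_norm_zero_iff [symmetric])
  also have "\<dots> \<longleftrightarrow> ((\<lambda>x. norm ((f x - f t) /\<^sub>R (x - t) - D)) \<longlongrightarrow> 0) (at t)"
  proof (rule filterlim_cong [OF refl refl])
    show "eventually (\<lambda>x. norm ((f x - f t - (x - t) *\<^sub>R D) /\<^sub>R norm (x - t)) = norm ((f x - f t) /\<^sub>R (x - t) - D)) (at t)"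
      unfolding eventually_at_filter
    proof (rule always_eventually, intro allI impI)
      fix x assume "x \<noteq> t"
      then have "(f x - f t) /\<^sub>R (x - t) - D = (f x - f t - (x - t) *\<^sub>R D) /\<^sub>R (x - t)"
        by (simp add: scaleR_diff_right)
      then show "norm ((f x - f t - (x - t) *\<^sub>R D) /\<^sub>R norm (x - t)) = norm ((f x - f t) /\<^sub>R (x - t) - D)"
        by simp
    qed
  qed
  also have "\<dots> \<longleftrightarrow> ((\<lambda>x. (f x - f t) /\<^sub>R (x - t)) \<longlongrightarrow> D) (at t)"
    by (subst Lim_null) (rule tendsto_norm_zero_iff)
  finally show ?thesis .
qed

lemma has_vector_derivative_square_root:
  fixes \<sigma> Y :: "real \<Rightarrow> complex"
  assumes Y: "(Y has_vector_derivative Y') (at t)" and cont: "isCont \<sigma> t"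
    and sq: "eventually (\<lambda>x. (\<sigma> x)\<^sup>2 = Y x) (nhds t)" and nz: "\<sigma> t \<noteq> 0"
  shows "(\<sigma> has_vector_derivative Y' / (2 * \<sigma> t)) (at t)"
proof -
  have sqt: "(\<sigma> t)\<^sup>2 = Y t" using sq by (rule eventually_nhds_x_imp_x)
  have lim: "((\<lambda>x. (Y x - Y t) /\<^sub>R (x - t)) \<longlongrightarrow> Y') (at t)"
    using Y by (simp only: has_vector_derivative_iff_Lim)
  have s: "((\<lambda>x. \<sigma> x + \<sigma> t) \<longlongrightarrow> 2 * \<sigma> t) (at t)"
    unfolding mult_2 using cont by (intro tendsto_add) (auto simp: isCont_def)
  have "((\<lambda>x. ((Y x - Y t) /\<^sub>R (x - t)) / (\<sigma> x + \<sigma> t)) \<longlongrightarrow> Y' / (2 * \<sigma> t)) (at t)"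
    by (rule tendsto_divide[OF lim s]) (use nz in auto)
  moreover have "eventually (\<lambda>x. \<sigma> x + \<sigma> t \<noteq> 0) (at t)"
    by (rule tendsto_imp_eventually_ne[OF s]) (use nz in auto)
  then have "eventually (\<lambda>x. ((Y x - Y t) /\<^sub>R (x - t)) / (\<sigma> x + \<sigma> t) = (\<sigma> x - \<sigma> t) /\<^sub>R (x - t)) (at t)"
  proof -
    have "eventually (\<lambda>x. (\<sigma> x)\<^sup>2 = Y x) (at t)"
      using sq unfolding eventually_at_filter by (rule eventually_mono) simp
    then show ?thesis using \<open>eventually (\<lambda>x. \<sigma> x + \<sigma> t \<noteq> 0) (at t)\<close>
    proof eventually_elim
      case (elim x)
      have "Y x - Y t = (\<sigma> x - \<sigma> t) * (\<sigma> x + \<sigma> t)"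
        using elim sqt by (simp add: algebra_simps power2_eq_square)
      then show ?case using elim by (simp add: scaleR_conv_of_real)
    qed
  qed
  ultimately have "((\<lambda>x. (\<sigma> x - \<sigma> t) /\<^sub>R (x - t)) \<longlongrightarrow> Y' / (2 * \<sigma> t)) (at t)"
    by (rule Lim_transform_eventually)
  then show ?thesis by (simp only: has_vector_derivative_iff_Lim)
qed


text \<open>The derivative D is part of the data and two-sided off S, so that lifts of different
  coordinates combine into one piecewise C1 curve.\<close>

definition hopf_lift ::
  "complex \<times> complex \<Rightarrow> complex \<times> complex \<Rightarrow> (real \<Rightarrow> complex \<times> complex) \<Rightarrow>
   (real \<Rightarrow> complex \<times> complex) \<Rightarrow> real set \<Rightarrow> bool" where
  "hopf_lift b c r D S \<longleftrightarrow> finite S \<and> continuous_on {0..1} r \<and>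
     (\<forall>t\<in>{0..1} - S. (r has_vector_derivative D t) (at t)) \<and> continuous_on ({0..1} - S) D \<and>
     r 0 = b \<and> r 1 = c \<and> (\<forall>t\<in>{0..1}. hopf (r t) = (1 - t) *\<^sub>R hopf b + t *\<^sub>R hopf c)"

text \<open>In a suitable real plane the Hopf map is complex squaring, so a segment is lifted by a square
  root along a segment in the closed upper half plane; the remaining phase is added linearly.\<close>

lemma hopf_lift_nonzero:
  fixes b c :: "complex \<times> complex"
  assumes b: "b \<noteq> 0"
  obtains r D S t0 where "hopf_lift b c r D S"
    "\<And>t. t \<in> {0..1} - S \<Longrightarrow>
       norm (D t) \<le> (norm b + norm c) / 2 * (1 / sqrt \<bar>t - t0\<bar>) + pi * (norm b + norm c)"
    "\<And>t \<kappa>. t \<in> {0..1} - S \<Longrightarrow> 0 < \<kappa> \<Longrightarrow> \<kappa> \<le> 1 / 16 \<Longrightarrow> norm (c - b) \<le> \<kappa> * norm b \<Longrightarrow>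
       norm (D t) \<le> (1 + 16 * \<kappa>) * norm (c - b)"
proof -
  obtain J M s \<theta> where fr: "linear J" "linear M"
    and nJ: "\<And>x y \<tau>. (norm (J x + \<tau> *\<^sub>R rot_gen (J y)))\<^sup>2 = (cmod x)\<^sup>2 + \<tau>\<^sup>2 * (cmod y)\<^sup>2"
    and hJ: "\<And>x. hopf (J x) = M (x\<^sup>2)" and Jb: "J (of_real (norm b)) = b"
    and c: "c = rot \<theta> (J s)" and th: "\<bar>\<theta>\<bar> \<le> pi" and s: "0 \<le> Re s" "0 \<le> Im s"
    by (rule hopf_frame[OF b, of c]) blast
  define n where "n = norm b"
  have n: "n > 0" using b by (simp add: n_def)
  have nJ0: "norm (J x) = cmod x" for x
    using nJ[of x 0 x] by (simp add: power2_eq_iff_nonneg)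
  have nc: "norm c = cmod s" by (simp add: c nJ0)
  define Y where "Y t = (1 - t) *\<^sub>R (of_real n)\<^sup>2 + t *\<^sub>R s\<^sup>2" for t
  define \<sigma> where "\<sigma> t = csqrt (Y t)" for t
  define V where "V = s\<^sup>2 - (of_real n)\<^sup>2"
  define r where "r t = rot (t * \<theta>) (J (\<sigma> t))" for t
  have Y_alt: "Y t = (of_real n)\<^sup>2 + t *\<^sub>R V" for t by (simp add: Y_def V_def algebra_simps)
  have ImY: "Im (Y t) \<ge> 0" if "t \<in> {0..1}" for t
    using that s n by (simp add: Y_def Im_power2)
  have \<sigma>2: "(\<sigma> t)\<^sup>2 = Y t" for t by (simp add: \<sigma>_def)
  have \<sigma>q: "0 \<le> Re (\<sigma> t)" "0 \<le> Im (\<sigma> t)" if "t \<in> {0..1}" for t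
    unfolding \<sigma>_def using csqrt_first_quadrant[OF ImY[OF that]] by auto
  have \<sigma>n: "(cmod (\<sigma> t))\<^sup>2 = cmod (Y t)" for t by (simp add: \<sigma>2 flip: norm_power)
  have \<sigma>0: "\<sigma> 0 = of_real n" and \<sigma>1: "\<sigma> 1 = s"
    unfolding \<sigma>_def using csqrt_first_quadrant_square[of "of_real n"] csqrt_first_quadrant_square[OF s] n
    by (auto simp: Y_def simp del: of_real_power csqrt.sel)
  \<comment> \<open>The values stay in the first quadrant, so the Hoelder bound gives continuity
    even if the segment enters the negative real axis, as it does for imaginary s \<noteq>
    0.\<close>
  have cont: "continuous_on {0..1} \<sigma>"
  proof (rule continuous_on_eq_continuous_within[THEN iffD2], rule ballI)
    fix t :: real assume t: "t \<in> {0..1}"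
    show "continuous (at t within {0..1}) \<sigma>"
      unfolding continuous_within
    proof (rule tendsto_dist_iff[THEN iffD2], rule Lim_null_comparison)
      show "eventually (\<lambda>x. norm (dist (\<sigma> x) (\<sigma> t)) \<le> sqrt (cmod (Y x - Y t))) (at t within {0..1})"
        unfolding eventually_at_filter
      proof (rule always_eventually, intro allI impI)
        fix x :: real assume "x \<in> {0..1}"
        then have "(cmod (\<sigma> x - \<sigma> t))\<^sup>2 \<le> cmod ((\<sigma> x)\<^sup>2 - (\<sigma> t)\<^sup>2)"
          by (intro first_quadrant_diff_le \<sigma>q t)
        then show "norm (dist (\<sigma> x) (\<sigma> t)) \<le> sqrt (cmod (Y x - Y t))"
          by (simp add: \<sigma>2 dist_norm real_le_rsqrt)
      qed
      have "((\<lambda>x. sqrt (cmod (Y x - Y t))) \<longlongrightarrow> sqrt (cmod (Y t - Y t))) (at t within {0..1})"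
        unfolding Y_def by (intro tendsto_intros)
      then show "((\<lambda>x. sqrt (cmod (Y x - Y t))) \<longlongrightarrow> 0) (at t within {0..1})" by simp
    qed
  qed
  \<comment> \<open>The line through the segment is closest to 0 at the parameter t0, whence |Y t|
    >= |V| |t - t0|; for V = 0 the quotient is 0 by convention. t0 belongs to S because 1 / sqrt 0
    is 0 and the claimed bound is meaningless there, 0 and 1 because derivatives are
    two-sided.\<close>
  define t0 where "t0 = - (Re (of_real (n\<^sup>2) * cnj V)) / (cmod V)\<^sup>2"
  define S where "S = {0, 1, t0} \<union> {t \<in> {0..1}. \<sigma> t = 0}"
  have "finite {t \<in> {0..1}. \<sigma> t = 0}"
  proof (rule finite_subset)
    \<comment> \<open>Re (Y t) is affine in t and equals n^2 > 0 at t = 0, so it has at most one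
      zero.\<close>
    show "{t \<in> {0..1}. \<sigma> t = 0} \<subseteq> {n\<^sup>2 / (n\<^sup>2 - Re (s\<^sup>2))}"
    proof
      fix t assume "t \<in> {t \<in> {0..1}. \<sigma> t = 0}"
      then have "Re (Y t) = 0" by (simp add: \<sigma>_def)
      then have e: "n\<^sup>2 + t * (Re (s\<^sup>2) - n\<^sup>2) = 0" by (simp add: Y_alt V_def Re_power2)
      have "Re (s\<^sup>2) - n\<^sup>2 \<noteq> 0" using e n by auto
      then show "t \<in> {n\<^sup>2 / (n\<^sup>2 - Re (s\<^sup>2))}" using e by (simp add: field_simps)
    qed
  qed simp
  then have finS: "finite S" by (simp add: S_def)
  define \<sigma>' where "\<sigma>' t = V / (2 * \<sigma> t)" for t
  have d\<sigma>: "(\<sigma> has_vector_derivative \<sigma>' t) (at t)" if "t \<in> {0..1} - S" for t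
    unfolding \<sigma>'_def
  proof (rule has_vector_derivative_square_root)
    show "(Y has_vector_derivative V) (at t)"
      unfolding Y_alt by (auto intro!: derivative_eq_intros)
    have "t \<in> {0<..<1}" using that by (auto simp: S_def less_le)
    then show "isCont \<sigma> t"
      using continuous_on_subset[OF cont, of "{0<..<1}"]
      by (simp add: continuous_on_eq_continuous_at subset_eq)
    show "\<sigma> t \<noteq> 0" using that by (auto simp: S_def)
  qed (simp add: \<sigma>2)
  define D where "D t = rot (t * \<theta>) (J (\<sigma>' t) + \<theta> *\<^sub>R rot_gen (J (\<sigma> t)))" for t
  have blJ: "bounded_linear J" using fr(1) linear_conv_bounded_linear by blast
  have blI: "bounded_linear rot_gen" using linear_rot_gen linear_conv_bounded_linear by blast
  have rr: "r t = cos (t * \<theta>) *\<^sub>R J (\<sigma> t) + sin (t * \<theta>) *\<^sub>R rot_gen (J (\<sigma> t))" for t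
    by (simp add: r_def rot_eq)
  have rg: "rot_gen (rot_gen x) = - x" for x by (simp add: rot_gen_def prod_eq_iff)
  have DD: "D t = cos (t * \<theta>) *\<^sub>R J (\<sigma>' t) + sin (t * \<theta>) *\<^sub>R rot_gen (J (\<sigma>' t))
      + \<theta> *\<^sub>R (cos (t * \<theta>) *\<^sub>R rot_gen (J (\<sigma> t)) - sin (t * \<theta>) *\<^sub>R J (\<sigma> t))" for t
    using linear_rot_gen by (simp add: D_def rot_eq linear_add linear_cmul rg algebra_simps)
  have dr: "(r has_vector_derivative D t) (at t)" if t: "t \<in> {0..1} - S" for t
  proof -
    note dJ = bounded_linear.has_vector_derivative[OF blJ d\<sigma>[OF t]]
    note dI = bounded_linear.has_vector_derivative[OF blI dJ]
    show ?thesis unfolding rr [abs_def] DD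
      by (rule derivative_eq_intros dJ dI | simp)+ (simp add: algebra_simps)
  qed
  have cJ: "continuous_on A (\<lambda>t. J (f t))" if "continuous_on A f" for A f
    using bounded_linear.continuous_on[OF blJ that] .
  have cI: "continuous_on A (\<lambda>t. rot_gen (f t))" if "continuous_on A f" for A f
    using bounded_linear.continuous_on[OF blI that] .
  have lift: "hopf_lift b c r D S"
    unfolding hopf_lift_def
  proof (intro conjI ballI finS dr)
    show "continuous_on {0..1} r"
      unfolding rr [abs_def] by (intro continuous_intros cJ cI cont)
    have "continuous_on ({0..1} - S) \<sigma>" using cont by (rule continuous_on_subset) auto
    moreover then have "continuous_on ({0..1} - S) \<sigma>'"
      unfolding \<sigma>'_def by (intro continuous_intros) (auto simp: S_def)
    ultimately show "continuous_on ({0..1} - S) D"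
      unfolding DD [abs_def] by (intro continuous_intros cJ cI)
    show "r 0 = b" by (simp add: r_def \<sigma>0 Jb n_def)
    show "r 1 = c" by (simp add: r_def \<sigma>1 c)
    fix t :: real
    have "hopf (r t) = M (Y t)" by (simp add: r_def hJ \<sigma>2)
    also have "\<dots> = (1 - t) *\<^sub>R M ((of_real n)\<^sup>2) + t *\<^sub>R M (s\<^sup>2)"
      unfolding Y_def using fr(2) by (simp only: linear_add linear_cmul)
    also have "\<dots> = (1 - t) *\<^sub>R hopf b + t *\<^sub>R hopf c"
      using hJ[of s] hJ[of "of_real n"] Jb by (simp add: c n_def)
    finally show "hopf (r t) = (1 - t) *\<^sub>R hopf b + t *\<^sub>R hopf c" .
  qed
  have n\<sigma>': "cmod (\<sigma>' t) = cmod V / (2 * cmod (\<sigma> t))" for t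
    by (simp add: \<sigma>'_def norm_divide norm_mult)
  \<comment> \<open>Pythagoras: by the choice of the frame the velocity of the square root is
    orthogonal to that of the phase. Adding norms instead would lose the factor close to 1 in the
    sharp bound.\<close>
  have nD: "(norm (D t))\<^sup>2 = (cmod (\<sigma>' t))\<^sup>2 + \<theta>\<^sup>2 * (cmod (\<sigma> t))\<^sup>2" for t
    by (simp add: D_def nJ)
  have Ybd: "cmod (Y t) \<le> max (n\<^sup>2) ((cmod s)\<^sup>2)" if "t \<in> {0..1}" for t
  proof -
    have "cmod (Y t) \<le> (1 - t) * n\<^sup>2 + t * (cmod s)\<^sup>2"
      unfolding Y_def using that by (intro order_trans[OF norm_triangle_ineq]) (simp add: norm_power)
    also have "\<dots> \<le> (1 - t) * max (n\<^sup>2) ((cmod s)\<^sup>2) + t * max (n\<^sup>2) ((cmod s)\<^sup>2)"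
      using that by (intro add_mono mult_left_mono) auto
    finally show ?thesis by (simp add: algebra_simps)
  qed
  have nV: "cmod V \<le> (n + cmod s)\<^sup>2"
  proof -
    have "cmod V \<le> (cmod s)\<^sup>2 + n\<^sup>2"
      unfolding V_def by (rule order_trans[OF norm_triangle_ineq4]) (simp add: norm_power)
    then show ?thesis using n by (simp add: power2_sum) (smt (verit) mult_nonneg_nonneg norm_ge_zero)
  qed
  have far: "norm (D t) \<le> (norm b + norm c) / 2 * (1 / sqrt \<bar>t - t0\<bar>) + pi * (norm b + norm c)"
    if t: "t \<in> {0..1} - S" for t
  proof -
    have \<sigma>nz: "\<sigma> t \<noteq> 0" using t by (auto simp: S_def)
    have "norm (D t) \<le> cmod (\<sigma>' t) + \<bar>\<theta>\<bar> * cmod (\<sigma> t)"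
    proof (rule power2_le_imp_le)
      show "(norm (D t))\<^sup>2 \<le> (cmod (\<sigma>' t) + \<bar>\<theta>\<bar> * cmod (\<sigma> t))\<^sup>2"
        unfolding nD by (simp add: power2_sum power_mult_distrib)
    qed simp
    moreover have "cmod (\<sigma>' t) \<le> (n + cmod s) / 2 * (1 / sqrt \<bar>t - t0\<bar>)"
    proof (cases "V = 0")
      case True
      then show ?thesis using n by (simp add: \<sigma>'_def)
    next
      case V: False
      have tt: "t \<noteq> t0" using t by (auto simp: S_def)
      have "cmod V * \<bar>t - t0\<bar> \<le> cmod (Y t)"
      proof -
        have "(cmod V * \<bar>t - t0\<bar>) * cmod V = \<bar>Re (Y t * cnj V)\<bar>"
        proof -
          have "Re (V * cnj V) = (cmod V)\<^sup>2" by (metis Re_complex_of_real complex_norm_square)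
          then have "Re (Y t * cnj V) = Re (of_real (n\<^sup>2) * cnj V) + t * (cmod V)\<^sup>2"
            by (simp add: Y_alt distrib_right del: times_complex.sel)
          also have "\<dots> = (t - t0) * (cmod V)\<^sup>2" using V by (simp add: t0_def field_simps del: times_complex.sel)
          finally show ?thesis by (simp add: abs_mult power2_eq_square del: times_complex.sel)
        qed
        also have "\<dots> \<le> cmod (Y t) * cmod V"
          by (metis abs_Re_le_cmod norm_mult complex_mod_cnj)
        finally show ?thesis using V by (simp only: mult_le_cancel_right) auto
      qed
      then have "sqrt (cmod V) * sqrt \<bar>t - t0\<bar> \<le> cmod (\<sigma> t)"
        by (metis \<sigma>n real_sqrt_le_mono real_sqrt_mult real_sqrt_abs abs_norm_cancel)
      moreover have sq: "sqrt (cmod V) > 0" "sqrt \<bar>t - t0\<bar> > 0" using V tt by auto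
      ultimately have "cmod (\<sigma>' t) \<le> cmod V / (2 * (sqrt (cmod V) * sqrt \<bar>t - t0\<bar>))"
        unfolding n\<sigma>' by (intro divide_left_mono) (auto intro!: mult_pos_pos simp: \<sigma>nz)
      also have "\<dots> = sqrt (cmod V) / 2 * (1 / sqrt \<bar>t - t0\<bar>)"
        using sq by (simp add: field_simps)
      also have "\<dots> \<le> (n + cmod s) / 2 * (1 / sqrt \<bar>t - t0\<bar>)"
        using nV n by (intro mult_right_mono divide_right_mono real_le_lsqrt) auto
      finally show ?thesis .
    qed
    moreover have "\<bar>\<theta>\<bar> * cmod (\<sigma> t) \<le> pi * (n + cmod s)"
    proof (rule mult_mono[OF th])
      have "(cmod (\<sigma> t))\<^sup>2 \<le> (n + cmod s)\<^sup>2"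
        unfolding \<sigma>n
      proof (rule order_trans[OF Ybd])
        show "max (n\<^sup>2) ((cmod s)\<^sup>2) \<le> (n + cmod s)\<^sup>2"
          using n by (intro max.boundedI power_mono) auto
      qed (use t in auto)
      then show "cmod (\<sigma> t) \<le> n + cmod s" by (rule power2_le_imp_le) (use n in auto)
    qed auto
    ultimately show ?thesis unfolding nc n_def [symmetric] by linarith
  qed
  have near: "norm (D t) \<le> (1 + 16 * \<kappa>) * norm (c - b)"
    if t: "t \<in> {0..1} - S" and k: "0 < \<kappa>" "\<kappa> \<le> 1 / 16" and bc: "norm (c - b) \<le> \<kappa> * norm b" for t \<kappa>
  proof (rule power2_le_imp_le)
    define e w q where "e = cmod (s - of_real n)" and "w = 1 - cos \<theta>" and "q = (norm (c - b))\<^sup>2"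
    have w0: "w \<ge> 0" by (simp add: w_def)
    \<comment> \<open>Law of cosines: e measures the displacement inside the plane and w the one by
      the phase. Each part of the velocity is compared with its own summand.\<close>
    have q: "q = e\<^sup>2 + 2 * n * Re s * w"
    proof -
      have "c - b = J (cos \<theta> *\<^sub>R s - of_real n) + sin \<theta> *\<^sub>R rot_gen (J s)"
        using fr(1) Jb by (simp add: c rot_eq linear_diff linear_cmul n_def)
      then have "q = (cmod (cos \<theta> *\<^sub>R s - of_real n))\<^sup>2 + (sin \<theta>)\<^sup>2 * (cmod s)\<^sup>2"
        by (simp add: q_def nJ)
      also have "\<dots> = (cos \<theta> * Re s - n)\<^sup>2 + (cos \<theta> * Im s)\<^sup>2 + (sin \<theta>)\<^sup>2 * ((Re s)\<^sup>2 + (Im s)\<^sup>2)"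
        by (simp add: cmod_power2)
      also have "\<dots> = (Re s - n)\<^sup>2 + (Im s)\<^sup>2 + 2 * n * Re s * (1 - cos \<theta>)"
        using sin_cos_squared_add[of \<theta>] by algebra
      also have "(Re s - n)\<^sup>2 + (Im s)\<^sup>2 = e\<^sup>2" by (simp add: e_def cmod_power2)
      finally show ?thesis by (simp add: w_def)
    qed
    have e0: "e \<ge> 0" by (simp add: e_def)
    have qle: "q \<le> (\<kappa> * n)\<^sup>2" unfolding q_def n_def by (rule power_mono[OF bc]) simp
    have "e\<^sup>2 \<le> (\<kappa> * n)\<^sup>2" using qle q s n w0 by (smt (verit) mult_nonneg_nonneg)
    then have e: "e \<le> \<kappa> * n" by (rule power2_le_imp_le) (use k n in auto)
    have "\<bar>Re s - n\<bar> \<le> e" unfolding e_def using abs_Re_le_cmod[of "s - of_real n"] by simp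
    then have Res: "Re s \<ge> (1 - \<kappa>) * n" using e by (simp add: algebra_simps)
    have "2 * n * ((1 - \<kappa>) * n) * w \<le> 2 * n * Re s * w"
      using Res n w0 by (intro mult_right_mono mult_left_mono) auto
    also have "\<dots> \<le> (\<kappa> * n)\<^sup>2" using qle q by (smt (verit) zero_le_power2)
    finally have "n\<^sup>2 * (2 * (1 - \<kappa>) * w) \<le> n\<^sup>2 * \<kappa>\<^sup>2" by (simp add: power2_eq_square algebra_simps)
    then have "2 * (1 - \<kappa>) * w \<le> \<kappa>\<^sup>2" using n by simp
    moreover have "1 * w \<le> 2 * (1 - \<kappa>) * w" using k w0 by (intro mult_right_mono) auto
    moreover have "\<kappa>\<^sup>2 \<le> \<kappa>" using k by (simp add: power2_eq_square mult_left_le)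
    ultimately have w: "w \<le> \<kappa>" by linarith
    have "cmod (s + of_real n) \<le> e + 2 * n"
      unfolding e_def using norm_triangle_ineq[of "s - of_real n" "2 * of_real n"] n by (simp add: norm_mult add.commute)
    then have "cmod (s + of_real n) \<le> (2 + \<kappa>) * n" using e by (simp add: algebra_simps)
    then have V: "cmod V \<le> e * ((2 + \<kappa>) * n)"
      unfolding V_def e_def
      by (simp add: power2_eq_square square_diff_square_factored norm_mult mult.commute mult_left_mono)
    have "e * ((2 + \<kappa>) * n) \<le> (\<kappa> * n) * (3 * n)"
      using e k n by (intro mult_mono) auto
    then have V3: "cmod V \<le> 3 * \<kappa> * n\<^sup>2" using V by (simp add: power2_eq_square algebra_simps)
    have "cmod (Y t - (of_real n)\<^sup>2) \<le> cmod V"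
      using t by (simp add: Y_alt mult_left_le_one_le)
    then have "cmod (Y t - (of_real n)\<^sup>2) \<le> 3 * \<kappa> * n\<^sup>2" using V3 by linarith
    moreover have "cmod ((of_real n)\<^sup>2) = n\<^sup>2" by (simp add: norm_power)
    ultimately have \<sigma>: "(1 - 3 * \<kappa>) * n\<^sup>2 \<le> (cmod (\<sigma> t))\<^sup>2" "(cmod (\<sigma> t))\<^sup>2 \<le> (1 + 3 * \<kappa>) * n\<^sup>2"
      unfolding \<sigma>n using norm_triangle_ineq2[of "Y t" "(of_real n)\<^sup>2"] norm_triangle_ineq3[of "Y t" "(of_real n)\<^sup>2"]
      by (auto simp: algebra_simps)
    have pos: "0 < (1 - 3 * \<kappa>) * n\<^sup>2" using k n by simp
    \<comment> \<open>K1 and, below, K2 are the source of the constant 16: the factor 1 + 16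
      \<kappa> has to absorb (2 + \<kappa>)^2 / (4 (1 - 3 \<kappa>)) for the square root and (1 + 3
      \<kappa>) / (1 - \<kappa>)^2 for the phase. The bound \<kappa> \<le> 1/16 controls the
      quadratic remainders.\<close>
    have K1: "(2 + \<kappa>)\<^sup>2 \<le> 4 * (1 + 16 * \<kappa>) * (1 - 3 * \<kappa>)"
    proof -
      have "\<kappa> * (193 * \<kappa>) \<le> \<kappa> * 48" using k by (intro mult_left_mono) auto
      then show ?thesis by (simp add: power2_eq_square algebra_simps)
    qed
    have "(cmod (\<sigma>' t))\<^sup>2 = (cmod V)\<^sup>2 / (4 * (cmod (\<sigma> t))\<^sup>2)"
      unfolding n\<sigma>' by (simp add: power_divide power_mult_distrib)
    also have "\<dots> \<le> (e * ((2 + \<kappa>) * n))\<^sup>2 / (4 * ((1 - 3 * \<kappa>) * n\<^sup>2))"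
      using \<sigma> pos V by (intro frac_le power_mono) auto
    also have "\<dots> = e\<^sup>2 * ((2 + \<kappa>)\<^sup>2 / (4 * (1 - 3 * \<kappa>)))"
      using n k by (simp add: power_mult_distrib)
    also have "\<dots> \<le> e\<^sup>2 * (1 + 16 * \<kappa>)"
      using K1 k by (intro mult_left_mono) (auto simp: field_simps)
    finally have 1: "(cmod (\<sigma>' t))\<^sup>2 \<le> (1 + 16 * \<kappa>) * e\<^sup>2" by (simp add: mult.commute)
    have K2: "1 + 3 * \<kappa> \<le> (1 + 16 * \<kappa>) * ((1 - \<kappa>) * (1 - \<kappa>))"
    proof -
      have "\<kappa> * (31 * \<kappa>) \<le> \<kappa> * (11 + 16 * \<kappa>\<^sup>2)" using k by (intro mult_left_mono) (auto simp: add_increasing2)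
      then show ?thesis by (simp add: power2_eq_square algebra_simps)
    qed
    \<comment> \<open>Since w \<le> \<kappa>, the correction factor in
      \<open>square_le_one_minus_cos\<close> is at least 1 - \<kappa>.\<close>
    have "\<theta>\<^sup>2 * (1 - \<kappa>) \<le> \<theta>\<^sup>2 * (1 - w / 2)" using w k w0 by (intro mult_left_mono) auto
    also have "\<dots> \<le> 2 * w" using square_le_one_minus_cos[OF th] by (simp add: w_def)
    finally have th2: "\<theta>\<^sup>2 * (1 - \<kappa>) \<le> 2 * w" .
    have "\<theta>\<^sup>2 * (cmod (\<sigma> t))\<^sup>2 \<le> \<theta>\<^sup>2 * ((1 + 3 * \<kappa>) * n\<^sup>2)"
      using \<sigma> by (intro mult_left_mono) auto
    also have "\<dots> \<le> \<theta>\<^sup>2 * ((1 + 16 * \<kappa>) * ((1 - \<kappa>) * (1 - \<kappa>)) * n\<^sup>2)"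
      using K2 by (intro mult_left_mono mult_right_mono) auto
    also have "\<dots> = (1 + 16 * \<kappa>) * n * (((1 - \<kappa>) * n) * (\<theta>\<^sup>2 * (1 - \<kappa>)))"
      by (simp add: power2_eq_square)
    also have "\<dots> \<le> (1 + 16 * \<kappa>) * n * (Re s * (2 * w))"
      using k n s by (intro mult_left_mono mult_mono[OF Res th2]) auto
    finally have "(norm (D t))\<^sup>2 \<le> (1 + 16 * \<kappa>) * q"
      unfolding nD q using 1 by (simp add: algebra_simps)
    also have "\<dots> \<le> (1 + 16 * \<kappa>)\<^sup>2 * q"
      using k by (intro mult_right_mono) (auto simp: q_def self_le_power)
    finally show "(norm (D t))\<^sup>2 \<le> ((1 + 16 * \<kappa>) * norm (c - b))\<^sup>2"
      by (simp add: q_def power_mult_distrib)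
  qed (use k in auto)
  show thesis by (rule that[OF lift far near]) auto
qed

lemma hopf_lift_reverse:
  assumes "hopf_lift b c r D S"
  shows "hopf_lift c b (\<lambda>t. r (1 - t)) (\<lambda>t. - D (1 - t)) ((\<lambda>t. 1 - t) ` S)"
  unfolding hopf_lift_def
proof (intro conjI ballI)
  have *: "1 - t \<in> {0..1} - S" if "t \<in> {0..1} - (\<lambda>t. 1 - t) ` S" for t :: real
    using that by (auto simp: image_iff)
  show "finite ((\<lambda>t. 1 - t) ` S)" using assms by (simp add: hopf_lift_def)
  show "continuous_on {0..1} (\<lambda>t. r (1 - t))"
    by (rule continuous_on_compose2[of "{0..1}" r])
       (use assms in \<open>auto simp: hopf_lift_def intro!: continuous_on_diff continuous_on_const continuous_on_id\<close>)
  show "continuous_on ({0..1} - (\<lambda>t. 1 - t) ` S) (\<lambda>t. - D (1 - t))"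
    by (rule continuous_on_minus, rule continuous_on_compose2[of "{0..1} - S" D])
      (use assms * in \<open>auto simp: hopf_lift_def intro!: continuous_on_diff continuous_on_const continuous_on_id\<close>)
  show "((\<lambda>t. r (1 - t)) has_vector_derivative - D (1 - t)) (at t)"
    if "t \<in> {0..1} - (\<lambda>t. 1 - t) ` S" for t
  proof -
    have "(r has_vector_derivative D (1 - t)) (at (1 - t))"
      using assms *[OF that] by (auto simp: hopf_lift_def)
    moreover have "((\<lambda>t. 1 - t) has_vector_derivative - 1) (at t)"
      by (auto intro!: derivative_eq_intros)
    ultimately show ?thesis
      using vector_diff_chain_at[of "\<lambda>t. 1 - t" "-1" t r "D (1 - t)"] by (simp add: o_def)
  qed
  show "r (1 - 0) = c" "r (1 - 1) = b" using assms by (simp_all add: hopf_lift_def)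
  fix t :: real assume "t \<in> {0..1}"
  then have "hopf (r (1 - t)) = (1 - (1 - t)) *\<^sub>R hopf b + (1 - t) *\<^sub>R hopf c"
    using assms by (auto simp: hopf_lift_def)
  then show "hopf (r (1 - t)) = (1 - t) *\<^sub>R hopf c + t *\<^sub>R hopf b" by simp
qed

text \<open>A frame exists as soon as one endpoint is nonzero. If that is c, a lift starting at c is
  run backwards, which moves the singular time to 1 - t0; for b = c = 0 the constant lift
  serves.\<close>

lemma hopf_lift_far:
  fixes b c :: "complex \<times> complex"
  obtains r D S t0 where "hopf_lift b c r D S"
    "\<And>t. t \<in> {0..1} - S \<Longrightarrow>
       norm (D t) \<le> (norm b + norm c) / 2 * (1 / sqrt \<bar>t - t0\<bar>) + pi * (norm b + norm c)"
proof -
  consider "b \<noteq> 0" | "c \<noteq> 0" | "b = 0" "c = 0" by blast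
  then show thesis
  proof cases
    case 1
    then show thesis by (rule hopf_lift_nonzero[of b c]) (rule that)
  next
    case 2
    obtain r D S t0 where L: "hopf_lift c b r D S"
      and B: "\<And>t. t \<in> {0..1} - S \<Longrightarrow>
       norm (D t) \<le> (norm c + norm b) / 2 * (1 / sqrt \<bar>t - t0\<bar>) + pi * (norm c + norm b)"
      using hopf_lift_nonzero[OF 2, of b] by metis
    show thesis
    proof (rule that[OF hopf_lift_reverse[OF L]])
      fix t assume t: "t \<in> {0..1} - (\<lambda>t. 1 - t) ` S"
      have "1 - t \<in> {0..1} - S"
        using t by (auto simp: image_iff)
      from B[OF this] show "norm (- D (1 - t))
          \<le> (norm b + norm c) / 2 * (1 / sqrt \<bar>t - (1 - t0)\<bar>) + pi * (norm b + norm c)"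
        by (simp add: add.commute abs_minus_commute algebra_simps)
    qed
  next
    case 3
    have "hopf_lift b c (\<lambda>_. 0) (\<lambda>_. 0) {}" using 3 by (simp add: hopf_lift_def)
    then show thesis by (rule that) (simp add: 3)
  qed
qed

text \<open>In the fibre over y the point \<open>J s\<close>, which is in phase with b, is close to
  b: on the first quadrant the inverse of squaring is Hoelder continuous, and M halves norms. At b =
  0 the estimate is an equality, so the exponent 1/2 is optimal.\<close>

lemma hopf_open:
  obtains c where "hopf c = y" "(norm (c - b))\<^sup>2 \<le> 2 * norm (y - hopf b)"
proof (cases "b = 0")
  case True
  obtain c where c: "hopf c = y" using hopf_surj by blast
  show thesis by (rule that[OF c]) (simp add: True norm_hopf flip: c)
next
  case False
  obtain c where c: "hopf c = y" using hopf_surj by blast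
  obtain J M s \<theta> where fr: "linear J" "linear M"
    and nJ: "\<And>x y \<tau>. (norm (J x + \<tau> *\<^sub>R rot_gen (J y)))\<^sup>2 = (cmod x)\<^sup>2 + \<tau>\<^sup>2 * (cmod y)\<^sup>2"
    and hJ: "\<And>x. hopf (J x) = M (x\<^sup>2)" and Jb: "J (of_real (norm b)) = b"
    and cr: "c = rot \<theta> (J s)" and s: "0 \<le> Re s" "0 \<le> Im s"
    by (rule hopf_frame[OF False, of c]) blast
  have nJ0: "(norm (J x))\<^sup>2 = (cmod x)\<^sup>2" for x
    using nJ[of x 0 x] by simp
  \<comment> \<open>Every complex number is a square, so \<open>norm_hopf\<close> determines the
    norm of M everywhere.\<close>
  have nM: "norm (M v) = cmod v / 2" for v
  proof -
    have "M v = hopf (J (csqrt v))" by (simp add: hJ)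
    then show ?thesis by (simp add: norm_hopf nJ0 flip: norm_power)
  qed
  show thesis
  proof (rule that)
    show "hopf (J s) = y" using c cr by simp
    have "J s - b = J (s - of_real (norm b))" using fr(1) Jb by (simp add: linear_diff)
    then have "(norm (J s - b))\<^sup>2 = (cmod (s - of_real (norm b)))\<^sup>2" by (simp add: nJ0)
    also have "\<dots> \<le> cmod (s\<^sup>2 - (of_real (norm b))\<^sup>2)"
      using s by (intro first_quadrant_diff_le) auto
    also have "\<dots> = 2 * norm (M (s\<^sup>2 - (of_real (norm b))\<^sup>2))" by (simp add: nM)
    also have "M (s\<^sup>2 - (of_real (norm b))\<^sup>2) = y - hopf b"
      using fr(2) hJ[of s] hJ[of "of_real (norm b)"] Jb c cr by (simp add: linear_diff)
    finally show "(norm (J s - b))\<^sup>2 \<le> 2 * norm (y - hopf b)" .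
  qed
qed

section \<open>Coordinates of the flat space\<close>

definition coord :: "'d \<Rightarrow> 'd::finite quat \<Rightarrow> complex \<times> complex" where
  "coord k p = (fst p $ k, snd p $ k)"

definition of_coords :: "('d \<Rightarrow> complex \<times> complex) \<Rightarrow> 'd::finite quat" where
  "of_coords f = ((\<chi> k. fst (f k)), (\<chi> k. snd (f k)))"

lemma coord_of_coords [simp]: "coord k (of_coords f) = f k"
  by (simp add: coord_def of_coords_def)

lemma quat_eqI: "(\<And>k. coord k p = coord k q) \<Longrightarrow> p = q"
  by (auto simp: coord_def prod_eq_iff vec_eq_iff)

lemma of_coords_coord [simp]: "of_coords (\<lambda>k. coord k p) = p"
  by (rule quat_eqI) simp

lemma linear_coord: "linear (coord k)"
  by (rule linearI) (simp_all add: coord_def)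

lemmas coord_linear [simp] =
  linear_0[OF linear_coord] linear_add[OF linear_coord] linear_diff[OF linear_coord]
  linear_neg[OF linear_coord] linear_cmul[OF linear_coord]

lemma bounded_linear_coord: "bounded_linear (coord k)"
  using linear_coord linear_conv_bounded_linear by blast

lemma norm_quat: "(norm p)\<^sup>2 = (\<Sum>k\<in>UNIV. (norm (coord k p))\<^sup>2)"
  by (simp add: norm_prod_def coord_def norm_vec_def L2_set_def sum_nonneg sum.distrib)

lemma norm_coord_le: "norm (coord k p) \<le> norm p"
proof (rule power2_le_imp_le)
  show "(norm (coord k p))\<^sup>2 \<le> (norm p)\<^sup>2"
    unfolding norm_quat by (rule member_le_sum) auto
qed simp

lemma norm_quat_le_sum: "norm p \<le> (\<Sum>k\<in>UNIV. norm (coord k p))"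
proof (rule power2_le_imp_le)
  have "(norm p)\<^sup>2 \<le> (L2_set (\<lambda>k. norm (coord k p)) UNIV)\<^sup>2"
    by (simp add: norm_quat L2_set_def sum_nonneg)
  also have "\<dots> \<le> (\<Sum>k\<in>UNIV. norm (coord k p))\<^sup>2"
    by (rule power_mono[OF L2_set_le_sum]) (auto simp: L2_set_nonneg)
  finally show "(norm p)\<^sup>2 \<le> (\<Sum>k\<in>UNIV. norm (coord k p))\<^sup>2" .
qed (simp add: sum_nonneg)

lemma moment_coeff_eq: "moment_coeff p k = hopf (coord k p)"
  by (simp add: moment_coeff_def hopf_def coord_def)

lemma level_set_iff:
  "p \<in> level_set \<iota> \<zeta> \<longleftrightarrow> (\<forall>l. (\<Sum>k\<in>UNIV. \<iota> l $ k *\<^sub>R hopf (coord k p)) = - blinfun_apply \<zeta> l)"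
  by (simp add: level_set_def moment_N_def moment_def fun_eq_iff moment_coeff_eq uminus_blinfun.rep_eq)

section \<open>The torus action in coordinates\<close>

lemma torus_iff: "\<tau> \<in> torus \<longleftrightarrow> (\<forall>k. cmod (\<tau> $ k) = 1)"
proof
  assume "\<forall>k. cmod (\<tau> $ k) = 1"
  then have "\<tau> = torus_exp (\<chi> k. Arg (\<tau> $ k))"
    using rcis_cmod_Arg by (simp add: torus_exp_def vec_eq_iff) (metis mult_1 of_real_1 rcis_def)
  then show "\<tau> \<in> torus" by (auto simp: torus_def)
qed (auto simp: torus_def torus_exp_def)

lemma coord_torus_exp: "coord k (torus_act (torus_exp x) p) = rot (x $ k) (coord k p)"
  by (simp add: coord_def torus_act_def torus_exp_def rot_def)

lemma torus_act_mult: "torus_act (\<sigma> * \<tau>) p = torus_act \<sigma> (torus_act \<tau> p)"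
  by (simp add: torus_act_def vec_eq_iff mult.commute mult.left_commute)

lemma torus_act_one [simp]: "torus_act 1 p = p"
  by (simp add: torus_act_def vec_eq_iff prod_eq_iff)

lemma linear_torus_act: "linear (torus_act \<tau>)"
  by (rule linearI) (simp_all add: torus_act_def vec_eq_iff prod_eq_iff algebra_simps scaleR_conv_of_real)

lemma bounded_linear_torus_act: "bounded_linear (torus_act \<tau>)"
  using linear_torus_act linear_conv_bounded_linear by blast

lemma norm_torus_act [simp]:
  assumes "\<tau> \<in> torus"
  shows "norm (torus_act \<tau> p) = norm p"
proof -
  obtain x where "\<tau> = torus_exp x" using assms by (auto simp: torus_def)
  then have "(norm (torus_act \<tau> p))\<^sup>2 = (norm p)\<^sup>2" by (simp add: norm_quat coord_torus_exp)
  then show ?thesis by simp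
qed

lemma norm_torus_act_diff:
  assumes "\<tau> \<in> torus"
  shows "norm (torus_act \<tau> p - torus_act \<tau> q) = norm (p - q)"
  using norm_torus_act[OF assms, of "p - q"] by (simp add: linear_diff[OF linear_torus_act])

lemma hopf_torus_act:
  assumes "\<tau> \<in> torus"
  shows "hopf (coord k (torus_act \<tau> p)) = hopf (coord k p)"
proof -
  obtain x where "\<tau> = torus_exp x" using assms by (auto simp: torus_def)
  then show ?thesis by (simp add: coord_torus_exp)
qed

lemma torus_exp_add: "torus_exp (x + y) = torus_exp x * torus_exp y"
  by (simp add: torus_exp_def vec_eq_iff cis_mult)

lemma torus_exp_zero [simp]: "torus_exp 0 = 1"
  by (simp add: torus_exp_def vec_eq_iff)

lemma level_set_torus_act:
  assumes "\<tau> \<in> torus"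
  shows "torus_act \<tau> p \<in> level_set \<iota> \<zeta> \<longleftrightarrow> p \<in> level_set \<iota> \<zeta>"
  by (simp add: level_set_iff hopf_torus_act[OF assms])

section \<open>Fundamental fields and coordinatewise calculus\<close>

definition fund :: "real ^ 'd \<Rightarrow> 'd quat \<Rightarrow> 'd::finite quat" where
  "fund x p = of_coords (\<lambda>k. x $ k *\<^sub>R rot_gen (coord k p))"

lemma coord_fund [simp]: "coord k (fund x p) = x $ k *\<^sub>R rot_gen (coord k p)"
  by (simp add: fund_def)

lemma linear_of_coords_single: "linear (\<lambda>h. of_coords (\<lambda>j. if j = k then h else 0))"
  by (rule linearI; rule quat_eqI) auto

lemma quat_sum_coords: "p = (\<Sum>k\<in>UNIV. of_coords (\<lambda>j. if j = k then coord k p else 0))"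
  by (rule quat_eqI) (simp add: linear_sum[OF linear_coord] sum.delta')

lemma has_vector_derivative_quatI:
  fixes f :: "real \<Rightarrow> 'd::finite quat"
  assumes "\<And>k. ((\<lambda>t. coord k (f t)) has_vector_derivative coord k D) (at t within S)"
  shows "(f has_vector_derivative D) (at t within S)"
proof -
  have "((\<lambda>t. \<Sum>k\<in>UNIV. of_coords (\<lambda>j. if j = k then coord k (f t) else 0)) has_vector_derivative
      (\<Sum>k\<in>UNIV. of_coords (\<lambda>j. if j = k then coord k D else 0))) (at t within S)"
    by (intro has_vector_derivative_sum bounded_linear.has_vector_derivative[OF _ assms]
        linear_of_coords_single linear_conv_bounded_linear[THEN iffD1])
  then show ?thesis by (simp flip: quat_sum_coords)
qed

lemma continuous_on_quatI:
  assumes "\<And>k. continuous_on S (\<lambda>t. coord k (f t))"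
  shows "continuous_on S f"
proof -
  have "continuous_on S (\<lambda>t. fst (f t) $ k)" "continuous_on S (\<lambda>t. snd (f t) $ k)" for k
    using continuous_on_fst[OF assms[of k]] continuous_on_snd[OF assms[of k]] by (simp_all add: coord_def)
  then have "continuous_on S (\<lambda>t. (\<chi> k. fst (f t) $ k, \<chi> k. snd (f t) $ k))"
    by (intro continuous_on_Pair continuous_on_vec_lambda)
  then show ?thesis by simp
qed

lemma has_vector_derivative_rot:
  assumes "(g has_vector_derivative g') (at t within S)" "(a has_vector_derivative a') (at t within S)"
  shows "((\<lambda>t. rot (a t) (g t)) has_vector_derivative
     rot (a t) (g' + a' *\<^sub>R rot_gen (g t))) (at t within S)"
proof -
  have bl: "bounded_linear rot_gen" using linear_rot_gen linear_conv_bounded_linear by blast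
  have rg: "rot_gen (rot_gen x) = - x" for x by (simp add: rot_gen_def prod_eq_iff)
  have a: "(a has_real_derivative a') (at t within S)"
    using assms(2) by (simp add: has_real_derivative_iff_has_vector_derivative)
  note dI = bounded_linear.has_vector_derivative[OF bl assms(1)]
  show ?thesis
    unfolding rot_eq
    by (rule derivative_eq_intros dI assms(1) a | simp)+
       (use linear_rot_gen in \<open>simp add: linear_add linear_cmul rg algebra_simps\<close>)
qed

lemma fundamental_field_eq: "fundamental_field x p = fund x p"
  unfolding fundamental_field_def
proof (rule vector_derivative_at, rule has_vector_derivative_quatI)
  fix k
  have "((\<lambda>s. rot (s * x $ k) (coord k p)) has_vector_derivative rot (0 * x $ k) (0 + x $ k *\<^sub>R rot_gen (coord k p))) (at 0)"
    by (rule has_vector_derivative_rot) (auto intro!: derivative_eq_intros)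
  then show "((\<lambda>s. coord k (torus_act (torus_exp (s *\<^sub>R x)) p)) has_vector_derivative coord k (fund x p)) (at 0)"
    by (simp add: coord_torus_exp)
qed

lemma linear_fund: "linear (fund x)"
  by (rule linearI; rule quat_eqI) (use linear_rot_gen in \<open>simp_all add: linear_add linear_cmul algebra_simps\<close>)

lemma bounded_linear_fund: "bounded_linear (fund x)"
  using linear_fund linear_conv_bounded_linear by blast

lemma torus_act_fund:
  shows "torus_act \<tau> (fund x p) = fund x (torus_act \<tau> p)"
  by (rule quat_eqI) (simp add: coord_def torus_act_def fund_def of_coords_def rot_gen_def prod_eq_iff scaleR_conv_of_real)

section \<open>Quotient lengths of curves\<close>

definition qspeed :: "(complex ^ 'd) set \<Rightarrow> (real \<Rightarrow> 'd::finite quat) \<Rightarrow> real \<Rightarrow> real" where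
  "qspeed N c t = infdist (vector_derivative c (at t)) (vertical_space N (c t))"

lemma quotient_length_eq: "quotient_length N c = (\<integral>\<^sup>+t\<in>{0..1}. ennreal (qspeed N c t) \<partial>lborel)"
  by (simp add: quotient_length_def qspeed_def)

lemma qspeed_nonneg: "qspeed N c t \<ge> 0"
  by (simp add: qspeed_def infdist_nonneg)

lemma vertical_space_eq: "vertical_space N p = (\<lambda>x. fund x p) ` lie_algebra N"
  by (simp add: vertical_space_def fundamental_field_eq)

section \<open>The distance from the vertical space\<close>

lemma zero_in_lie_algebra: "1 \<in> N \<Longrightarrow> 0 \<in> lie_algebra N"
  by (simp add: lie_algebra_def)

lemma lie_algebra_uminus: "x \<in> lie_algebra N \<Longrightarrow> - x \<in> lie_algebra N"
  unfolding lie_algebra_def by (auto, metis minus_minus scaleR_minus_left scaleR_minus_right)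

lemma fund_uminus_left: "fund (- x) p = - fund x p"
  by (rule quat_eqI) simp

lemma fund_zero_left [simp]: "fund 0 p = 0"
  by (rule quat_eqI) simp

lemma infdist_less_iff:
  assumes "A \<noteq> {}"
  shows "infdist v A < a \<longleftrightarrow> (\<exists>x\<in>A. dist v x < a)"
  using assms by (simp add: infdist_notempty cINF_less_iff)

lemma infdist_vertical_less_iff:
  assumes "1 \<in> N"
  shows "infdist v (vertical_space N p) < a \<longleftrightarrow> (\<exists>x\<in>lie_algebra N. norm (v - fund x p) < a)"
  unfolding vertical_space_eq
  using zero_in_lie_algebra[OF assms] by (subst infdist_less_iff) (auto simp: dist_norm)

lemma infdist_minus_vertical: "infdist (- v) (vertical_space N p) = infdist v (vertical_space N p)"
proof -
  have sub: "infdist (- v) (vertical_space N p) \<le> infdist v (vertical_space N p)" for v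
  proof (cases "vertical_space N p = {}")
    case False
    then show ?thesis
      unfolding infdist_notempty[OF False]
    proof (rule cINF_mono)
      fix y assume "y \<in> vertical_space N p"
      then have "- y \<in> vertical_space N p"
        by (auto simp: vertical_space_eq fund_uminus_left [symmetric] intro: lie_algebra_uminus)
      moreover have "dist (- v) (- y) \<le> dist v y" by (simp add: dist_norm norm_minus_commute)
      ultimately show "\<exists>x\<in>vertical_space N p. dist (- v) x \<le> dist v y" by blast
    qed auto
  qed (simp add: infdist_def)
  from sub[of v] sub[of "- v"] show ?thesis by simp
qed

lemma infdist_scaleR:
  fixes v :: "'a::real_normed_vector"
  assumes "a > 0"
  shows "infdist (a *\<^sub>R v) ((\<lambda>x. a *\<^sub>R x) ` A) = a * infdist v A"
proof -
  have le: "infdist (a *\<^sub>R v) ((\<lambda>x. a *\<^sub>R x) ` A) \<le> a * infdist v A" if a: "a > 0" for a v and A :: "'a set"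
  proof (cases "A = {}")
    case False
    have "infdist (a *\<^sub>R v) ((\<lambda>x. a *\<^sub>R x) ` A) / a \<le> infdist v A"
      unfolding infdist_notempty[OF False]
    proof (rule cINF_greatest[OF False])
      fix x assume "x \<in> A"
      then have "infdist (a *\<^sub>R v) ((\<lambda>x. a *\<^sub>R x) ` A) \<le> dist (a *\<^sub>R v) (a *\<^sub>R x)"
        by (intro infdist_le) auto
      also have "\<dots> = a * dist v x" using a by (simp add: dist_norm flip: scaleR_diff_right)
      finally show "infdist (a *\<^sub>R v) ((\<lambda>x. a *\<^sub>R x) ` A) / a \<le> dist v x" using a by (simp add: field_simps)
    qed
    then show ?thesis using a by (simp add: field_simps)
  qed (simp add: infdist_def)
  have "infdist ((1/a) *\<^sub>R (a *\<^sub>R v)) ((\<lambda>x. (1/a) *\<^sub>R x) ` (\<lambda>x. a *\<^sub>R x) ` A) \<le> (1/a) * infdist (a *\<^sub>R v) ((\<lambda>x. a *\<^sub>R x) ` A)"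
    using assms by (intro le) auto
  then have "a * infdist v A \<le> infdist (a *\<^sub>R v) ((\<lambda>x. a *\<^sub>R x) ` A)"
    using assms by (simp add: image_image field_simps)
  with le[OF assms] show ?thesis by (rule antisym)
qed

lemma vertical_space_scaleR: "vertical_space N (a *\<^sub>R p) = (\<lambda>x. a *\<^sub>R x) ` vertical_space N p"
  by (simp add: vertical_space_eq image_image linear_cmul[OF linear_fund])

lemma scaleR_vertical_space:
  assumes "a \<noteq> 0"
  shows "(\<lambda>x. a *\<^sub>R x) ` vertical_space N p = vertical_space N p"
proof -
  have f: "fund (s *\<^sub>R x) p = s *\<^sub>R fund x p" for s x by (rule quat_eqI) simp
  have sub: "(\<lambda>x. s *\<^sub>R x) ` vertical_space N p \<subseteq> vertical_space N p" for s
    by (auto simp: vertical_space_eq image_image f [symmetric] lie_algebra_def)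
  have "vertical_space N p = (\<lambda>x. a *\<^sub>R x) ` (\<lambda>x. (1/a) *\<^sub>R x) ` vertical_space N p"
    using assms by (simp add: image_image)
  also have "\<dots> \<subseteq> (\<lambda>x. a *\<^sub>R x) ` vertical_space N p" by (intro image_mono sub)
  finally show ?thesis using sub by blast
qed

lemma infdist_scaleR_vertical:
  "a > 0 \<Longrightarrow> infdist (a *\<^sub>R v) (vertical_space N p) = a * infdist v (vertical_space N p)"
  using infdist_scaleR[of a v "vertical_space N p"] scaleR_vertical_space[of a N p] by simp

section \<open>Piecewise C1 curves under symmetries, reversal and concatenation\<close>

lemma valid_pathE:
  assumes "valid_path c"
  obtains S D where "finite S" "continuous_on {0..1} c"
    "\<And>t. t \<in> {0..1} - S \<Longrightarrow> (c has_vector_derivative D t) (at t)" "continuous_on ({0..1} - S) D"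
  using assms unfolding valid_path_def piecewise_C1_differentiable_on_def C1_differentiable_on_def by blast

lemma valid_pathI:
  assumes "finite S" "continuous_on {0..1} c"
    "\<And>t. t \<in> {0..1} - S \<Longrightarrow> (c has_vector_derivative D t) (at t)" "continuous_on ({0..1} - S) D"
  shows "valid_path c"
  using assms unfolding valid_path_def piecewise_C1_differentiable_on_def C1_differentiable_on_def by blast

text \<open>Where c is continuously differentiable, the horizontal speed is upper semicontinuous: a
  strict sublevel set is a union of open sets, one for each element of the Lie algebra. The finitely
  many remaining times do not affect measurability.\<close>

lemma measurable_qspeed:
  assumes c: "valid_path c" and N: "1 \<in> N"
  shows "(\<lambda>t. ennreal (qspeed N c t) * indicator {0..1} t) \<in> borel_measurable borel"
proof -
  obtain S D where S: "finite S" and cc: "continuous_on {0..1} c"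
    and D: "\<And>t. t \<in> {0..1} - S \<Longrightarrow> (c has_vector_derivative D t) (at t)"
    and cD: "continuous_on ({0..1} - S) D" by (rule valid_pathE[OF c]) blast
  define U where "U = {0<..<1} - S"
  have U: "open U" "U \<subseteq> {0..1} - S" using S by (auto simp: U_def finite_imp_closed open_Diff)
  define g where "g t = indicator U t * infdist (D t) (vertical_space N (c t))" for t
  have "g \<in> borel_measurable borel"
  proof (rule borel_measurableI_less)
    fix a :: real
    show "{t \<in> space borel. g t < a} \<in> sets borel"
    proof (cases "a \<le> 0")
      case True
      have "\<not> g t < a" for t using infdist_nonneg True by (auto simp: g_def indicator_def not_less intro: order_trans)
      then show ?thesis by simp
    next
      case False
      have eq: "{t \<in> space borel. g t < a} = (- U) \<union> (\<Union>x\<in>lie_algebra N. U \<inter> {t. norm (D t - fund x (c t)) < a})"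
        using False zero_in_lie_algebra[OF N]
        by (auto simp: g_def indicator_def infdist_vertical_less_iff[OF N])
      have "open (U \<inter> {t. norm (D t - fund x (c t)) < a})" for x
      proof -
        have "continuous_on U (\<lambda>t. norm (D t - fund x (c t)))"
          by (intro continuous_intros bounded_linear.continuous_on[OF bounded_linear_fund]
              continuous_on_subset[OF cD] continuous_on_subset[OF cc]) (use U in auto)
        from continuous_on_open_vimage[OF U(1), THEN iffD1, OF this, rule_format, of "{..<a}"]
        show ?thesis by (simp add: vimage_def Int_commute)
      qed
      then have "open (\<Union>x\<in>lie_algebra N. U \<inter> {t. norm (D t - fund x (c t)) < a})" by blast
      then have "(\<Union>x\<in>lie_algebra N. U \<inter> {t. norm (D t - fund x (c t)) < a}) \<in> sets borel" by (rule borel_open)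
      moreover have "- U \<in> sets borel" using U(1) by (simp add: borel_closed closed_Compl)
      ultimately show ?thesis by (simp only: eq sets.Un)
    qed
  qed
  then have "(\<lambda>t. ennreal (g t) * indicator {0..1} t) \<in> borel_measurable borel" by measurable
  then show ?thesis
  proof (rule measurable_discrete_difference[where X = "S \<union> {0, 1}"])
    fix t assume "t \<notin> S \<union> {0, 1}"
    then show "ennreal (g t) * indicator {0..1} t = ennreal (qspeed N c t) * indicator {0..1} t"
      using vector_derivative_at[OF D[of t]] by (auto simp: g_def qspeed_def indicator_def U_def)
  qed (use S in \<open>auto intro: countable_finite\<close>)
qed

lemma AE_not_finite: "finite S \<Longrightarrow> AE t in lborel. t \<notin> (S :: real set)"
  by (rule AE_not_in) (rule finite_imp_null_set_lborel)

lemma valid_path_linear: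
  assumes "valid_path c" "bounded_linear A"
  shows "valid_path (A \<circ> c)"
proof -
  obtain S D where S: "finite S" and cc: "continuous_on {0..1} c"
    and D: "\<And>t. t \<in> {0..1} - S \<Longrightarrow> (c has_vector_derivative D t) (at t)"
    and cD: "continuous_on ({0..1} - S) D" by (rule valid_pathE[OF assms(1)]) blast
  show ?thesis
    by (rule valid_pathI[OF S, where D = "A \<circ> D"])
       (use assms(2) cc D cD in \<open>auto simp: o_def intro: bounded_linear.continuous_on bounded_linear.has_vector_derivative\<close>)
qed

text \<open>Serves both the elements of N, with a = 1, and the dilations, with a equal to their
  factor.\<close>

lemma quotient_length_linear:
  assumes c: "valid_path c" and N: "1 \<in> N" and A: "bounded_linear A" and a: "a \<ge> 0"
    and eq: "\<And>v p. infdist (A v) (vertical_space N (A p)) = a * infdist v (vertical_space N p)"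
  shows "quotient_length N (A \<circ> c) = ennreal a * quotient_length N c"
proof -
  obtain S D where S: "finite S"
    and D: "\<And>t. t \<in> {0..1} - S \<Longrightarrow> (c has_vector_derivative D t) (at t)" by (rule valid_pathE[OF c]) blast
  have "quotient_length N (A \<circ> c) = (\<integral>\<^sup>+t. ennreal a * (ennreal (qspeed N c t) * indicator {0..1} t) \<partial>lborel)"
    unfolding quotient_length_eq
  proof (rule nn_integral_cong_AE, rule AE_mp[OF AE_not_finite[OF S]], rule AE_I2, rule impI)
    fix t assume t: "t \<notin> S"
    show "ennreal (qspeed N (A \<circ> c) t) * indicator {0..1} t = ennreal a * (ennreal (qspeed N c t) * indicator {0..1} t)"
    proof (cases "t \<in> {0..1}")
      case True
      with t have "t \<in> {0..1} - S" by simp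
      from D[OF this] bounded_linear.has_vector_derivative[OF A D[OF this]]
      have "vector_derivative c (at t) = D t" "vector_derivative (A \<circ> c) (at t) = A (D t)"
        by (auto intro: vector_derivative_at simp: o_def)
      then show ?thesis using True a by (simp add: qspeed_def eq ennreal_mult' infdist_nonneg)
    qed simp
  qed
  also have "\<dots> = ennreal a * quotient_length N c"
    unfolding quotient_length_eq by (rule nn_integral_cmult) (use measurable_qspeed[OF c N] in simp)
  finally show ?thesis .
qed

lemma quotient_length_reverse:
  assumes c: "valid_path c" and N: "1 \<in> N"
  shows "quotient_length N (reversepath c) = quotient_length N c"
proof -
  obtain S D where S: "finite S"
    and D: "\<And>t. t \<in> {0..1} - S \<Longrightarrow> (c has_vector_derivative D t) (at t)" by (rule valid_pathE[OF c]) blast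
  let ?f = "\<lambda>t. ennreal (qspeed N c t) * indicator {0..1} t"
  have "quotient_length N (reversepath c) = (\<integral>\<^sup>+t. ?f (1 + (-1) * t) \<partial>lborel)"
    unfolding quotient_length_eq
  proof (rule nn_integral_cong_AE, rule AE_mp[OF AE_not_finite[of "(\<lambda>t. 1 - t) ` S"]], simp add: S, rule AE_I2, rule impI)
    fix t assume t: "t \<notin> (\<lambda>t. 1 - t) ` S"
    show "ennreal (qspeed N (reversepath c) t) * indicator {0..1} t = ?f (1 + (-1) * t)"
    proof (cases "t \<in> {0..1}")
      case True
      with t have *: "1 - t \<in> {0..1} - S" by (auto simp: image_iff)
      have "((\<lambda>t. 1 - t) has_vector_derivative - 1) (at t)" by (auto intro!: derivative_eq_intros)
      then have "(reversepath c has_vector_derivative - D (1 - t)) (at t)"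
        using vector_diff_chain_at[of "\<lambda>t. 1 - t" "-1" t c "D (1 - t)"] D[OF *] by (simp add: o_def reversepath_def)
      then have "vector_derivative (reversepath c) (at t) = - D (1 - t)" by (rule vector_derivative_at)
      moreover have "vector_derivative c (at (1 - t)) = D (1 - t)" using D[OF *] by (rule vector_derivative_at)
      ultimately show ?thesis
        using True by (simp add: qspeed_def infdist_minus_vertical reversepath_def)
    qed (auto simp: indicator_def)
  qed
  also have "\<dots> = quotient_length N c"
    unfolding quotient_length_eq
    using nn_integral_real_affine[of ?f "-1" 1] measurable_qspeed[OF c N] by simp
  finally show ?thesis .
qed

lemma quotient_length_join:
  assumes c1: "valid_path c1" and c2: "valid_path c2" and N: "1 \<in> N"
  shows "quotient_length N (c1 +++ c2) \<le> quotient_length N c1 + quotient_length N c2"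
proof -
  obtain S1 D1 where S1: "finite S1"
    and D1: "\<And>t. t \<in> {0..1} - S1 \<Longrightarrow> (c1 has_vector_derivative D1 t) (at t)" by (rule valid_pathE[OF c1]) blast
  obtain S2 D2 where S2: "finite S2"
    and D2: "\<And>t. t \<in> {0..1} - S2 \<Longrightarrow> (c2 has_vector_derivative D2 t) (at t)" by (rule valid_pathE[OF c2]) blast
  let ?f = "\<lambda>c t. ennreal (qspeed N c t) * indicator {0..1} t"
  define E where "E = (\<lambda>t. t / 2) ` S1 \<union> (\<lambda>t. (t + 1) / 2) ` S2 \<union> {1/2}"
  have E: "finite E" using S1 S2 by (simp add: E_def)
  \<comment> \<open>Each half is traversed at double speed, and the affine substitution below undoes
    the factor 2. The time 1/2 and the transported break points form the null set E.\<close>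
  have "quotient_length N (c1 +++ c2) \<le> (\<integral>\<^sup>+t. ennreal 2 * ?f c1 (0 + 2 * t) + ennreal 2 * ?f c2 (-1 + 2 * t) \<partial>lborel)"
    unfolding quotient_length_eq
  proof (rule nn_integral_mono_AE, rule AE_mp[OF AE_not_finite[OF E]], rule AE_I2, rule impI)
    fix t assume t: "t \<notin> E"
    consider "t \<notin> {0..1}" | "0 \<le> t" "t < 1/2" | "1/2 < t" "t \<le> 1"
      using t by (fastforce simp: E_def)
    then show "?f (c1 +++ c2) t \<le> ennreal 2 * ?f c1 (0 + 2 * t) + ennreal 2 * ?f c2 (-1 + 2 * t)"
    proof cases
      case 2
      have *: "2 * t \<in> {0..1} - S1" using 2 t by (auto simp: E_def image_iff mult.commute)
      have "((\<lambda>t. 2 * t) has_vector_derivative 2) (at t)" by (auto intro!: derivative_eq_intros)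
      then have "((\<lambda>t. c1 (2 * t)) has_vector_derivative 2 *\<^sub>R D1 (2 * t)) (at t)"
        using vector_diff_chain_at[of "\<lambda>t. 2 * t" "2" t c1 "D1 (2 * t)"] D1[OF *] by (simp add: o_def)
      then have "((c1 +++ c2) has_vector_derivative 2 *\<^sub>R D1 (2 * t)) (at t)"
        by (rule has_vector_derivative_transform_within_open[of _ _ _ "{..<1/2}"]) (use 2 in \<open>auto simp: joinpaths_def\<close>)
      then have "vector_derivative (c1 +++ c2) (at t) = 2 *\<^sub>R D1 (2 * t)" by (rule vector_derivative_at)
      moreover have "vector_derivative c1 (at (2 * t)) = D1 (2 * t)" using D1[OF *] by (rule vector_derivative_at)
      ultimately have "qspeed N (c1 +++ c2) t = 2 * qspeed N c1 (2 * t)"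
        using 2 by (simp add: qspeed_def joinpaths_def infdist_scaleR_vertical)
      then show ?thesis using * 2 by (simp add: ennreal_mult' qspeed_nonneg)
    next
      case 3
      have *: "2 * t - 1 \<in> {0..1} - S2" using 3 t by (auto simp: E_def image_iff)
      have "((\<lambda>t. 2 * t - 1) has_vector_derivative 2) (at t)" by (auto intro!: derivative_eq_intros)
      then have "((\<lambda>t. c2 (2 * t - 1)) has_vector_derivative 2 *\<^sub>R D2 (2 * t - 1)) (at t)"
        using vector_diff_chain_at[of "\<lambda>t. 2 * t - 1" "2" t c2 "D2 (2 * t - 1)"] D2[OF *] by (simp add: o_def)
      then have "((c1 +++ c2) has_vector_derivative 2 *\<^sub>R D2 (2 * t - 1)) (at t)"
        by (rule has_vector_derivative_transform_within_open[of _ _ _ "{1/2<..}"]) (use 3 in \<open>auto simp: joinpaths_def\<close>)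
      then have "vector_derivative (c1 +++ c2) (at t) = 2 *\<^sub>R D2 (2 * t - 1)" by (rule vector_derivative_at)
      moreover have "vector_derivative c2 (at (2 * t - 1)) = D2 (2 * t - 1)" using D2[OF *] by (rule vector_derivative_at)
      ultimately have "qspeed N (c1 +++ c2) t = 2 * qspeed N c2 (2 * t - 1)"
        using 3 by (simp add: qspeed_def joinpaths_def infdist_scaleR_vertical)
      then show ?thesis using * 3 by (simp add: ennreal_mult' qspeed_nonneg indicator_def)
    qed simp
  qed
  also have "\<dots> = ennreal 2 * (\<integral>\<^sup>+t. ?f c1 (0 + 2 * t) \<partial>lborel) + ennreal 2 * (\<integral>\<^sup>+t. ?f c2 (-1 + 2 * t) \<partial>lborel)"
  proof -
    have m: "(\<lambda>t. ?f c (a + 2 * t)) \<in> borel_measurable lborel" if "valid_path c" for c and a :: real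
      using measurable_compose[of "\<lambda>t. a + 2 * t" borel borel "?f c" borel] measurable_qspeed[OF that N] by simp
    show ?thesis
      using m[OF c1, of 0] m[OF c2, of "-1"] by (subst nn_integral_add) (simp_all add: nn_integral_cmult)
  qed
  also have "\<dots> = quotient_length N c1 + quotient_length N c2"
    unfolding quotient_length_eq
    using nn_integral_real_affine[of "?f c1" 2 0] nn_integral_real_affine[of "?f c2" 2 "-1"]
      measurable_qspeed[OF c1 N] measurable_qspeed[OF c2 N] by simp
  finally show ?thesis .
qed

section \<open>The quotient distance\<close>

lemma hopf_scaleR: "hopf (s *\<^sub>R h) = s\<^sup>2 *\<^sub>R hopf h"
  by (simp add: hopf_def vec_eq_iff forall_3 power_mult_distrib diff_divide_distrib right_diff_distrib)
    (simp add: power2_eq_square algebra_simps)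

lemma level_set_scaleR:
  assumes "s \<noteq> 0"
  shows "s *\<^sub>R p \<in> level_set \<iota> (s\<^sup>2 *\<^sub>R \<zeta>) \<longleftrightarrow> p \<in> level_set \<iota> \<zeta>"
proof -
  have "(\<Sum>k\<in>UNIV. \<iota> l $ k *\<^sub>R hopf (coord k (s *\<^sub>R p))) = s\<^sup>2 *\<^sub>R (\<Sum>k\<in>UNIV. \<iota> l $ k *\<^sub>R hopf (coord k p))" for l
    by (simp add: hopf_scaleR scaleR_sum_right mult.commute)
  then show ?thesis using assms
    by (simp add: level_set_iff scaleR_blinfun.rep_eq flip: scaleR_minus_right)
qed

lemma closed_level_set_limit:
  assumes "\<And>i. p i \<in> level_set \<iota> (\<zeta> i)" "p \<longlonglongrightarrow> p0" "\<zeta> \<longlonglongrightarrow> \<zeta>0"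
  shows "p0 \<in> level_set \<iota> \<zeta>0"
  unfolding level_set_iff
proof
  fix l
  have "isCont hopf h" for h
    using continuous_on_hopf[OF continuous_on_id, of UNIV]
      continuous_on_eq_continuous_at[OF open_UNIV, of hopf] by blast
  then have "(\<lambda>i. hopf (coord k (p i))) \<longlonglongrightarrow> hopf (coord k p0)" for k
    by (rule isCont_tendsto_compose) (rule bounded_linear.tendsto[OF bounded_linear_coord assms(2)])
  then have "(\<lambda>i. \<Sum>k\<in>UNIV. \<iota> l $ k *\<^sub>R hopf (coord k (p i))) \<longlonglongrightarrow> (\<Sum>k\<in>UNIV. \<iota> l $ k *\<^sub>R hopf (coord k p0))"
    by (intro tendsto_intros)
  moreover have "(\<lambda>i. - blinfun_apply (\<zeta> i) l) \<longlonglongrightarrow> - blinfun_apply \<zeta>0 l"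
    by (intro tendsto_intros assms)
  moreover have "(\<Sum>k\<in>UNIV. \<iota> l $ k *\<^sub>R hopf (coord k (p i))) = - blinfun_apply (\<zeta> i) l" for i
    using assms(1)[of i] by (simp add: level_set_iff)
  ultimately show "(\<Sum>k\<in>UNIV. \<iota> l $ k *\<^sub>R hopf (coord k p0)) = - blinfun_apply \<zeta>0 l"
    using LIMSEQ_unique by auto
qed

section \<open>Orbits of N and infima of lengths\<close>

locale torus_reduction =
  fixes \<iota> :: "'l::real_normed_vector \<Rightarrow> real ^ 'd::finite" and N :: "(complex ^ 'd) set"
  assumes N: "subtorus N" and linear_iota: "linear \<iota>" and inj_iota: "inj \<iota>"
begin

abbreviation level :: "('l \<Rightarrow>\<^sub>L (real ^ 3)) \<Rightarrow> 'd quat set" where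
  "level \<equiv> level_set \<iota>"

lemma one_in_N: "1 \<in> N" and N_torus: "\<tau> \<in> N \<Longrightarrow> \<tau> \<in> torus"
  and N_mult: "\<sigma> \<in> N \<Longrightarrow> \<tau> \<in> N \<Longrightarrow> \<sigma> * \<tau> \<in> N"
  using N by (auto simp: subtorus_def)

lemma N_inverse:
  assumes "\<tau> \<in> N"
  obtains \<sigma> where "\<sigma> \<in> N" "\<sigma> * \<tau> = 1" "\<tau> * \<sigma> = 1"
proof
  show "(\<chi> k. inverse (\<tau> $ k)) \<in> N" using N assms by (simp add: subtorus_def)
  have "\<tau> $ k \<noteq> 0" for k using N_torus[OF assms] by (auto simp: torus_iff) (metis norm_zero zero_neq_one)
  then show "(\<chi> k. inverse (\<tau> $ k)) * \<tau> = 1" "\<tau> * (\<chi> k. inverse (\<tau> $ k)) = 1"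
    by (simp_all add: vec_eq_iff)
qed

lemma compact_N: "compact N"
proof -
  have "norm \<tau> \<le> of_nat CARD('d)" if "\<tau> \<in> N" for \<tau>
  proof -
    have "norm \<tau> \<le> (\<Sum>k\<in>UNIV. cmod (\<tau> $ k))"
      unfolding norm_vec_def by (rule L2_set_le_sum) simp
    also have "\<dots> = of_nat CARD('d)" using N_torus[OF that] by (simp add: torus_iff)
    finally show ?thesis .
  qed
  then have "bounded N" by (auto simp: bounded_iff)
  then show ?thesis using N by (simp add: compact_eq_bounded_closed subtorus_def)
qed

lemma self_in_orbit [simp]: "p \<in> orbit N p"
  unfolding orbit_def using one_in_N by (metis image_eqI torus_act_one)

lemma torus_act_in_orbit [simp]: "\<tau> \<in> N \<Longrightarrow> torus_act \<tau> p \<in> orbit N p"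
  by (simp add: orbit_def)

lemma orbit_eqI:
  assumes "q \<in> orbit N p"
  shows "orbit N q = orbit N p"
proof -
  obtain \<tau> where \<tau>: "\<tau> \<in> N" "q = torus_act \<tau> p" using assms by (auto simp: orbit_def)
  obtain \<sigma> where \<sigma>: "\<sigma> \<in> N" "\<sigma> * \<tau> = 1" using N_inverse[OF \<tau>(1)] by metis
  have "p = torus_act \<sigma> q" by (simp add: \<tau>(2) \<sigma>(2) flip: torus_act_mult)
  then show ?thesis
    using \<tau> \<sigma>(1) N_mult by (auto simp: orbit_def image_iff) (metis torus_act_mult)+
qed

lemma orbit_torus_act: "\<tau> \<in> N \<Longrightarrow> orbit N (torus_act \<tau> p) = orbit N p"
  by (rule orbit_eqI) simp

lemma orbit_scaleR: "orbit N (s *\<^sub>R p) = (\<lambda>x. s *\<^sub>R x) ` orbit N p"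
  by (simp add: orbit_def image_image linear_cmul[OF linear_torus_act])

lemma infdist_torus_act:
  assumes "\<tau> \<in> N"
  shows "infdist (torus_act \<tau> v) (vertical_space N (torus_act \<tau> p)) = infdist v (vertical_space N p)"
proof -
  have v: "vertical_space N (torus_act \<tau> p) = torus_act \<tau> ` vertical_space N p"
    by (simp add: vertical_space_eq image_image torus_act_fund)
  show ?thesis
  proof (cases "vertical_space N p = {}")
    case False
    then show ?thesis unfolding v
      by (simp add: infdist_notempty image_image dist_norm norm_torus_act_diff[OF N_torus[OF assms]])
  qed (simp add: v infdist_def)
qed

definition curves :: "('l \<Rightarrow>\<^sub>L (real ^ 3)) \<Rightarrow> 'd quat \<Rightarrow> 'd quat \<Rightarrow> (real \<Rightarrow> 'd quat) set" where
  "curves \<zeta> p q = {c. valid_path c \<and> path_image c \<subseteq> level \<zeta> \<and>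
     pathstart c \<in> orbit N p \<and> pathfinish c \<in> orbit N q}"

text \<open>Kept extended real-valued, because \<open>quotient_dist\<close> turns an infinite
  infimum into 0. Finiteness on level sets is \<open>qlen_finite\<close>.\<close>

definition qlen :: "('l \<Rightarrow>\<^sub>L (real ^ 3)) \<Rightarrow> 'd quat \<Rightarrow> 'd quat \<Rightarrow> ennreal" where
  "qlen \<zeta> p q = (INF c\<in>curves \<zeta> p q. quotient_length N c)"

lemma quotient_dist_eq: "quotient_dist \<iota> N \<zeta> (orbit N p) (orbit N q) = enn2real (qlen \<zeta> p q)"
  by (simp add: quotient_dist_def qlen_def curves_def)

lemma qlen_orbit_cong:
  "orbit N p = orbit N p' \<Longrightarrow> orbit N q = orbit N q' \<Longrightarrow> qlen \<zeta> p q = qlen \<zeta> p' q'"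
  by (simp add: qlen_def curves_def)

lemma torus_act_curve:
  assumes c: "c \<in> curves \<zeta> p q" and \<tau>: "\<tau> \<in> N"
  shows "torus_act \<tau> \<circ> c \<in> curves \<zeta> p q" "quotient_length N (torus_act \<tau> \<circ> c) = quotient_length N c"
proof -
  have v: "valid_path c" using c by (simp add: curves_def)
  have "torus_act \<tau> x \<in> orbit N y" if "x \<in> orbit N y" for x y
    using orbit_eqI[OF that] \<tau> torus_act_in_orbit by blast
  then show "torus_act \<tau> \<circ> c \<in> curves \<zeta> p q"
    using c valid_path_linear[OF v bounded_linear_torus_act] level_set_torus_act[OF N_torus[OF \<tau>], of _ \<iota> \<zeta>]
    by (auto simp del: split_paired_All simp: curves_def subset_iff path_image_compose pathstart_compose pathfinish_compose)
  show "quotient_length N (torus_act \<tau> \<circ> c) = quotient_length N c"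
    using quotient_length_linear[OF v one_in_N bounded_linear_torus_act, of 1 \<tau>] infdist_torus_act[OF \<tau>] by simp
qed

text \<open>Only the orbits of the endpoints are prescribed and N preserves lengths, so a nearly
  optimal curve can be moved to start exactly at p, as concatenation demands.\<close>

lemma qlen_lessE:
  assumes "qlen \<zeta> p q < S"
  obtains c where "c \<in> curves \<zeta> p q" "pathstart c = p" "quotient_length N c < S"
proof -
  obtain c where c: "c \<in> curves \<zeta> p q" "quotient_length N c < S"
    using assms unfolding qlen_def INF_less_iff by blast
  then obtain \<tau> where \<tau>: "\<tau> \<in> N" "pathstart c = torus_act \<tau> p" by (auto simp: curves_def orbit_def)
  obtain \<sigma> where \<sigma>: "\<sigma> \<in> N" "\<sigma> * \<tau> = 1" using N_inverse[OF \<tau>(1)] by metis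
  show thesis
  proof (rule that)
    show "torus_act \<sigma> \<circ> c \<in> curves \<zeta> p q" "quotient_length N (torus_act \<sigma> \<circ> c) < S"
      using torus_act_curve[OF c(1) \<sigma>(1)] c(2) by auto
    show "pathstart (torus_act \<sigma> \<circ> c) = p"
      by (simp add: pathstart_compose \<tau>(2) \<sigma>(2) flip: torus_act_mult)
  qed
qed

lemma qlen_le: "c \<in> curves \<zeta> p q \<Longrightarrow> qlen \<zeta> p q \<le> quotient_length N c"
  unfolding qlen_def by (rule INF_lower)

lemma qlen_sym_le: "qlen \<zeta> q p \<le> qlen \<zeta> p q"
  unfolding qlen_def [of \<zeta> p q]
proof (rule INF_greatest)
  fix c assume c: "c \<in> curves \<zeta> p q"
  then have "reversepath c \<in> curves \<zeta> q p" by (auto simp: curves_def)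
  then have "qlen \<zeta> q p \<le> quotient_length N (reversepath c)" by (rule qlen_le)
  also have "\<dots> = quotient_length N c"
    using c one_in_N by (intro quotient_length_reverse) (auto simp: curves_def)
  finally show "qlen \<zeta> q p \<le> quotient_length N c" .
qed

lemma qlen_sym: "qlen \<zeta> p q = qlen \<zeta> q p"
  by (intro antisym qlen_sym_le)

lemma qlen_triangle: "qlen \<zeta> p r \<le> qlen \<zeta> p q + qlen \<zeta> q r"
proof (rule ennreal_le_epsilon)
  fix e :: real
  assume fin: "qlen \<zeta> p q + qlen \<zeta> q r < top" and e: "0 < e"
  define e2 where "e2 = ennreal (e / 2)"
  have e2: "e2 > 0" "e2 + e2 = ennreal e" using e by (simp_all add: e2_def flip: ennreal_plus)
  have less: "x < x + e2" if "x < top" for x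
    using that e2(1) ennreal_add_left_cancel_less[of x 0 e2] by (simp add: less_top)
  have fin1: "qlen \<zeta> p q < top" "qlen \<zeta> q r < top"
    using fin by (simp_all add: ennreal_add_eq_top less_top)
  obtain c1 where c1: "c1 \<in> curves \<zeta> p q" "quotient_length N c1 < qlen \<zeta> p q + e2"
    by (rule qlen_lessE[OF less[OF fin1(1)]])
  have "pathfinish c1 \<in> orbit N q" using c1 by (simp add: curves_def)
  \<comment> \<open>The second curve has to start at the very endpoint of the first, which is just
    some point of the orbit of q.\<close>
  then have o: "orbit N (pathfinish c1) = orbit N q" by (rule orbit_eqI)
  then have "qlen \<zeta> (pathfinish c1) r < qlen \<zeta> q r + e2"
    using qlen_orbit_cong[OF o refl] less[OF fin1(2)] by simp
  then obtain c2 where c2: "c2 \<in> curves \<zeta> (pathfinish c1) r" "pathstart c2 = pathfinish c1"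
      "quotient_length N c2 < qlen \<zeta> q r + e2"
    by (rule qlen_lessE)
  have "c1 +++ c2 \<in> curves \<zeta> p r"
    using c1(1) c2(1,2) by (auto simp: curves_def path_image_join intro: valid_path_join)
  then have "qlen \<zeta> p r \<le> quotient_length N (c1 +++ c2)" by (rule qlen_le)
  also have "\<dots> \<le> quotient_length N c1 + quotient_length N c2"
    using c1(1) c2(1) one_in_N by (intro quotient_length_join) (auto simp: curves_def)
  also have "\<dots> \<le> (qlen \<zeta> p q + e2) + (qlen \<zeta> q r + e2)"
    using c1(2) c2(3) by (intro add_mono less_imp_le)
  also have "\<dots> = qlen \<zeta> p q + qlen \<zeta> q r + (e2 + e2)" by (simp only: add_ac)
  finally show "qlen \<zeta> p r \<le> qlen \<zeta> p q + qlen \<zeta> q r + ennreal e" by (simp only: e2(2))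
qed

lemma qlen_refl:
  assumes "p \<in> level \<zeta>"
  shows "qlen \<zeta> p p = 0"
proof -
  have v: "valid_path (\<lambda>_::real. p)" by (rule valid_pathI[of "{}" _ "\<lambda>_. 0"]) auto
  then have "(\<lambda>_. p) \<in> curves \<zeta> p p"
    using assms by (auto simp: curves_def path_image_def pathstart_def pathfinish_def)
  then have "qlen \<zeta> p p \<le> quotient_length N (\<lambda>_. p)" by (rule qlen_le)
  also have "\<dots> = 0"
  proof -
    have "infdist 0 (vertical_space N p) = 0"
      using zero_in_lie_algebra[OF one_in_N] fund_zero_left[of p] unfolding vertical_space_eq
      by (metis image_eqI infdist_zero)
    then show ?thesis by (simp add: quotient_length_eq qspeed_def)
  qed
  finally show ?thesis by simp
qed

lemma qlen_scaleR_le: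
  assumes s: "s > 0"
  shows "qlen (s\<^sup>2 *\<^sub>R \<zeta>) (s *\<^sub>R p) (s *\<^sub>R q) \<le> ennreal s * qlen \<zeta> p q"
proof -
  \<comment> \<open>Dividing by s leaves an infimum to be bounded below on one side only, so
    multiplication need not be exchanged with it.\<close>
  have "ennreal (1 / s) * qlen (s\<^sup>2 *\<^sub>R \<zeta>) (s *\<^sub>R p) (s *\<^sub>R q) \<le> qlen \<zeta> p q"
    unfolding qlen_def [of \<zeta>]
  proof (rule INF_greatest)
    fix c assume c: "c \<in> curves \<zeta> p q"
    then have v: "valid_path c" by (simp add: curves_def)
    have bl: "bounded_linear (\<lambda>x :: 'd quat. s *\<^sub>R x)" by (rule bounded_linear_scaleR_right)
    have "(\<lambda>x. s *\<^sub>R x) \<circ> c \<in> curves (s\<^sup>2 *\<^sub>R \<zeta>) (s *\<^sub>R p) (s *\<^sub>R q)"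
      using c valid_path_linear[OF v bl] level_set_scaleR[of s _ \<iota> \<zeta>] s
      by (auto simp: curves_def path_image_compose pathstart_compose pathfinish_compose orbit_scaleR)
    then have "qlen (s\<^sup>2 *\<^sub>R \<zeta>) (s *\<^sub>R p) (s *\<^sub>R q) \<le> quotient_length N ((\<lambda>x. s *\<^sub>R x) \<circ> c)" by (rule qlen_le)
    also have "\<dots> = ennreal s * quotient_length N c"
      using s by (intro quotient_length_linear[OF v one_in_N bl]) (auto simp: vertical_space_scaleR infdist_scaleR)
    finally have "ennreal (1 / s) * qlen (s\<^sup>2 *\<^sub>R \<zeta>) (s *\<^sub>R p) (s *\<^sub>R q)
        \<le> ennreal (1 / s) * (ennreal s * quotient_length N c)" by (rule mult_left_mono) simp
    also have "\<dots> = quotient_length N c"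
      using s by (simp add: mult.assoc [symmetric] flip: ennreal_mult)
    finally show "ennreal (1 / s) * qlen (s\<^sup>2 *\<^sub>R \<zeta>) (s *\<^sub>R p) (s *\<^sub>R q) \<le> quotient_length N c" .
  qed
  then have "ennreal s * (ennreal (1 / s) * qlen (s\<^sup>2 *\<^sub>R \<zeta>) (s *\<^sub>R p) (s *\<^sub>R q)) \<le> ennreal s * qlen \<zeta> p q"
    by (rule mult_left_mono) simp
  then show ?thesis
    using s by (simp add: mult.assoc [symmetric] flip: ennreal_mult)
qed

lemma qlen_scaleR:
  assumes s: "s > 0"
  shows "qlen (s\<^sup>2 *\<^sub>R \<zeta>) (s *\<^sub>R p) (s *\<^sub>R q) = ennreal s * qlen \<zeta> p q"
proof (rule antisym[OF qlen_scaleR_le[OF s]])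
  have "ennreal s * qlen \<zeta> p q = ennreal s * qlen ((1/s)\<^sup>2 *\<^sub>R s\<^sup>2 *\<^sub>R \<zeta>) ((1/s) *\<^sub>R s *\<^sub>R p) ((1/s) *\<^sub>R s *\<^sub>R q)"
    using s by (simp add: power_divide)
  also have "\<dots> \<le> ennreal s * (ennreal (1/s) * qlen (s\<^sup>2 *\<^sub>R \<zeta>) (s *\<^sub>R p) (s *\<^sub>R q))"
    using s by (intro mult_left_mono qlen_scaleR_le) auto
  also have "\<dots> = qlen (s\<^sup>2 *\<^sub>R \<zeta>) (s *\<^sub>R p) (s *\<^sub>R q)"
    using s by (simp add: mult.assoc [symmetric] flip: ennreal_mult)
  finally show "ennreal s * qlen \<zeta> p q \<le> qlen (s\<^sup>2 *\<^sub>R \<zeta>) (s *\<^sub>R p) (s *\<^sub>R q)" .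
qed

section \<open>Explicit curves inside one level set\<close>

lemma quotient_length_le:
  assumes c: "valid_path c" and B: "\<And>t. t \<in> {0..1} - S \<Longrightarrow> norm (vector_derivative c (at t)) \<le> B t" and S: "finite S"
  shows "quotient_length N c \<le> (\<integral>\<^sup>+t\<in>{0..1}. ennreal (B t) \<partial>lborel)"
  unfolding quotient_length_eq
proof (rule nn_integral_mono_AE, rule AE_mp[OF AE_not_finite[OF S]], rule AE_I2, rule impI)
  fix t assume t: "t \<notin> S"
  show "ennreal (qspeed N c t) * indicator {0..1} t \<le> ennreal (B t) * indicator {0..1} t"
  proof (cases "t \<in> {0..1}")
    case True
    have "0 \<in> vertical_space N (c t)"
      using zero_in_lie_algebra[OF one_in_N] fund_zero_left[of "c t"] unfolding vertical_space_eq
      by (metis image_eqI)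
    then have "qspeed N c t \<le> dist (vector_derivative c (at t)) 0" unfolding qspeed_def by (rule infdist_le)
    also have "\<dots> \<le> B t" using B[of t] True t by simp
    finally show ?thesis using True by (simp add: ennreal_leI)
  qed simp
qed

text \<open>Level sets are cut out by affine conditions on the Hopf values, so they contain every
  curve whose coordinates lift the straight segments between these values with a common parameter.
  Coordinates outside Z change by a small relative amount and get the sharp bound of the lift, those
  in Z only the crude one.\<close>

lemma qlen_le_near_far:
  assumes p: "p \<in> level \<zeta>" and q: "q \<in> level \<zeta>" and \<kappa>: "0 < \<kappa>" "\<kappa> \<le> 1/16"
    and near: "\<And>k. k \<notin> Z \<Longrightarrow> coord k p \<noteq> 0 \<and> norm (coord k q - coord k p) \<le> \<kappa> * norm (coord k p)"
  shows "qlen \<zeta> p q \<le> ennreal ((1 + 16 * \<kappa>) * norm (q - p) + 6 * (\<Sum>k\<in>Z. norm (coord k p) + norm (coord k q)))"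
proof -
  have "\<exists>r D S t0. hopf_lift (coord k p) (coord k q) r D S \<and>
     (\<forall>t\<in>{0..1} - S. (k \<in> Z \<longrightarrow> norm (D t) \<le> (norm (coord k p) + norm (coord k q)) / 2 * (1 / sqrt \<bar>t - t0\<bar>)
         + pi * (norm (coord k p) + norm (coord k q))) \<and>
       (k \<notin> Z \<longrightarrow> norm (D t) \<le> (1 + 16 * \<kappa>) * norm (coord k q - coord k p)))" for k
  proof (cases "k \<in> Z")
    case True
    show ?thesis
      by (rule hopf_lift_far[of "coord k p" "coord k q"]) (use True in blast)
  next
    case False
    with near have "coord k p \<noteq> 0" "norm (coord k q - coord k p) \<le> \<kappa> * norm (coord k p)" by auto
    show ?thesis
      by (rule hopf_lift_nonzero[OF \<open>coord k p \<noteq> 0\<close>, of "coord k q"])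
         (use False \<kappa> \<open>norm (coord k q - coord k p) \<le> \<kappa> * norm (coord k p)\<close> in blast)
  qed
  then obtain r D S t0 where L: "\<And>k. hopf_lift (coord k p) (coord k q) (r k) (D k) (S k)"
    and far: "\<And>k t. k \<in> Z \<Longrightarrow> t \<in> {0..1} - S k \<Longrightarrow>
        norm (D k t) \<le> (norm (coord k p) + norm (coord k q)) / 2 * (1 / sqrt \<bar>t - t0 k\<bar>)
         + pi * (norm (coord k p) + norm (coord k q))"
    and near': "\<And>k t. k \<notin> Z \<Longrightarrow> t \<in> {0..1} - S k \<Longrightarrow> norm (D k t) \<le> (1 + 16 * \<kappa>) * norm (coord k q - coord k p)"
    by metis
  define c where "c t = of_coords (\<lambda>k. r k t)" for t
  define D' where "D' t = of_coords (\<lambda>k. D k t)" for t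
  define S' where "S' = (\<Union>k. S k)"
  have S': "finite S'" using L by (auto simp: S'_def hopf_lift_def)
  have sub: "t \<in> {0..1} - S k" if "t \<in> {0..1} - S'" for t k using that by (auto simp: S'_def)
  have dc: "(c has_vector_derivative D' t) (at t)" if "t \<in> {0..1} - S'" for t
  proof (rule has_vector_derivative_quatI)
    show "((\<lambda>t. coord k (c t)) has_vector_derivative coord k (D' t)) (at t)" for k
      using L[of k] sub[OF that, of k] by (simp add: c_def D'_def hopf_lift_def)
  qed
  have v: "valid_path c"
  proof (rule valid_pathI[OF S' _ dc])
    show "continuous_on {0..1} c"
      by (rule continuous_on_quatI) (use L in \<open>simp add: c_def hopf_lift_def\<close>)
    show "continuous_on ({0..1} - S') D'"
    proof (rule continuous_on_quatI)
      show "continuous_on ({0..1} - S') (\<lambda>t. coord k (D' t))" for k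
        using L[of k] sub[of _ k] unfolding hopf_lift_def D'_def
        by (auto intro: continuous_on_subset)
    qed
  qed
  have c01: "c 0 = p" "c 1 = q"
    using L by (auto intro!: quat_eqI simp: c_def hopf_lift_def)
  have lev: "c t \<in> level \<zeta>" if t: "t \<in> {0..1}" for t
    unfolding level_set_iff
  proof
    fix l
    have "hopf (coord k (c t)) = (1 - t) *\<^sub>R hopf (coord k p) + t *\<^sub>R hopf (coord k q)" for k
      using L[of k] t by (simp add: c_def hopf_lift_def)
    then have "(\<Sum>k\<in>UNIV. \<iota> l $ k *\<^sub>R hopf (coord k (c t))) =
      (1 - t) *\<^sub>R (\<Sum>k\<in>UNIV. \<iota> l $ k *\<^sub>R hopf (coord k p)) + t *\<^sub>R (\<Sum>k\<in>UNIV. \<iota> l $ k *\<^sub>R hopf (coord k q))"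
      by (simp add: scaleR_sum_right scaleR_add_right sum.distrib mult.commute)
    also have "\<dots> = - blinfun_apply \<zeta> l"
      using p q by (simp add: level_set_iff algebra_simps)
    finally show "(\<Sum>k\<in>UNIV. \<iota> l $ k *\<^sub>R hopf (coord k (c t))) = - blinfun_apply \<zeta> l" .
  qed
  have cc: "c \<in> curves \<zeta> p q"
    using v lev c01 by (auto simp: curves_def path_image_def pathstart_def pathfinish_def)
  define n where "n k = norm (coord k p) + norm (coord k q)" for k
  have n: "n k \<ge> 0" for k by (simp add: n_def)
  have nD: "norm (D' t) \<le> (1 + 16 * \<kappa>) * norm (q - p) + (\<Sum>k\<in>Z. n k / 2 * (1 / sqrt \<bar>t - t0 k\<bar>) + pi * n k)"
    if t: "t \<in> {0..1} - S'" for t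
  proof -
    \<comment> \<open>The sharp coordinates are estimated jointly in the Euclidean norm, which keeps
      the factor of \<open>norm (q - p)\<close> close to 1. For the others the triangle inequality
      is good enough.\<close>
    define A B :: "'d quat" where "A = of_coords (\<lambda>k. if k \<in> Z then 0 else D k t)"
      and "B = of_coords (\<lambda>k. if k \<in> Z then D k t else 0)"
    have "D' t = A + B" by (rule quat_eqI) (simp add: A_def B_def D'_def)
    then have "norm (D' t) \<le> norm A + norm B" by (simp add: norm_triangle_ineq)
    also have "norm A \<le> (1 + 16 * \<kappa>) * norm (q - p)"
    proof (rule power2_le_imp_le)
      have "(norm A)\<^sup>2 \<le> (\<Sum>k\<in>UNIV. ((1 + 16 * \<kappa>) * norm (coord k (q - p)))\<^sup>2)"
        unfolding norm_quat A_def
        by (intro sum_mono power_mono) (use near'[OF _ sub[OF t]] \<kappa> in auto)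
      also have "\<dots> = ((1 + 16 * \<kappa>) * norm (q - p))\<^sup>2"
        by (simp add: power_mult_distrib norm_quat sum_distrib_left)
      finally show "(norm A)\<^sup>2 \<le> ((1 + 16 * \<kappa>) * norm (q - p))\<^sup>2" .
    qed (use \<kappa> in auto)
    also have "norm B \<le> (\<Sum>k\<in>UNIV. norm (coord k B))" by (rule norm_quat_le_sum)
    also have "\<dots> = (\<Sum>k\<in>Z. norm (D k t))"
      by (rule sum.mono_neutral_cong_right) (auto simp: B_def)
    also have "\<dots> \<le> (\<Sum>k\<in>Z. n k / 2 * (1 / sqrt \<bar>t - t0 k\<bar>) + pi * n k)"
      unfolding n_def by (intro sum_mono far sub[OF t])
    finally show ?thesis by simp
  qed
  have "qlen \<zeta> p q \<le> quotient_length N c" by (rule qlen_le[OF cc])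
  also have "\<dots> \<le> (\<integral>\<^sup>+t\<in>{0..1}. ennreal ((1 + 16 * \<kappa>) * norm (q - p) +
      (\<Sum>k\<in>Z. n k / 2 * (1 / sqrt \<bar>t - t0 k\<bar>) + pi * n k)) \<partial>lborel)"
    using nD vector_derivative_at[OF dc] by (intro quotient_length_le[OF v _ S']) auto
  also have "\<dots> = (\<integral>\<^sup>+t. ennreal ((1 + 16 * \<kappa>) * norm (q - p)) * indicator {0..1} t +
      (\<Sum>k\<in>Z. ennreal (n k / 2) * (ennreal (1 / sqrt \<bar>t - t0 k\<bar>) * indicator {0..1} t)
         + ennreal (pi * n k) * indicator {0..1} t) \<partial>lborel)"
  proof (rule nn_integral_cong)
    fix t :: real
    define f where "f k = n k / 2 * (1 / sqrt \<bar>t - t0 k\<bar>)" for k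
    have f: "f k \<ge> 0" for k using n[of k] by (simp add: f_def)
    have "ennreal (f k + pi * n k) = ennreal (n k / 2) * ennreal (1 / sqrt \<bar>t - t0 k\<bar>) + ennreal (pi * n k)" for k
      using n[of k] f[of k] by (simp only: ennreal_plus mult_nonneg_nonneg pi_ge_zero f_def flip: ennreal_mult')
    moreover have "ennreal ((1 + 16 * \<kappa>) * norm (q - p) + (\<Sum>k\<in>Z. f k + pi * n k)) =
        ennreal ((1 + 16 * \<kappa>) * norm (q - p)) + (\<Sum>k\<in>Z. ennreal (f k + pi * n k))"
      using n f \<kappa> by (subst ennreal_plus) (auto intro!: sum_nonneg sum_ennreal [symmetric] simp del: ennreal_plus)
    ultimately show "ennreal ((1 + 16 * \<kappa>) * norm (q - p) +
         (\<Sum>k\<in>Z. n k / 2 * (1 / sqrt \<bar>t - t0 k\<bar>) + pi * n k)) * indicator {0..1} t =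
       ennreal ((1 + 16 * \<kappa>) * norm (q - p)) * indicator {0..1} t +
      (\<Sum>k\<in>Z. ennreal (n k / 2) * (ennreal (1 / sqrt \<bar>t - t0 k\<bar>) * indicator {0..1} t)
         + ennreal (pi * n k) * indicator {0..1} t)"
      by (cases "t \<in> {0..1}") (simp_all add: f_def)
  qed
  also have "\<dots> = ennreal ((1 + 16 * \<kappa>) * norm (q - p)) +
      (\<Sum>k\<in>Z. ennreal (n k / 2) * (\<integral>\<^sup>+t\<in>{0..1}. ennreal (1 / sqrt \<bar>t - t0 k\<bar>) \<partial>lborel) + ennreal (pi * n k))"
    by (subst nn_integral_add) (auto simp: nn_integral_sum nn_integral_add nn_integral_cmult nn_integral_cmult_indicator)
  also have "\<dots> \<le> ennreal ((1 + 16 * \<kappa>) * norm (q - p)) + (\<Sum>k\<in>Z. ennreal (6 * n k))"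
  proof (intro add_mono order_refl sum_mono)
    fix k
    \<comment> \<open>6 = 2 + 4: the singular part contributes half of the bound 4 for its integral,
      and the linear phase contributes pi < 4.\<close>
    have "ennreal (n k / 2) * (\<integral>\<^sup>+t\<in>{0..1}. ennreal (1 / sqrt \<bar>t - t0 k\<bar>) \<partial>lborel) \<le> ennreal (n k / 2) * ennreal 4"
      using nn_integral_inverse_sqrt_le[of "t0 k"] by (intro mult_left_mono) auto
    also have "\<dots> = ennreal (2 * n k)" using n[of k] by (subst ennreal_mult [symmetric]) auto
    finally have "ennreal (n k / 2) * (\<integral>\<^sup>+t\<in>{0..1}. ennreal (1 / sqrt \<bar>t - t0 k\<bar>) \<partial>lborel) + ennreal (pi * n k)
        \<le> ennreal (2 * n k) + ennreal (pi * n k)" by (rule add_right_mono)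
    also have "\<dots> \<le> ennreal (6 * n k)"
      using n[of k] pi_less_4 mult_right_mono[of pi 4 "n k"]
      by (subst ennreal_plus [symmetric]) (auto intro!: ennreal_leI simp del: ennreal_plus)
    finally show "ennreal (n k / 2) * (\<integral>\<^sup>+t\<in>{0..1}. ennreal (1 / sqrt \<bar>t - t0 k\<bar>) \<partial>lborel) + ennreal (pi * n k) \<le> ennreal (6 * n k)" .
  qed
  also have "\<dots> = ennreal ((1 + 16 * \<kappa>) * norm (q - p) + 6 * (\<Sum>k\<in>Z. n k))"
    using n \<kappa> by (subst ennreal_plus) (auto simp: sum_nonneg sum_distrib_left simp del: ennreal_plus)
  finally show ?thesis by (simp add: n_def)
qed

text \<open>With all coordinates in Z nothing has to be small, so any two points of a level set are
  joined by a curve of finite length.\<close>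

lemma qlen_finite:
  assumes "p \<in> level \<zeta>" "q \<in> level \<zeta>"
  shows "qlen \<zeta> p q < top"
  using qlen_le_near_far[OF assms, of "1/16" UNIV] by (simp add: order_le_less_trans)

end

section \<open>Curves of nearly minimal length\<close>

context torus_reduction
begin

text \<open>The curve may leave the level set by \<eta> and end anywhere on the orbit of q, but it
  is 1-Lipschitz for the flat norm, so that limits can be taken. Membership in the level set is
  recovered as \<eta> tends to 0.\<close>

definition nearly_joined :: "real \<Rightarrow> ('l \<Rightarrow>\<^sub>L (real ^ 3)) \<Rightarrow> 'd quat \<Rightarrow> 'd quat \<Rightarrow> real \<Rightarrow> bool" where
  "nearly_joined \<eta> \<zeta> p q S \<longleftrightarrow> 0 \<le> S \<and> (\<exists>\<gamma> \<tau>. \<tau> \<in> N \<and> \<gamma> 0 = p \<and> \<gamma> S = torus_act \<tau> q \<and>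
     1-lipschitz_on {0..S} \<gamma> \<and> (\<forall>t\<in>{0..S}. infdist (\<gamma> t) (level \<zeta>) \<le> \<eta>))"

lemma nearly_joined_mono:
  assumes "nearly_joined \<eta> \<zeta> p q S" "S \<le> S'"
  shows "nearly_joined \<eta> \<zeta> p q S'"
proof -
  obtain \<gamma> \<tau> where g: "0 \<le> S" "\<tau> \<in> N" "\<gamma> 0 = p" "\<gamma> S = torus_act \<tau> q"
     "1-lipschitz_on {0..S} \<gamma>" "\<forall>t\<in>{0..S}. infdist (\<gamma> t) (level \<zeta>) \<le> \<eta>"
    using assms by (auto simp: nearly_joined_def)
  have "1-lipschitz_on {0..S'} (\<lambda>t. \<gamma> (min t S))"
  proof (rule lipschitz_onI)
    fix x y assume "x \<in> {0..S'}" "y \<in> {0..S'}"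
    then have "dist (\<gamma> (min x S)) (\<gamma> (min y S)) \<le> 1 * dist (min x S) (min y S)"
      using g(1) by (intro lipschitz_onD[OF g(5)]) auto
    also have "\<dots> \<le> 1 * dist x y" by (auto simp: dist_real_def min_def)
    finally show "dist (\<gamma> (min x S)) (\<gamma> (min y S)) \<le> 1 * dist x y" .
  qed simp
  then show ?thesis unfolding nearly_joined_def
    using g assms(2) by (intro conjI exI[of _ "\<lambda>t. \<gamma> (min t S)"] exI[of _ \<tau>]) auto
qed

lemma nearly_joined_torus_act:
  assumes "nearly_joined \<eta> \<zeta> p (torus_act \<sigma> q) S" "\<sigma> \<in> N"
  shows "nearly_joined \<eta> \<zeta> p q S"
  using assms unfolding nearly_joined_def by (metis N_mult torus_act_mult)

lemma infdist_level_set_torus_act: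
  assumes "\<tau> \<in> N"
  shows "infdist (torus_act \<tau> x) (level \<zeta>) \<le> infdist x (level \<zeta>)"
proof (cases "level \<zeta> = {}")
  case False
  then show ?thesis unfolding infdist_notempty[OF False]
  proof (rule cINF_mono)
    fix y assume "y \<in> level \<zeta>"
    then show "\<exists>z\<in>level \<zeta>. dist (torus_act \<tau> x) z \<le> dist x y"
      using level_set_torus_act[OF N_torus[OF assms], of y \<iota> \<zeta>]
      by (intro bexI[of _ "torus_act \<tau> y"]) (simp_all add: dist_norm norm_torus_act_diff[OF N_torus[OF assms]])
  qed auto
qed (simp add: infdist_def)

lemma nearly_joined_trans:
  assumes "nearly_joined \<eta> \<zeta> p q S" "nearly_joined \<eta> \<zeta> q r T"
  shows "nearly_joined \<eta> \<zeta> p r (S + T)"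
proof -
  obtain \<gamma> \<tau> where g: "0 \<le> S" "\<tau> \<in> N" "\<gamma> 0 = p" "\<gamma> S = torus_act \<tau> q"
     "1-lipschitz_on {0..S} \<gamma>" "\<forall>t\<in>{0..S}. infdist (\<gamma> t) (level \<zeta>) \<le> \<eta>"
    using assms(1) by (auto simp: nearly_joined_def)
  obtain \<delta> \<sigma> where d: "0 \<le> T" "\<sigma> \<in> N" "\<delta> 0 = q" "\<delta> T = torus_act \<sigma> r"
     "1-lipschitz_on {0..T} \<delta>" "\<forall>t\<in>{0..T}. infdist (\<delta> t) (level \<zeta>) \<le> \<eta>"
    using assms(2) by (auto simp: nearly_joined_def)
  define \<delta>' where "\<delta>' t = torus_act \<tau> (\<delta> (t - S))" for t
  have "1-lipschitz_on {S..S+T} \<delta>'"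
  proof (rule lipschitz_onI)
    fix x y assume "x \<in> {S..S+T}" "y \<in> {S..S+T}"
    then have "dist (\<delta> (x - S)) (\<delta> (y - S)) \<le> 1 * dist (x - S) (y - S)"
      by (intro lipschitz_onD[OF d(5)]) auto
    then show "dist (\<delta>' x) (\<delta>' y) \<le> 1 * dist x y"
      by (simp add: \<delta>'_def dist_norm norm_torus_act_diff[OF N_torus[OF g(2)]])
  qed simp
  then have "1-lipschitz_on {0..S+T} (\<lambda>t. if t \<le> S then \<gamma> t else \<delta>' t)"
    by (rule lipschitz_on_concat[OF g(5)]) (simp add: \<delta>'_def g d)
  moreover have "infdist (\<delta>' t) (level \<zeta>) \<le> \<eta>" if "t \<in> {S..S+T}" for t
  proof -
    have "infdist (\<delta>' t) (level \<zeta>) \<le> infdist (\<delta> (t - S)) (level \<zeta>)"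
      unfolding \<delta>'_def by (rule infdist_level_set_torus_act[OF g(2)])
    also have "\<dots> \<le> \<eta>" using d(6) that by auto
    finally show ?thesis .
  qed
  \<comment> \<open>For T = 0 the endpoint falls into the first branch; then \<delta> does not move
    and q is itself \<open>torus_act \<sigma> r\<close>.\<close>
  moreover have "(if S + T \<le> S then \<gamma> (S + T) else \<delta>' (S + T)) = torus_act (\<tau> * \<sigma>) r"
  proof (cases "T = 0")
    case True
    then show ?thesis using g(4) d(3,4) by (simp add: torus_act_mult)
  qed (use d(1,4) in \<open>simp add: \<delta>'_def torus_act_mult\<close>)
  ultimately show ?thesis unfolding nearly_joined_def
    using g d N_mult[OF g(2) d(2)]
    by (intro conjI exI[of _ "\<lambda>t. if t \<le> S then \<gamma> t else \<delta>' t"] exI[of _ "\<tau> * \<sigma>"]) auto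
qed

text \<open>A chord need not stay in the level set, but it departs from its starting point, which
  lies there, by at most its length.\<close>

lemma nearly_joined_short:
  assumes p: "p \<in> level \<zeta>" and \<tau>: "\<tau> \<in> N" and n: "norm (torus_act \<tau> q - p) \<le> \<eta>"
  shows "nearly_joined \<eta> \<zeta> p q (norm (torus_act \<tau> q - p))"
proof -
  define v S where "v = torus_act \<tau> q - p" and "S = norm v"
  define \<gamma> where "\<gamma> t = p + t *\<^sub>R sgn v" for t :: real
  have ns: "norm (sgn v) \<le> 1" by (simp add: norm_sgn)
  have ss: "S *\<^sub>R sgn v = v" by (cases "v = 0") (auto simp: S_def sgn_div_norm)
  have gd: "norm (\<gamma> x - \<gamma> y) \<le> \<bar>x - y\<bar>" for x y
  proof -
    have "\<gamma> x - \<gamma> y = (x - y) *\<^sub>R sgn v" by (simp add: \<gamma>_def algebra_simps)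
    then show ?thesis using ns mult_left_mono[OF ns, of "\<bar>x - y\<bar>"] by simp
  qed
  have "1-lipschitz_on {0..S} \<gamma>" using gd by (intro lipschitz_onI) (auto simp: dist_norm)
  moreover have "infdist (\<gamma> t) (level \<zeta>) \<le> \<eta>" if "t \<in> {0..S}" for t
  proof -
    have "infdist (\<gamma> t) (level \<zeta>) \<le> dist (\<gamma> t) p" by (rule infdist_le[OF p])
    also have "\<dots> \<le> t" using gd[of t 0] that by (simp add: dist_norm \<gamma>_def)
    finally show ?thesis using that n by (simp add: S_def v_def)
  qed
  ultimately show ?thesis unfolding nearly_joined_def
    using \<tau> ss by (intro conjI exI[of _ \<gamma>] exI[of _ \<tau>]) (auto simp: \<gamma>_def S_def v_def)
qed

text \<open>Moving along the orbit of \<open>N\<close> with the velocity \<open>x\<close> that nearly minimises the distance of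
  \<open>c'\<close> from the vertical space makes \<open>c\<close> nearly horizontal near a given time.\<close>

lemma horizontal_displacement:
  assumes c: "(c has_vector_derivative v) (at t)" and e: "e > 0"
  obtains d where "d > 0" "\<And>a b. a \<le> t \<Longrightarrow> t \<le> b \<Longrightarrow> b - a < d \<Longrightarrow>
    \<exists>\<tau>\<in>N. norm (torus_act \<tau> (c b) - c a) \<le> (infdist v (vertical_space N (c t)) + e) * (b - a)"
proof -
  define f where "f = infdist v (vertical_space N (c t))"
  have "f < f + e / 2" using e by simp
  then obtain x where x: "x \<in> lie_algebra N" "norm (v - fund x (c t)) < f + e / 2"
    unfolding f_def infdist_vertical_less_iff[OF one_in_N] by blast
  \<comment> \<open>The torus element is 1 at s = t, so the velocity of \<psi> at t is D. Only the
    first-order behaviour at this single time is used.\<close>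
  define \<psi> where "\<psi> s = torus_act (torus_exp ((t - s) *\<^sub>R x)) (c s)" for s
  define D where "D = v - fund x (c t)"
  have "(\<psi> has_vector_derivative D) (at t)"
  proof (rule has_vector_derivative_quatI)
    fix k
    have "((\<lambda>s. rot ((t - s) * x $ k) (coord k (c s))) has_vector_derivative
        rot ((t - t) * x $ k) (coord k v + (- (x $ k)) *\<^sub>R rot_gen (coord k (c t)))) (at t)"
      by (rule has_vector_derivative_rot bounded_linear.has_vector_derivative[OF bounded_linear_coord c])+
         (auto intro!: derivative_eq_intros)
    then show "((\<lambda>s. coord k (\<psi> s)) has_vector_derivative coord k D) (at t)"
      by (simp add: \<psi>_def coord_torus_exp D_def)
  qed
  then obtain d where d: "d > 0" "\<And>y. \<bar>y - t\<bar> < d \<Longrightarrow> norm (\<psi> y - \<psi> t - (y - t) *\<^sub>R D) \<le> e / 2 * \<bar>y - t\<bar>"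
    unfolding has_vector_derivative_def has_derivative_at_alt using e by (metis half_gt_zero real_norm_def)
  show thesis
  proof (rule that[OF d(1)])
    fix a b assume ab: "a \<le> t" "t \<le> b" "b - a < d"
    have tri: "norm (u + v - w) \<le> norm u + norm v + norm w" for u v w :: "'d quat"
      using norm_triangle_ineq4[of "u + v" w] norm_triangle_ineq[of u v] by linarith
    have "\<psi> b - \<psi> a = (b - a) *\<^sub>R D + (\<psi> b - \<psi> t - (b - t) *\<^sub>R D) - (\<psi> a - \<psi> t - (a - t) *\<^sub>R D)"
      by (simp add: algebra_simps)
    then have "norm (\<psi> b - \<psi> a) \<le> norm ((b - a) *\<^sub>R D) + norm (\<psi> b - \<psi> t - (b - t) *\<^sub>R D) + norm (\<psi> a - \<psi> t - (a - t) *\<^sub>R D)"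
      by (simp only: tri)
    also have "\<dots> \<le> (b - a) * (f + e / 2) + e / 2 * \<bar>b - t\<bar> + e / 2 * \<bar>a - t\<bar>"
      using ab x(2) by (intro add_mono d(2)) (auto simp: D_def intro!: mult_left_mono)
    also have "\<dots> = (f + e) * (b - a)" using ab by (simp add: field_simps)
    finally have *: "norm (\<psi> b - \<psi> a) \<le> (f + e) * (b - a)" .
    \<comment> \<open>The isometry \<open>torus_exp ((t - a) *\<^sub>R x)\<close> is common to
      \<open>\<psi> a\<close> and \<open>\<psi> b\<close>; removing it leaves \<open>c a\<close>
      and, up to \<tau>, \<open>c b\<close>.\<close>
    define \<tau> where "\<tau> = torus_exp ((a - b) *\<^sub>R x)"
    have \<tau>: "\<tau> \<in> N" using x(1) by (simp add: \<tau>_def lie_algebra_def)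
    have ta: "torus_exp ((t - a) *\<^sub>R x) \<in> N" using x(1) by (simp add: lie_algebra_def)
    have "torus_exp ((t - b) *\<^sub>R x) = torus_exp ((t - a) *\<^sub>R x) * \<tau>"
      by (simp add: \<tau>_def flip: torus_exp_add scaleR_add_left)
    then have "norm (\<psi> b - \<psi> a) = norm (torus_act \<tau> (c b) - c a)"
      by (simp add: \<psi>_def torus_act_mult norm_torus_act_diff[OF N_torus[OF ta]])
    then show "\<exists>\<tau>\<in>N. norm (torus_act \<tau> (c b) - c a) \<le> (infdist v (vertical_space N (c t)) + e) * (b - a)"
      using * \<tau> by (auto simp: f_def)
  qed
qed

text \<open>Along a fine subdivision c is replaced by chords adjusted by torus elements, whose
  lengths are bounded by a Riemann sum of the horizontal speed. The speed may be unbounded near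
  break points, so the gauge integral is used; its tags and gauges also match the pointwise estimate
  of \<open>horizontal_displacement\<close>.\<close>

lemma nearly_joined_curve:
  assumes c: "c \<in> curves \<zeta> p q" "pathstart c = p" and S: "quotient_length N c < ennreal S" and \<eta>: "\<eta> > 0"
  shows "nearly_joined \<eta> \<zeta> p q S"
proof -
  have v: "valid_path c" and lev: "\<And>t. t \<in> {0..1} \<Longrightarrow> c t \<in> level \<zeta>"
    using c by (auto simp: curves_def path_image_def)
  obtain E0 D where E0: "finite E0" and cc: "continuous_on {0..1} c"
    and D: "\<And>t. t \<in> {0..1} - E0 \<Longrightarrow> (c has_vector_derivative D t) (at t)"
    by (rule valid_pathE[OF v]) blast
  define E where "E = E0 \<union> {0, 1}"
  have E: "finite E" using E0 by (simp add: E_def)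
  obtain I where I: "quotient_length N c = ennreal I" "I \<ge> 0"
    using S by (cases "quotient_length N c" rule: ennreal_cases) auto
  then have IS: "I < S" using S by (simp add: ennreal_less_iff)
  define f where "f = qspeed N c"
  have f0: "f t \<ge> 0" for t by (simp add: f_def qspeed_nonneg)
  have "(f has_integral I) {0..1}"
  proof -
    have m: "(\<lambda>t. ennreal (indicator {0..1} t * f t)) = (\<lambda>t. ennreal (f t) * indicator {0..1} t)"
      by (auto simp: indicator_def)
    have "(\<lambda>t. ennreal (indicator {0..1} t * f t)) \<in> borel_measurable borel"
      by (simp only: m) (simp only: f_def measurable_qspeed[OF v one_in_N])
    then have "(\<lambda>t. enn2real (ennreal (indicator {0..1} t * f t))) \<in> borel_measurable borel"
      by measurable
    then have "(\<lambda>t. indicator {0..1} t * f t) \<in> borel_measurable borel"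
      using f0 by simp
    then have "((\<lambda>t. indicator {0..1} t * f t) has_integral I) UNIV"
    proof (rule nn_integral_has_integral)
      have "(\<integral>\<^sup>+t. ennreal (indicator {0..1} t * f t) \<partial>lborel) = quotient_length N c"
        by (simp only: m) (simp only: quotient_length_eq f_def)
      then show "(\<integral>\<^sup>+t. ennreal (indicator {0..1} t * f t) \<partial>lborel) = ennreal I" using I by simp
    qed (use f0 I in auto)
    moreover have "(\<lambda>t. indicator {0..1} t * f t) = (\<lambda>t. if t \<in> {0..1} then f t else 0)"
      by (auto simp: indicator_def)
    ultimately have "((\<lambda>t. if t \<in> {0..1} then f t else 0) has_integral I) UNIV" by simp
    then show ?thesis by (simp only: has_integral_restrict_UNIV)
  qed
  \<comment> \<open>The excess S - I is split into equal shares: one for the Riemann sum, one for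
    the chords over the unit interval, two for each exceptional time.\<close>
  define e where "e = (S - I) / (2 + 2 * real (card E))"
  have e: "e > 0" using IS by (simp add: e_def)
  obtain g where g: "gauge g" and gI: "\<And>D. D tagged_division_of {0..1} \<Longrightarrow> g fine D \<Longrightarrow>
      norm ((\<Sum>(x,K)\<in>D. measure lborel K *\<^sub>R f x) - I) < e"
  proof -
    from \<open>(f has_integral I) {0..1}\<close>[unfolded has_integral_real [of f I 0 1], rule_format, OF e]
    show thesis by (elim exE conjE) (rule that, assumption, blast)
  qed
  \<comment> \<open>Every s in E adds 0 before s, 1 at s and 2 after s. Hence H b - H a >= 1 for
    each nondegenerate interval containing s, even if s is an endpoint.\<close>
  define H where "H t = (\<Sum>s\<in>E. of_bool (s < t) + of_bool (s \<le> t) :: real)" for t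
  \<comment> \<open>All three terms of the cost are additive over adjacent intervals, which makes P
    stable under concatenation.\<close>
  define P where "P a b \<longleftrightarrow> (0 \<le> a \<and> b \<le> 1 \<longrightarrow> (\<exists>T. T tagged_division_of {a..b} \<and> g fine T \<and>
      nearly_joined \<eta> \<zeta> (c a) (c b) ((\<Sum>(x,K)\<in>T. measure lborel K *\<^sub>R f x) + e * (b - a) + e * (H b - H a))))" for a b
  have "P 0 1"
  proof (rule Bolzano)
    fix a b d :: real
    assume ab: "P a b" "P b d" "a \<le> b" "b \<le> d"
    show "P a d" unfolding P_def
    proof
      assume ad: "0 \<le> a \<and> d \<le> 1"
      obtain T1 where T1: "T1 tagged_division_of {a..b}" "g fine T1"
        "nearly_joined \<eta> \<zeta> (c a) (c b) ((\<Sum>(x,K)\<in>T1. measure lborel K *\<^sub>R f x) + e * (b - a) + e * (H b - H a))"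
        using ab ad by (auto simp: P_def)
      obtain T2 where T2: "T2 tagged_division_of {b..d}" "g fine T2"
        "nearly_joined \<eta> \<zeta> (c b) (c d) ((\<Sum>(x,K)\<in>T2. measure lborel K *\<^sub>R f x) + e * (d - b) + e * (H d - H b))"
        using ab ad by (auto simp: P_def)
      have "T1 \<union> T2 tagged_division_of {a..b} \<union> {b..d}"
        by (rule tagged_division_Un[OF T1(1) T2(1)]) auto
      then have T: "T1 \<union> T2 tagged_division_of {a..d}" using ab by (simp add: ivl_disj_un_two_touch)
      have "(\<Sum>(x,K)\<in>T1 \<union> T2. measure lborel K *\<^sub>R f x) = (\<Sum>(x,K)\<in>T1. measure lborel K *\<^sub>R f x) + (\<Sum>(x,K)\<in>T2. measure lborel K *\<^sub>R f x)"
      proof (rule sum.union_inter_neutral)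
        show "finite T1" "finite T2" using T1 T2 by auto
        \<comment> \<open>A pair common to both divisions has its interval inside {b} and
          contributes nothing.\<close>
        show "\<forall>y\<in>T1 \<inter> T2. (case y of (x, K) \<Rightarrow> measure lborel K *\<^sub>R f x) = 0"
        proof (clarify)
          fix x K assume xK: "(x, K) \<in> T1" "(x, K) \<in> T2"
          have "K \<subseteq> {a..b}" "K \<subseteq> {b..d}"
            using tagged_division_ofD(3)[OF T1(1) xK(1)] tagged_division_ofD(3)[OF T2(1) xK(2)] by auto
          then have "K \<subseteq> {b}" by force
          then have "measure lborel K = 0"
            by (auto dest!: subset_singletonD)
          then show "measure lborel K *\<^sub>R f x = 0" by simp
        qed
      qed
      then have "nearly_joined \<eta> \<zeta> (c a) (c d) ((\<Sum>(x,K)\<in>T1 \<union> T2. measure lborel K *\<^sub>R f x) + e * (d - a) + e * (H d - H a))"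
        using nearly_joined_trans[OF T1(3) T2(3)] by (simp add: algebra_simps)
      then show "\<exists>T. T tagged_division_of {a..d} \<and> g fine T \<and>
          nearly_joined \<eta> \<zeta> (c a) (c d) ((\<Sum>(x,K)\<in>T. measure lborel K *\<^sub>R f x) + e * (d - a) + e * (H d - H a))"
        using T fine_Un[OF T1(2) T2(2)] by blast
    qed
  next
    fix x :: real assume x: "0 \<le> x" "x \<le> 1"
    obtain d1 where d1: "d1 > 0" "ball x d1 \<subseteq> g x"
      using g by (metis gauge_def open_contains_ball)
    have Hmono: "H a \<le> H b" if "a \<le> b" for a b
      unfolding H_def using that by (intro sum_mono add_mono) auto
    have PI: "P a b" if ab: "a \<le> x" "x \<le> b" "b - a < d1"
      and nj: "0 \<le> a \<Longrightarrow> b \<le> 1 \<Longrightarrow> nearly_joined \<eta> \<zeta> (c a) (c b) ((f x + e) * (b - a) + e * (H b - H a))" for a b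
      unfolding P_def
    proof
      assume "0 \<le> a \<and> b \<le> 1"
      have "{a..b} \<subseteq> ball x d1" using ab by (auto simp: dist_real_def)
      then have "g fine {(x, {a..b})}" using d1 by (auto simp: fine_def)
      moreover have "{(x, {a..b})} tagged_division_of {a..b}"
        using tagged_division_of_self_real[of x a b] ab by auto
      ultimately show "\<exists>T. T tagged_division_of {a..b} \<and> g fine T \<and>
          nearly_joined \<eta> \<zeta> (c a) (c b) ((\<Sum>(x,K)\<in>T. measure lborel K *\<^sub>R f x) + e * (b - a) + e * (H b - H a))"
        using nj \<open>0 \<le> a \<and> b \<le> 1\<close> ab by (intro exI[of _ "{(x, {a..b})}"]) (auto simp: algebra_simps)
    qed
    show "\<exists>d>0. \<forall>a b. a \<le> x \<and> x \<le> b \<and> b - a < d \<longrightarrow> P a b"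
    proof (cases "x \<in> E")
      case False
      then have xE: "x \<in> {0..1} - E0" using x by (auto simp: E_def)
      have fx: "f x = infdist (D x) (vertical_space N (c x))"
        by (simp add: f_def qspeed_def vector_derivative_at[OF D[OF xE]])
      obtain d2 where d2: "d2 > 0" "\<And>a b. a \<le> x \<Longrightarrow> x \<le> b \<Longrightarrow> b - a < d2 \<Longrightarrow>
           \<exists>\<tau>\<in>N. norm (torus_act \<tau> (c b) - c a) \<le> (f x + e) * (b - a)"
        using horizontal_displacement[OF D[OF xE] e] unfolding fx by metis
      \<comment> \<open>The last bound keeps the chord no longer than \<eta>, as
        \<open>nearly_joined_short\<close> demands.\<close>
      define d where "d = min d1 (min d2 (\<eta> / (f x + e)))"
      have fe: "f x + e > 0" using f0[of x] e by simp
      have "P a b" if ab: "a \<le> x" "x \<le> b" "b - a < d" for a b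
      proof (rule PI)
        assume a0: "0 \<le> a" "b \<le> 1"
        obtain \<tau> where \<tau>: "\<tau> \<in> N" "norm (torus_act \<tau> (c b) - c a) \<le> (f x + e) * (b - a)"
          using d2(2)[of a b] ab by (auto simp: d_def)
        have "b - a < \<eta> / (f x + e)" using ab by (simp add: d_def)
        then have "(f x + e) * (b - a) \<le> \<eta>" using fe by (simp add: field_simps)
        then have "nearly_joined \<eta> \<zeta> (c a) (c b) (norm (torus_act \<tau> (c b) - c a))"
          using \<tau> a0 ab by (intro nearly_joined_short lev) auto
        then show "nearly_joined \<eta> \<zeta> (c a) (c b) ((f x + e) * (b - a) + e * (H b - H a))"
          by (rule nearly_joined_mono) (use \<tau>(2) Hmono[of a b] ab e in \<open>auto intro!: add_increasing2\<close>)
      qed (use ab in \<open>auto simp: d_def\<close>)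
      moreover have "d > 0" using d1 d2 fe \<eta> by (simp add: d_def)
      ultimately show ?thesis by blast
    next
      case True
      \<comment> \<open>At an exceptional time no derivative is available. By continuity the chord
        is no longer than e, and the jump of H pays for it.\<close>
      define m where "m = min e \<eta>"
      have m: "m > 0" using e \<eta> by (simp add: m_def)
      obtain d2 where d2: "d2 > 0" "\<And>y. y \<in> {0..1} \<Longrightarrow> dist y x < d2 \<Longrightarrow> dist (c y) (c x) < m / 2"
        using cc x m unfolding continuous_on_iff by (metis atLeastAtMost_iff half_gt_zero)
      have "P a b" if ab: "a \<le> x" "x \<le> b" "b - a < min d1 d2" for a b
      proof (rule PI)
        assume a0: "0 \<le> a" "b \<le> 1"
        show "nearly_joined \<eta> \<zeta> (c a) (c b) ((f x + e) * (b - a) + e * (H b - H a))"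
        proof (cases "a = b")
          case True
          then show ?thesis using nearly_joined_short[OF lev one_in_N, of a "c b" \<eta>] \<eta> a0 ab by simp
        next
          case False
          have "dist (c a) (c x) < m / 2" "dist (c b) (c x) < m / 2"
            using d2(2)[of a] d2(2)[of b] ab a0 x by (auto simp: dist_real_def)
          then have "dist (c a) (c b) < m" by (rule dist_triangle_half_l)
          then have n: "norm (torus_act 1 (c b) - c a) \<le> m" by (simp add: dist_norm norm_minus_commute)
          have "H b - H a = (\<Sum>s\<in>E. (of_bool (s < b) + of_bool (s \<le> b)) - (of_bool (s < a) + of_bool (s \<le> a)))"
            by (simp add: H_def sum_subtractf)
          also have "\<dots> \<ge> (\<Sum>s\<in>{x}. (of_bool (s < b) + of_bool (s \<le> b)) - (of_bool (s < a) + of_bool (s \<le> a)))"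
            using True E ab by (intro sum_mono2) auto
          also have "(\<Sum>s\<in>{x}. (of_bool (s < b) + of_bool (s \<le> b)) - (of_bool (s < a) + of_bool (s \<le> a)) :: real) \<ge> 1"
            using ab False by auto
          finally have "H b - H a \<ge> 1" by simp
          then have "e * 1 \<le> e * (H b - H a)" using e by (intro mult_left_mono) auto
          moreover have "0 \<le> (f x + e) * (b - a)" using f0[of x] e ab by simp
          moreover have "m \<le> e" "m \<le> \<eta>" by (auto simp: m_def)
          ultimately have "norm (torus_act 1 (c b) - c a) \<le> (f x + e) * (b - a) + e * (H b - H a)"
            using n by linarith
          moreover have "nearly_joined \<eta> \<zeta> (c a) (c b) (norm (torus_act 1 (c b) - c a))"
            using n \<open>m \<le> \<eta>\<close> a0 ab by (intro nearly_joined_short lev one_in_N) auto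
          ultimately show ?thesis using nearly_joined_mono by blast
        qed
      qed (use ab in auto)
      then show ?thesis using d1 d2 by (intro exI[of _ "min d1 d2"]) auto
    qed
  qed simp
  then obtain T where T: "T tagged_division_of {0..1}" "g fine T"
      and nj: "nearly_joined \<eta> \<zeta> (c 0) (c 1) ((\<Sum>(x,K)\<in>T. measure lborel K *\<^sub>R f x) + e * (1 - 0) + e * (H 1 - H 0))"
    by (auto simp: P_def)
  have "(\<Sum>(x,K)\<in>T. measure lborel K *\<^sub>R f x) < I + e" using gI[OF T] by (simp add: abs_less_iff)
  moreover have "H 1 \<le> 2 * real (card E)"
  proof -
    have "H 1 \<le> (\<Sum>s\<in>E. 2)" unfolding H_def by (intro sum_mono) auto
    then show ?thesis by simp
  qed
  moreover have "H 0 \<ge> 0" unfolding H_def by (intro sum_nonneg) auto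
  ultimately have "(\<Sum>(x,K)\<in>T. measure lborel K *\<^sub>R f x) + e * (1 - 0) + e * (H 1 - H 0) \<le> I + e + e + e * (2 * real (card E))"
    using e by (intro add_mono mult_left_mono) auto
  also have "\<dots> = I + e * (2 + 2 * real (card E))" by (simp add: algebra_simps)
  also have "\<dots> = S"
  proof -
    have "2 + 2 * real (card E) \<noteq> 0" by (smt (verit) of_nat_0_le_iff)
    then show ?thesis by (simp add: e_def)
  qed
  finally have "nearly_joined \<eta> \<zeta> (c 0) (c 1) S" using nj nearly_joined_mono by blast
  moreover have "c 0 = p" using c(2) by (simp add: pathstart_def)
  moreover obtain \<tau> where "\<tau> \<in> N" "c 1 = torus_act \<tau> q" using c by (auto simp: curves_def orbit_def pathfinish_def)
  ultimately show ?thesis using nearly_joined_torus_act by metis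
qed

lemma nearly_joined_qlen:
  assumes "qlen \<zeta> p q < ennreal S" "\<eta> > 0"
  shows "nearly_joined \<eta> \<zeta> p q S"
  using qlen_lessE[OF assms(1)] nearly_joined_curve assms(2) by metis

text \<open>The source of the lower bound of the quotient distance by the flat distance between
  orbits.\<close>

lemma nearly_joined_norm:
  assumes "nearly_joined \<eta> \<zeta> p q S"
  obtains \<tau> where "\<tau> \<in> N" "norm (torus_act \<tau> q - p) \<le> S"
proof -
  obtain \<gamma> \<tau> where g: "0 \<le> S" "\<tau> \<in> N" "\<gamma> 0 = p" "\<gamma> S = torus_act \<tau> q" "1-lipschitz_on {0..S} \<gamma>"
    using assms by (auto simp: nearly_joined_def)
  have "dist (\<gamma> S) (\<gamma> 0) \<le> 1 * dist S 0" using g(1) by (intro lipschitz_onD[OF g(5)]) auto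
  then show thesis using g by (intro that[of \<tau>]) (auto simp: dist_norm)
qed

text \<open>The tolerance 1 / (i + 1) shrinks along the sequence, so the uniform limit lies in the
  limiting level set. The torus elements at the far ends converge along a further subsequence
  because N is compact.\<close>

lemma limit_curve:
  assumes lev: "\<And>i. p i \<in> level (\<zeta> i)"
    and lim: "\<zeta> \<longlonglongrightarrow> \<zeta>0" "p \<longlonglongrightarrow> p0" "q \<longlonglongrightarrow> q0"
    and less: "\<And>i. qlen (\<zeta> i) (p i) (q i) < ennreal S"
 obtains \<gamma> :: "real \<Rightarrow> 'd quat" and \<tau> where "\<tau> \<in> N" "\<gamma> 0 = p0" "\<gamma> 1 = torus_act \<tau> q0" "S-lipschitz_on {0..1} \<gamma>"
    "\<And>t. t \<in> {0..1} \<Longrightarrow> \<gamma> t \<in> level \<zeta>0"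
proof -
  have "nearly_joined (inverse (real (Suc i))) (\<zeta> i) (p i) (q i) S" for i
    using nearly_joined_qlen[OF less] by simp
  then obtain G0 T where S: "0 \<le> S" and G0: "\<And>i. T i \<in> N" "\<And>i. G0 i 0 = p i" "\<And>i. G0 i S = torus_act (T i) (q i)"
     "\<And>i. 1-lipschitz_on {0..S} (G0 i)" "\<And>i t. t \<in> {0..S} \<Longrightarrow> infdist (G0 i t) (level (\<zeta> i)) \<le> inverse (real (Suc i))"
    unfolding nearly_joined_def by metis
  \<comment> \<open>On the unit interval the duration S becomes the Lipschitz constant.\<close>
  define G where "G i t = G0 i (S * t)" for i t
  have St: "S * t \<in> {0..S}" if "t \<in> {0..1}" for t using that S by (auto simp: mult_left_le)
  have Gl: "norm (G i x - G i y) \<le> S * \<bar>x - y\<bar>" if "x \<in> {0..1}" "y \<in> {0..1}" for i x y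
  proof -
    have "dist (G0 i (S * x)) (G0 i (S * y)) \<le> 1 * dist (S * x) (S * y)"
      using that St by (intro lipschitz_onD[OF G0(4)]) auto
    also have "\<dots> = S * \<bar>x - y\<bar>" using S by (simp add: dist_real_def abs_mult flip: right_diff_distrib)
    finally show ?thesis by (simp add: G_def dist_norm)
  qed
  have G0p: "G i 0 = p i" for i by (simp add: G_def G0)
  obtain M where M: "\<And>i. norm (p i) \<le> M"
    using convergent_imp_bounded[of p] lim(2) unfolding convergent_def bounded_iff by (metis rangeI)
  obtain g k where g: "continuous_on {0..1} g" "strict_mono (k :: nat \<Rightarrow> nat)"
     "\<And>e. 0 < e \<Longrightarrow> \<exists>n0. \<forall>n x. n \<ge> n0 \<and> x \<in> {0..1} \<longrightarrow> norm (G (k n) x - g x) < e"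
  proof (rule Arzela_Ascoli[of "{0..1::real}" G "M + S"])
    show "norm (G i x) \<le> M + S" if "x \<in> {0..1}" for i x
    proof -
      have "norm (G i x) \<le> norm (G i 0) + norm (G i x - G i 0)" by (metis add.commute norm_triangle_sub)
      also have "\<dots> \<le> M + S * \<bar>x - 0\<bar>" using Gl[of x 0 i] that M[of i] by (intro add_mono) (auto simp: G0p)
      also have "\<dots> \<le> M + S" using that S by (simp add: mult_left_le)
      finally show ?thesis .
    qed
    show "\<exists>d>0. \<forall>n y. y \<in> {0..1} \<and> norm (x - y) < d \<longrightarrow> norm (G n x - G n y) < e"
      if "x \<in> {0..1}" "0 < e" for x e
    proof (intro exI[of _ "e / (S + 1)"] conjI allI impI)
      show "0 < e / (S + 1)" using that S by simp
      fix n y assume y: "y \<in> {0..1} \<and> norm (x - y) < e / (S + 1)"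
      have "norm (G n x - G n y) \<le> S * \<bar>x - y\<bar>" using Gl that y by auto
      also have "\<dots> \<le> (S + 1) * \<bar>x - y\<bar>" by (intro mult_right_mono) auto
      also have "\<dots> < e" using y S by (simp add: field_simps)
      finally show "norm (G n x - G n y) < e" .
    qed
  qed auto
  have conv: "(\<lambda>n. G (k n) x) \<longlonglongrightarrow> g x" if "x \<in> {0..1}" for x
    unfolding LIMSEQ_iff using g(3) that by meson
  obtain \<tau> m where \<tau>: "\<tau> \<in> N" "strict_mono (m :: nat \<Rightarrow> nat)" "(\<lambda>n. T (k (m n))) \<longlonglongrightarrow> \<tau>"
  proof -
    have "seq_compact N" using compact_N by (rule compact_imp_seq_compact)
    then show thesis
      by (rule seq_compactE[of N "\<lambda>n. T (k n)"]) (use G0(1) that in \<open>auto simp: o_def\<close>)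
  qed
  show thesis
  proof (rule that[OF \<tau>(1), of g])
    have pk: "(\<lambda>n. p (k n)) \<longlonglongrightarrow> p0" using LIMSEQ_subseq_LIMSEQ[OF lim(2) g(2)] by (simp add: o_def)
    then show "g 0 = p0" using conv[of 0] by (simp add: G0p) (metis LIMSEQ_unique)
    have q: "(\<lambda>n. q (k (m n))) \<longlonglongrightarrow> q0"
      using LIMSEQ_subseq_LIMSEQ[OF lim(3) strict_mono_o[OF g(2) \<tau>(2)]] by (simp add: o_def)
    have G1: "(\<lambda>n. G (k (m n)) 1) \<longlonglongrightarrow> g 1"
      using LIMSEQ_subseq_LIMSEQ[OF conv[of 1] \<tau>(2)] by (simp add: o_def)
    have nz: "\<tau> $ j \<noteq> 0" for j
      using N_torus[OF \<tau>(1)] by (auto simp: torus_iff) (metis norm_zero zero_neq_one)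
    have "(\<lambda>n. fst (torus_act (T (k (m n))) (q (k (m n))))) \<longlonglongrightarrow> fst (torus_act \<tau> q0)"
      unfolding torus_act_def fst_conv
    proof (rule vec_tendstoI)
      fix j
      have "(\<lambda>n. inverse (T (k (m n)) $ j) * fst (q (k (m n))) $ j) \<longlonglongrightarrow> inverse (\<tau> $ j) * fst q0 $ j"
        by (intro tendsto_mult tendsto_inverse tendsto_vec_nth tendsto_fst \<tau>(3) q nz)
      then show "(\<lambda>n. (\<chi> j. inverse (T (k (m n)) $ j) * fst (q (k (m n))) $ j) $ j) \<longlonglongrightarrow> (\<chi> j. inverse (\<tau> $ j) * fst q0 $ j) $ j"
        by simp
    qed
    moreover have "(\<lambda>n. snd (torus_act (T (k (m n))) (q (k (m n))))) \<longlonglongrightarrow> snd (torus_act \<tau> q0)"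
      unfolding torus_act_def snd_conv
    proof (rule vec_tendstoI)
      fix j
      have "(\<lambda>n. T (k (m n)) $ j * snd (q (k (m n))) $ j) \<longlonglongrightarrow> \<tau> $ j * snd q0 $ j"
        by (intro tendsto_mult tendsto_vec_nth tendsto_snd \<tau>(3) q)
      then show "(\<lambda>n. (\<chi> j. T (k (m n)) $ j * snd (q (k (m n))) $ j) $ j) \<longlonglongrightarrow> (\<chi> j. \<tau> $ j * snd q0 $ j) $ j"
        by simp
    qed
    ultimately have "(\<lambda>n. torus_act (T (k (m n))) (q (k (m n)))) \<longlonglongrightarrow> torus_act \<tau> q0"
      using tendsto_Pair by fastforce
    moreover have "(\<lambda>n. torus_act (T (k (m n))) (q (k (m n)))) \<longlonglongrightarrow> g 1"
      using G1 by (simp add: G_def G0)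
    ultimately show "g 1 = torus_act \<tau> q0" using LIMSEQ_unique by blast
    show "S-lipschitz_on {0..1} g"
    proof (rule lipschitz_onI[OF _ S])
      fix x y :: real assume xy: "x \<in> {0..1}" "y \<in> {0..1}"
      have "(\<lambda>n. norm (G (k n) x - G (k n) y)) \<longlonglongrightarrow> norm (g x - g y)"
        by (intro tendsto_intros conv xy)
      then have "norm (g x - g y) \<le> S * \<bar>x - y\<bar>"
        by (rule LIMSEQ_le_const2) (use Gl[OF xy] in auto)
      then show "dist (g x) (g y) \<le> S * dist x y" by (simp add: dist_norm)
    qed
    fix t :: real assume t: "t \<in> {0..1}"
    \<comment> \<open>The factor 2 makes the inequality strict, so that some point of the level set
      realises it.\<close>
    have "\<exists>x\<in>level (\<zeta> i). dist (G i t) x < 2 * inverse (real (Suc i))" for i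
    proof -
      have "infdist (G i t) (level (\<zeta> i)) < 2 * inverse (real (Suc i))"
      proof -
        have "0 < inverse (real (Suc i))" by simp
        then show ?thesis using G0(5)[OF St[OF t], of i] unfolding G_def by linarith
      qed
      then show ?thesis using lev[of i] by (subst (asm) infdist_less_iff) auto
    qed
    then obtain X where X: "\<And>i. X i \<in> level (\<zeta> i)" "\<And>i. dist (G i t) (X i) < 2 * inverse (real (Suc i))"
      by metis
    have "(\<lambda>i. 2 * inverse (real (Suc i))) \<longlonglongrightarrow> 2 * 0" by (intro tendsto_intros LIMSEQ_inverse_real_of_nat)
    then have "(\<lambda>i. 2 * inverse (real (Suc i))) \<longlonglongrightarrow> 0" by simp
    then have "(\<lambda>i. norm (X i - G i t)) \<longlonglongrightarrow> 0"
      by (rule tendsto_sandwich[rotated 3, where f = "\<lambda>_. 0"])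
         (use X(2) in \<open>auto intro!: always_eventually less_imp_le simp: dist_norm norm_minus_commute\<close>)
    then have "(\<lambda>i. X i - G i t) \<longlonglongrightarrow> 0" by (rule tendsto_norm_zero_cancel)
    then have "(\<lambda>n. X (k n) - G (k n) t) \<longlonglongrightarrow> 0"
      using LIMSEQ_subseq_LIMSEQ[OF _ g(2)] by (fastforce simp: o_def)
    from tendsto_add[OF this conv[OF t]] have "(\<lambda>n. X (k n)) \<longlonglongrightarrow> g t" by simp
    then show "g t \<in> level \<zeta>0"
      using closed_level_set_limit[of "\<lambda>n. X (k n)" \<iota> "\<lambda>n. \<zeta> (k n)"] X(1)
        LIMSEQ_subseq_LIMSEQ[OF lim(1) g(2)] by (auto simp: o_def)
  qed
qed

end

section \<open>Length comparison between neighbouring level sets\<close>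

text \<open>A cumulative quantity: the time spent in W during an interval becomes a difference and
  telescopes when intervals are concatenated.\<close>

definition time_in :: "real set \<Rightarrow> real \<Rightarrow> real" where
  "time_in W s = measure lebesgue ({0..s} \<inter> W)"

lemma time_in_gap:
  fixes W :: "real set"
  assumes W: "W \<in> lmeasurable" and uv: "0 \<le> u" "u \<le> v" and sub: "{u<..<v} \<subseteq> W"
  shows "time_in W u + (v - u) \<le> time_in W v"
proof -
  have f: "{0..s} \<inter> W \<in> lmeasurable" for s using W by (intro fmeasurable_Int_fmeasurable) auto
  have g: "{u<..<v} \<in> lmeasurable" by simp
  have "time_in W u + (v - u) = time_in W u + measure lebesgue {u<..<v}"
    using uv by simp
  also have "\<dots> = measure lebesgue (({0..u} \<inter> W) \<union> {u<..<v})"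
    unfolding time_in_def using f[of u] g by (intro measure_Union [symmetric]) (use fmeasurableD2[OF f[of u]] fmeasurableD2[OF g] fmeasurableD[OF f[of u]] in \<open>auto simp: infinity_ennreal_def\<close>)
  also have "\<dots> \<le> time_in W v"
    unfolding time_in_def by (rule measure_mono_fmeasurable) (use f[of u] g f[of v] sub uv in \<open>auto dest: fmeasurableD\<close>)
  finally show ?thesis .
qed

lemma time_in_mono:
  fixes W :: "real set"
  assumes W: "W \<in> lmeasurable" and uv: "u \<le> v"
  shows "time_in W u \<le> time_in W v"
proof -
  have f: "{0..s} \<inter> W \<in> lmeasurable" for s using W by (intro fmeasurable_Int_fmeasurable) auto
  show ?thesis unfolding time_in_def by (rule measure_mono_fmeasurable) (use f[of u] f[of v] uv in \<open>auto dest: fmeasurableD\<close>)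
qed

text \<open>After its last zero before \<open>b\<close> the path \<open>f\<close> needs a time of at least \<open>\<parallel>f b\<parallel> / L\<close>, all of it
  outside of the zero set.\<close>

lemma lipschitz_gap:
  fixes f :: "real \<Rightarrow> 'a::real_normed_vector"
  assumes f: "L-lipschitz_on {0..1} f" and W: "W \<in> lmeasurable" and zero: "f t = 0"
    and sub: "\<And>s. s \<in> {0..1} \<Longrightarrow> a \<le> s \<Longrightarrow> s \<le> b \<Longrightarrow> f s \<noteq> 0 \<Longrightarrow> s \<in> W"
    and abt: "0 \<le> a" "a \<le> t" "t \<le> b" "b \<le> 1"
  shows "norm (f b) \<le> L * (time_in W b - time_in W t)"
    and "norm (f a) \<le> L * (time_in W t - time_in W a)"
proof -
  have L: "L \<ge> 0" using f by (rule lipschitz_on_nonneg)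
  have cont: "continuous_on {0..1} f" using f by (rule lipschitz_on_continuous_on)
  have cZ: "compact {s \<in> {u..v}. f s = 0}" if "0 \<le> u" "v \<le> 1" for u v
  proof -
    have "continuous_on {u..v} f" using cont by (rule continuous_on_subset) (use that in auto)
    then have "closed {s \<in> {u..v}. f s = 0}"
      using continuous_closed_preimage_constant[of "{u..v}" f 0] by simp
    moreover have "bounded {s \<in> {u..v}. f s = 0}" by (rule bounded_subset[of "{u..v}"]) auto
    ultimately show ?thesis by (simp add: compact_eq_bounded_closed)
  qed
  obtain m where m: "m \<in> {t..b}" "f m = 0" "\<And>s. s \<in> {t..b} \<Longrightarrow> f s = 0 \<Longrightarrow> s \<le> m"
    using compact_attains_sup[OF cZ[of t b]] abt zero by auto
  have "{m<..<b} \<subseteq> W"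
  proof
    fix s assume s: "s \<in> {m<..<b}"
    then have "f s \<noteq> 0" using m(1) m(3)[of s] by auto
    then show "s \<in> W" using s m(1) abt by (intro sub) auto
  qed
  then have "time_in W m + (b - m) \<le> time_in W b"
    using m abt by (intro time_in_gap[OF W]) auto
  moreover have "time_in W t \<le> time_in W m"
    using m by (intro time_in_mono[OF W]) auto
  ultimately have le: "b - m \<le> time_in W b - time_in W t" by simp
  have "norm (f b) = dist (f b) (f m)" using m by simp
  also have "\<dots> \<le> L * dist b m" using m abt by (intro lipschitz_onD[OF f]) auto
  also have "\<dots> = L * (b - m)" using m by (simp add: dist_real_def)
  also have "\<dots> \<le> L * (time_in W b - time_in W t)"
    using le L by (rule mult_left_mono)
  finally show "norm (f b) \<le> L * (time_in W b - time_in W t)" .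
  obtain n where n: "n \<in> {a..t}" "f n = 0" "\<And>s. s \<in> {a..t} \<Longrightarrow> f s = 0 \<Longrightarrow> n \<le> s"
    using compact_attains_inf[OF cZ[of a t]] abt zero by auto
  have "{a<..<n} \<subseteq> W"
  proof
    fix s assume s: "s \<in> {a<..<n}"
    then have "f s \<noteq> 0" using n(1) n(3)[of s] by auto
    then show "s \<in> W" using s n(1) abt by (intro sub) auto
  qed
  then have "time_in W a + (n - a) \<le> time_in W n"
    using n abt by (intro time_in_gap[OF W]) auto
  moreover have "time_in W n \<le> time_in W t"
    using n by (intro time_in_mono[OF W]) auto
  ultimately have le: "n - a \<le> time_in W t - time_in W a" by simp
  have "norm (f a) = dist (f a) (f n)" using n by simp
  also have "\<dots> \<le> L * dist a n" using n abt by (intro lipschitz_onD[OF f]) auto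
  also have "\<dots> = L * (n - a)" using n by (simp add: dist_real_def)
  also have "\<dots> \<le> L * (time_in W t - time_in W a)"
    using le L by (rule mult_left_mono)
  finally show "norm (f a) \<le> L * (time_in W t - time_in W a)" .
qed

context torus_reduction
begin

text \<open>A left inverse of \<iota> spreads \<zeta>' - \<zeta> over the coordinates. Shifting each
  Hopf value by its share and lifting the shift with \<open>hopf_open\<close> moves q to the other
  level set. The square is the exponent 1/2 of that lemma; C does not depend on q, so singular
  points are covered too.\<close>

lemma level_set_approx:
  obtains C where "C \<ge> 0" "\<And>\<zeta> \<zeta>' q. q \<in> level \<zeta> \<Longrightarrow>
    \<exists>q'\<in>level \<zeta>'. (norm (q' - q))\<^sup>2 \<le> C * norm (\<zeta>' - \<zeta>)"
proof -
  obtain g where g: "linear g" "g \<circ> \<iota> = id"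
    using linear_injective_left_inverse[OF linear_iota inj_iota] by blast
  define C where "C = (\<Sum>k\<in>UNIV. 2 * norm (g (axis k 1)))"
  have "C \<ge> 0" by (simp add: C_def sum_nonneg)
  moreover have "\<exists>q'\<in>level \<zeta>'. (norm (q' - q))\<^sup>2 \<le> C * norm (\<zeta>' - \<zeta>)"
    if q: "q \<in> level \<zeta>" for q \<zeta> \<zeta>'
  proof -
    define w where "w k = blinfun_apply (\<zeta>' - \<zeta>) (g (axis k 1))" for k
    have "\<exists>c. hopf c = hopf (coord k q) - w k \<and> (norm (c - coord k q))\<^sup>2 \<le> 2 * norm (w k)" for k
      by (rule hopf_open[of "hopf (coord k q) - w k" "coord k q"]) auto
    then obtain c where c: "\<And>k. hopf (c k) = hopf (coord k q) - w k" "\<And>k. (norm (c k - coord k q))\<^sup>2 \<le> 2 * norm (w k)"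
      by metis
    have "(\<Sum>k\<in>UNIV. \<iota> l $ k *\<^sub>R w k) = blinfun_apply (\<zeta>' - \<zeta>) l" for l
    proof -
      have "(\<Sum>k\<in>UNIV. \<iota> l $ k *\<^sub>R w k) = blinfun_apply (\<zeta>' - \<zeta>) (g (\<Sum>k\<in>UNIV. \<iota> l $ k *\<^sub>R axis k 1))"
        by (simp add: w_def blinfun.sum_right blinfun.scaleR_right linear_sum[OF g(1)] linear_cmul[OF g(1)])
      also have "(\<Sum>k\<in>UNIV. \<iota> l $ k *\<^sub>R axis k 1) = \<iota> l"
        by (simp add: vec_eq_iff axis_def if_distrib cong: if_cong)
      also have "g (\<iota> l) = l" using g(2) by (metis comp_apply id_apply)
      finally show ?thesis .
    qed
    then have "of_coords c \<in> level \<zeta>'"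
      using q by (simp add: level_set_iff c(1) scaleR_diff_right sum_subtractf blinfun.diff_left)
    moreover have "(norm (of_coords c - q))\<^sup>2 \<le> C * norm (\<zeta>' - \<zeta>)"
    proof -
      have "(norm (of_coords c - q))\<^sup>2 \<le> (\<Sum>k\<in>UNIV. 2 * norm (g (axis k 1)) * norm (\<zeta>' - \<zeta>))"
        unfolding norm_quat
      proof (rule sum_mono)
        fix k
        have "norm (w k) \<le> norm (\<zeta>' - \<zeta>) * norm (g (axis k 1))" unfolding w_def by (rule norm_blinfun)
        then show "(norm (coord k (of_coords c - q)))\<^sup>2 \<le> 2 * norm (g (axis k 1)) * norm (\<zeta>' - \<zeta>)"
          using c(2)[of k] by (simp add: mult.commute)
      qed
      then show ?thesis by (simp add: C_def sum_distrib_right)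
    qed
    ultimately show ?thesis by blast
  qed
  ultimately show thesis using that by blast
qed

text \<open>Upper semicontinuity with value S: the limit superior of \<open>qlen\<close> is at most
  S when the parameter and both endpoints vary jointly. Speaking about all neighbouring level sets
  at once, it is additive under concatenation and can be proved along a curve piece by
  piece.\<close>

definition joined_nearby :: "('l \<Rightarrow>\<^sub>L (real ^ 3)) \<Rightarrow> 'd quat \<Rightarrow> 'd quat \<Rightarrow> real \<Rightarrow> bool" where
  "joined_nearby \<zeta> p q S \<longleftrightarrow> (\<forall>\<epsilon>>0. \<exists>\<delta>>0. \<forall>\<zeta>' p' q'. norm (\<zeta>' - \<zeta>) < \<delta> \<longrightarrow> norm (p' - p) < \<delta> \<longrightarrow>
     norm (q' - q) < \<delta> \<longrightarrow> p' \<in> level \<zeta>' \<longrightarrow> q' \<in> level \<zeta>' \<longrightarrow> qlen \<zeta>' p' q' \<le> ennreal (S + \<epsilon>))"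

lemma joined_nearbyE:
  assumes "joined_nearby \<zeta> p q S" "\<epsilon> > 0"
  obtains \<delta> where "\<delta> > 0" "\<And>\<zeta>' p' q'. norm (\<zeta>' - \<zeta>) < \<delta> \<Longrightarrow> norm (p' - p) < \<delta> \<Longrightarrow>
     norm (q' - q) < \<delta> \<Longrightarrow> p' \<in> level \<zeta>' \<Longrightarrow> q' \<in> level \<zeta>' \<Longrightarrow> qlen \<zeta>' p' q' \<le> ennreal (S + \<epsilon>)"
  using assms(1)[unfolded joined_nearby_def, rule_format, OF assms(2)] by blast

lemma joined_nearby_closure:
  assumes "\<And>e. e > 0 \<Longrightarrow> joined_nearby \<zeta> p q (S + K * e)" "K \<ge> 0"
  shows "joined_nearby \<zeta> p q S"
  unfolding joined_nearby_def
proof (intro allI impI)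
  fix \<epsilon> :: real assume e: "\<epsilon> > 0"
  define e' where "e' = \<epsilon> / 2 / (K + 1)"
  have e': "e' > 0" using e assms(2) by (simp add: e'_def)
  have "K * e' \<le> (K + 1) * e'" using e' by (intro mult_right_mono) auto
  also have "\<dots> = \<epsilon> / 2" using assms(2) unfolding e'_def by (intro nonzero_mult_div_cancel_left [of "K + 1", unfolded times_divide_eq_right [symmetric]]) simp
  finally have le: "S + K * e' + \<epsilon> / 2 \<le> S + \<epsilon>" by simp
  obtain \<delta> where "\<delta> > 0" "\<And>\<zeta>' p' q'. norm (\<zeta>' - \<zeta>) < \<delta> \<Longrightarrow> norm (p' - p) < \<delta> \<Longrightarrow>
     norm (q' - q) < \<delta> \<Longrightarrow> p' \<in> level \<zeta>' \<Longrightarrow> q' \<in> level \<zeta>' \<Longrightarrow> qlen \<zeta>' p' q' \<le> ennreal (S + K * e' + \<epsilon> / 2)"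
    by (rule joined_nearbyE[OF assms(1)[OF e'] half_gt_zero[OF e]]) blast
  then show "\<exists>\<delta>>0. \<forall>\<zeta>' p' q'. norm (\<zeta>' - \<zeta>) < \<delta> \<longrightarrow> norm (p' - p) < \<delta> \<longrightarrow>
     norm (q' - q) < \<delta> \<longrightarrow> p' \<in> level \<zeta>' \<longrightarrow> q' \<in> level \<zeta>' \<longrightarrow> qlen \<zeta>' p' q' \<le> ennreal (S + \<epsilon>)"
    by (intro exI[of _ \<delta>]) (blast intro: order_trans[OF _ ennreal_leI[OF le]])
qed

lemma joined_nearby_mono:
  assumes "joined_nearby \<zeta> p q S" "S \<le> S'"
  shows "joined_nearby \<zeta> p q S'"
proof -
  have le: "ennreal (S + e) \<le> ennreal (S' + e)" for e using assms(2) by (intro ennreal_leI) simp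
  show ?thesis
    unfolding joined_nearby_def
  proof (intro allI impI)
    fix \<epsilon> :: real assume "\<epsilon> > 0"
    then obtain \<delta> where d: "\<delta> > 0" "\<And>\<zeta>' p' q'. norm (\<zeta>' - \<zeta>) < \<delta> \<Longrightarrow> norm (p' - p) < \<delta> \<Longrightarrow>
       norm (q' - q) < \<delta> \<Longrightarrow> p' \<in> level \<zeta>' \<Longrightarrow> q' \<in> level \<zeta>' \<Longrightarrow> qlen \<zeta>' p' q' \<le> ennreal (S + \<epsilon>)"
      using joined_nearbyE[OF assms(1)] by blast
    show "\<exists>\<delta>>0. \<forall>\<zeta>' p' q'. norm (\<zeta>' - \<zeta>) < \<delta> \<longrightarrow> norm (p' - p) < \<delta> \<longrightarrow>
     norm (q' - q) < \<delta> \<longrightarrow> p' \<in> level \<zeta>' \<longrightarrow> q' \<in> level \<zeta>' \<longrightarrow> qlen \<zeta>' p' q' \<le> ennreal (S' + \<epsilon>)"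
      by (intro exI[of _ \<delta>] conjI d(1) allI impI order_trans[OF d(2) le])
  qed
qed

lemma joined_nearby_sym: "joined_nearby \<zeta> p q S \<Longrightarrow> joined_nearby \<zeta> q p S"
  unfolding joined_nearby_def by (metis qlen_sym)

text \<open>The intermediate point q lies in the level set of \<zeta> only; on a neighbouring one
  \<open>level_set_approx\<close> supplies a substitute close to q.\<close>

lemma joined_nearby_trans:
  assumes S: "joined_nearby \<zeta> p q S" "0 \<le> S" and T: "joined_nearby \<zeta> q r T" "0 \<le> T"
    and q: "q \<in> level \<zeta>"
  shows "joined_nearby \<zeta> p r (S + T)"
  unfolding joined_nearby_def
proof (intro allI impI)
  fix \<epsilon> :: real assume e: "\<epsilon> > 0"
  obtain \<delta>1 where d1: "\<delta>1 > 0" "\<And>\<zeta>' p' q'. norm (\<zeta>' - \<zeta>) < \<delta>1 \<Longrightarrow> norm (p' - p) < \<delta>1 \<Longrightarrow>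
     norm (q' - q) < \<delta>1 \<Longrightarrow> p' \<in> level \<zeta>' \<Longrightarrow> q' \<in> level \<zeta>' \<Longrightarrow> qlen \<zeta>' p' q' \<le> ennreal (S + \<epsilon> / 2)"
    by (rule joined_nearbyE[OF S(1) half_gt_zero[OF e]]) blast
  obtain \<delta>2 where d2: "\<delta>2 > 0" "\<And>\<zeta>' p' q'. norm (\<zeta>' - \<zeta>) < \<delta>2 \<Longrightarrow> norm (p' - q) < \<delta>2 \<Longrightarrow>
     norm (q' - r) < \<delta>2 \<Longrightarrow> p' \<in> level \<zeta>' \<Longrightarrow> q' \<in> level \<zeta>' \<Longrightarrow> qlen \<zeta>' p' q' \<le> ennreal (T + \<epsilon> / 2)"
    by (rule joined_nearbyE[OF T(1) half_gt_zero[OF e]]) blast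
  obtain C where C: "C \<ge> 0" "\<And>\<zeta>' q. q \<in> level \<zeta> \<Longrightarrow>
    \<exists>q'\<in>level \<zeta>'. (norm (q' - q))\<^sup>2 \<le> C * norm (\<zeta>' - \<zeta>)"
    using level_set_approx by metis
  define m where "m = min \<delta>1 \<delta>2"
  \<comment> \<open>The denominator C + 1 gives C |\<zeta>' - \<zeta>| < m^2 without a separate case
    C = 0.\<close>
  define \<delta> where "\<delta> = min m (m\<^sup>2 / (C + 1))"
  have m: "m > 0" using d1 d2 by (simp add: m_def)
  show "\<exists>\<delta>>0. \<forall>\<zeta>' p' r'. norm (\<zeta>' - \<zeta>) < \<delta> \<longrightarrow> norm (p' - p) < \<delta> \<longrightarrow>
     norm (r' - r) < \<delta> \<longrightarrow> p' \<in> level \<zeta>' \<longrightarrow> r' \<in> level \<zeta>' \<longrightarrow> qlen \<zeta>' p' r' \<le> ennreal (S + T + \<epsilon>)"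
  proof (intro exI[of _ \<delta>] conjI allI impI)
    show "\<delta> > 0" using m C by (simp add: \<delta>_def)
    fix \<zeta>' p' r' assume *: "norm (\<zeta>' - \<zeta>) < \<delta>" "norm (p' - p) < \<delta>" "norm (r' - r) < \<delta>"
       "p' \<in> level \<zeta>'" "r' \<in> level \<zeta>'"
    obtain q' where q': "q' \<in> level \<zeta>'" "(norm (q' - q))\<^sup>2 \<le> C * norm (\<zeta>' - \<zeta>)" using C(2)[OF q] by blast
    have "C * norm (\<zeta>' - \<zeta>) \<le> (C + 1) * norm (\<zeta>' - \<zeta>)" by (intro mult_right_mono) auto
    also have "\<dots> < (C + 1) * (m\<^sup>2 / (C + 1))" using *(1) C by (intro mult_strict_left_mono) (auto simp: \<delta>_def)
    also have "\<dots> = m\<^sup>2" using C by simp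
    finally have "(norm (q' - q))\<^sup>2 < m\<^sup>2" using q' by simp
    then have "norm (q' - q) < m" by (rule power2_less_imp_less) (use m in simp)
    then have "qlen \<zeta>' p' q' \<le> ennreal (S + \<epsilon> / 2)" "qlen \<zeta>' q' r' \<le> ennreal (T + \<epsilon> / 2)"
      using * q' by (auto intro!: d1(2) d2(2) simp: \<delta>_def m_def)
    then have "qlen \<zeta>' p' r' \<le> ennreal (S + \<epsilon> / 2) + ennreal (T + \<epsilon> / 2)"
      by (meson add_mono order_trans qlen_triangle)
    also have "\<dots> = ennreal (S + T + \<epsilon>)" using e S T by (subst ennreal_plus [symmetric]) auto
    finally show "qlen \<zeta>' p' r' \<le> ennreal (S + T + \<epsilon>)" .
  qed
qed

text \<open>Coordinates that do not vanish at p stay away from 0 nearby, so small displacements are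
  small relative to them and cost a factor close to 1. Only the vanishing ones fall under the crude
  bound.\<close>

lemma joined_nearby_local:
  assumes e: "\<epsilon> > 0"
  obtains \<delta> where "\<delta> > 0" "\<And>q. norm (q - p) < \<delta> \<Longrightarrow>
    joined_nearby \<zeta> p q ((1 + \<epsilon>) * norm (q - p) + 6 * (\<Sum>k | coord k p = 0. norm (coord k q)))"
proof -
  define Z where "Z = {k. coord k p = 0}"
  define \<kappa> where "\<kappa> = min (1/16) (\<epsilon> / 16)"
  have \<kappa>: "0 < \<kappa>" "\<kappa> \<le> 1/16" "16 * \<kappa> \<le> \<epsilon>" using e by (auto simp: \<kappa>_def)
  \<comment> \<open>The smallest norm of a nonzero coordinate of p, capped at 1 so that the minimum
    exists even for p = 0.\<close>
  define m where "m = Min (insert 1 ((\<lambda>k. norm (coord k p)) ` (- Z)))"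
  have "m \<in> insert 1 ((\<lambda>k. norm (coord k p)) ` (- Z))" unfolding m_def by (rule Min_in) auto
  then have m: "m > 0" by (auto simp: Z_def)
  have mle: "m \<le> norm (coord k p)" if "k \<notin> Z" for k unfolding m_def using that by (intro Min_le) auto
  \<comment> \<open>Coordinates of p' and q' differ by at most 3 \<delta>, while those of p' outside
    Z keep norm at least m / 2; \<open>qlen_le_near_far\<close> asks for 3 \<delta> \<le> \<kappa> m
    / 2.\<close>
  define \<delta> where "\<delta> = \<kappa> * m / 8"
  have \<delta>: "\<delta> > 0" using \<kappa> m by (simp add: \<delta>_def)
  have dm: "8 * \<delta> \<le> \<kappa> * m" "2 * \<delta> \<le> m"
    using \<kappa> m mult_right_mono[of \<kappa> 1 m] by (auto simp: \<delta>_def)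
  show thesis
  proof (rule that[OF \<delta>])
    fix q assume q: "norm (q - p) < \<delta>"
    define A where "A = (1 + \<epsilon>) * norm (q - p) + 6 * (\<Sum>k\<in>Z. norm (coord k q))"
    have "joined_nearby \<zeta> p q A"
      unfolding joined_nearby_def
    proof (intro allI impI)
      fix e' :: real assume e': "e' > 0"
      \<comment> \<open>The coefficient of d in the total error: p' and q' each move by less than d,
        which enters the chord and, with weight 6, every coordinate in Z.\<close>
      define B where "B = 2 * (1 + \<epsilon>) + 12 * real (card Z)"
      have B: "B > 0" using e by (simp add: B_def add_pos_nonneg)
      define d where "d = min \<delta> (e' / B)"
      show "\<exists>\<delta>>0. \<forall>\<zeta>' p' q'. norm (\<zeta>' - \<zeta>) < \<delta> \<longrightarrow> norm (p' - p) < \<delta> \<longrightarrow>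
         norm (q' - q) < \<delta> \<longrightarrow> p' \<in> level \<zeta>' \<longrightarrow> q' \<in> level \<zeta>' \<longrightarrow> qlen \<zeta>' p' q' \<le> ennreal (A + e')"
      proof (intro exI[of _ d] conjI allI impI)
        show "d > 0" using \<delta> e' B by (simp add: d_def)
        fix \<zeta>' p' q' assume *: "norm (\<zeta>' - \<zeta>) < d" "norm (p' - p) < d" "norm (q' - q) < d"
          "p' \<in> level \<zeta>'" "q' \<in> level \<zeta>'"
        have dd: "d \<le> \<delta>" "d * B \<le> e'" using B by (auto simp: d_def min_def field_simps)
        have nk: "norm (coord k x - coord k y) \<le> norm (x - y)" for k and x y :: "'d quat"
          using norm_coord_le[of k "x - y"] by simp
        have q'p': "norm (q' - p') \<le> norm (q' - q) + norm (q - p) + norm (p' - p)"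
          using norm_triangle_ineq4[of "(q' - q) + (q - p)" "p' - p"] norm_triangle_ineq[of "q' - q" "q - p"] by simp
        have near: "coord k p' \<noteq> 0 \<and> norm (coord k q' - coord k p') \<le> \<kappa> * norm (coord k p')" if k: "k \<notin> Z" for k
        proof -
          have "norm (coord k p) \<le> norm (coord k p') + norm (coord k p' - coord k p)"
            using norm_triangle_ineq4[of "coord k p'" "coord k p' - coord k p"] by simp
          then have "m - \<delta> \<le> norm (coord k p')"
            using mle[OF k] nk[of k p' p] *(2) dd by linarith
          then have m2: "m / 2 \<le> norm (coord k p')" using dm by linarith
          have "norm (coord k q' - coord k p') \<le> 3 * \<delta>"
            using nk[of k q' p'] q'p' * q dd by linarith
          also have "\<dots> \<le> \<kappa> * (m / 2)" using dm(1) \<delta> by simp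
          also have "\<dots> \<le> \<kappa> * norm (coord k p')" using m2 \<kappa> by (intro mult_left_mono) auto
          finally show ?thesis using m2 m by auto
        qed
        have "qlen \<zeta>' p' q' \<le> ennreal ((1 + 16 * \<kappa>) * norm (q' - p') + 6 * (\<Sum>k\<in>Z. norm (coord k p') + norm (coord k q')))"
          by (rule qlen_le_near_far[OF *(4,5) \<kappa>(1,2) near])
        also have "\<dots> \<le> ennreal (A + e')"
        proof (rule ennreal_leI)
          have "norm (coord k p') + norm (coord k q') \<le> norm (coord k q) + 2 * d" if "k \<in> Z" for k
          proof -
            have "norm (coord k p') \<le> d" using nk[of k p' p] that * by (simp add: Z_def)
            moreover have "norm (coord k q') \<le> norm (coord k q) + d"
              using nk[of k q' q] * norm_triangle_ineq[of "coord k q" "coord k q' - coord k q"] by simp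
            ultimately show ?thesis by simp
          qed
          then have "(\<Sum>k\<in>Z. norm (coord k p') + norm (coord k q')) \<le> (\<Sum>k\<in>Z. norm (coord k q) + 2 * d)"
            by (rule sum_mono)
          then have 1: "(\<Sum>k\<in>Z. norm (coord k p') + norm (coord k q')) \<le> (\<Sum>k\<in>Z. norm (coord k q)) + 2 * d * real (card Z)"
            by (simp add: sum.distrib mult.commute)
          have "(1 + 16 * \<kappa>) * norm (q' - p') \<le> (1 + \<epsilon>) * (norm (q - p) + 2 * d)"
            using q'p' * \<kappa> e by (intro mult_mono) auto
          then have "(1 + 16 * \<kappa>) * norm (q' - p') + 6 * (\<Sum>k\<in>Z. norm (coord k p') + norm (coord k q'))
             \<le> A + d * B"
            using 1 by (simp add: A_def B_def algebra_simps)
          then show "(1 + 16 * \<kappa>) * norm (q' - p') + 6 * (\<Sum>k\<in>Z. norm (coord k p') + norm (coord k q')) \<le> A + e'"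
            using dd by linarith
        qed
        finally show "qlen \<zeta>' p' q' \<le> ennreal (A + e')" .
      qed
    qed
    then show "joined_nearby \<zeta> p q ((1 + \<epsilon>) * norm (q - p) + 6 * (\<Sum>k | coord k p = 0. norm (coord k q)))"
      by (simp add: A_def Z_def)
  qed
qed

text \<open>The coordinates that vanish at a given time \<open>t\<close> contribute only through the time which they
  spend away from zero near \<open>t\<close>; up to a set of small measure, there is none.\<close>

lemma joined_nearby_lipschitz:
  fixes \<gamma> :: "real \<Rightarrow> 'd quat"
  assumes lip: "L-lipschitz_on {0..1} \<gamma>" and lev: "\<And>t. t \<in> {0..1} \<Longrightarrow> \<gamma> t \<in> level \<zeta>"
  shows "joined_nearby \<zeta> (\<gamma> 0) (\<gamma> 1) L"
proof (rule joined_nearby_closure)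
  have L: "L \<ge> 0" using lip by (rule lipschitz_on_nonneg)
  then show "0 \<le> L + 6 * L * real CARD('d)" by simp
  fix e :: real assume e: "e > 0"
  have lk: "L-lipschitz_on {0..1} (\<lambda>t. coord k (\<gamma> t))" for k
  proof (rule lipschitz_onI[OF _ L])
    fix x y :: real assume "x \<in> {0..1}" "y \<in> {0..1}"
    then have "dist (\<gamma> x) (\<gamma> y) \<le> L * dist x y" by (rule lipschitz_onD[OF lip])
    moreover have "dist (coord k (\<gamma> x)) (coord k (\<gamma> y)) \<le> dist (\<gamma> x) (\<gamma> y)"
      using norm_coord_le[of k "\<gamma> x - \<gamma> y"] by (simp add: dist_norm)
    ultimately show "dist (coord k (\<gamma> x)) (coord k (\<gamma> y)) \<le> L * dist x y" by simp
  qed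
  define T where "T k = {t \<in> {0..1}. coord k (\<gamma> t) = 0}" for k
  \<comment> \<open>Outer regularity: the closed zero set of a coordinate, however irregular, has a
    neighbourhood that exceeds it by a small measure only.\<close>
  have "\<exists>U. open U \<and> T k \<subseteq> U \<and> U - T k \<in> lmeasurable \<and> measure lebesgue (U - T k) \<le> e" for k
  proof -
    have "closed (T k)" unfolding T_def
      by (rule continuous_closed_preimage_constant[OF lipschitz_on_continuous_on[OF lk]]) simp
    then have "T k \<in> sets lebesgue" by simp
    then obtain U where U: "open U" "T k \<subseteq> U" "U - T k \<in> lmeasurable" "emeasure lebesgue (U - T k) < ennreal e"
      using sets_lebesgue_outer_open e by metis
    then have "measure lebesgue (U - T k) \<le> e"
      using e by (simp add: emeasure_eq_measure2 ennreal_less_iff)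
    then show ?thesis using U by blast
  qed
  then obtain U where U: "\<And>k. open (U k)" "\<And>k. T k \<subseteq> U k" "\<And>k. U k - T k \<in> lmeasurable"
      "\<And>k. measure lebesgue (U k - T k) \<le> e" by metis
  define W where "W k = U k - T k" for k
  define g where "g k s = time_in (W k) s" for k s
  \<comment> \<open>The accumulated cost: length with the factor 1 + e, plus 6 L per unit of time
    spent in each W k. Its increments telescope.\<close>
  define G where "G s = (1 + e) * L * s + 6 * L * (\<Sum>k\<in>UNIV. g k s)" for s
  have W: "W k \<in> lmeasurable" for k using U by (simp add: W_def)
  have gmono: "g k a \<le> g k b" if "a \<le> b" for k a b
    unfolding g_def using W that by (rule time_in_mono)
  have Gmono: "G a \<le> G b" if "a \<le> b" for a b
    unfolding G_def using that L e gmono by (intro add_mono mult_left_mono sum_mono) auto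
  define P where "P a b \<longleftrightarrow> (0 \<le> a \<and> a \<le> b \<and> b \<le> 1 \<longrightarrow> joined_nearby \<zeta> (\<gamma> a) (\<gamma> b) (G b - G a))" for a b
  have "P 0 1"
  proof (rule Bolzano)
    fix a b c assume ab: "P a b" "P b c" "a \<le> b" "b \<le> c"
    show "P a c" unfolding P_def
    proof
      assume ac: "0 \<le> a \<and> a \<le> c \<and> c \<le> 1"
      have "joined_nearby \<zeta> (\<gamma> a) (\<gamma> c) ((G b - G a) + (G c - G b))"
        by (rule joined_nearby_trans[where q = "\<gamma> b"]) (use ab ac lev Gmono in \<open>auto simp: P_def\<close>)
      then show "joined_nearby \<zeta> (\<gamma> a) (\<gamma> c) (G c - G a)" by simp
    qed
  next
    fix t :: real assume t: "0 \<le> t" "t \<le> 1"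
    obtain \<delta> where \<delta>: "\<delta> > 0" "\<And>q. norm (q - \<gamma> t) < \<delta> \<Longrightarrow>
      joined_nearby \<zeta> (\<gamma> t) q ((1 + e) * norm (q - \<gamma> t) + 6 * (\<Sum>k | coord k (\<gamma> t) = 0. norm (coord k q)))"
      using joined_nearby_local[OF e, of "\<gamma> t" \<zeta>] by blast
    \<comment> \<open>On this neighbourhood of t, a coordinate that vanishes at t can be nonzero
      only at times in W k, which is the hypothesis of \<open>lipschitz_gap\<close>.\<close>
    define V where "V = (\<Inter>k\<in>{k. coord k (\<gamma> t) = 0}. U k)"
    have "open V" unfolding V_def by (intro open_INT) (use U in auto)
    moreover have "t \<in> V" using t U(2) by (auto simp: V_def T_def)
    ultimately obtain d0 where d0: "d0 > 0" "ball t d0 \<subseteq> V" using open_contains_ball by blast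
    define d where "d = min d0 (\<delta> / (L + 1))"
    have d: "d > 0" using d0 \<delta> L by (simp add: d_def)
    have Ld: "L * s < \<delta>" if "0 \<le> s" "s < d" for s
    proof -
      have "L * s \<le> (L + 1) * s" using that by (intro mult_right_mono) auto
      also have "\<dots> < (L + 1) * (\<delta> / (L + 1))" using that L by (intro mult_strict_left_mono) (auto simp: d_def)
      finally show ?thesis using L by simp
    qed
    have "P a b" if ab: "a \<le> t" "t \<le> b" "b - a < d" for a b
      unfolding P_def
    proof
      assume a0: "0 \<le> a \<and> a \<le> b \<and> b \<le> 1"
      let ?Z = "{k. coord k (\<gamma> t) = 0}"
      have nb: "norm (\<gamma> b - \<gamma> t) \<le> L * (b - t)" and na: "norm (\<gamma> a - \<gamma> t) \<le> L * (t - a)"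
        using lipschitz_onD[OF lip, of b t] lipschitz_onD[OF lip, of a t] t ab a0
        by (auto simp: dist_norm)
      have "norm (\<gamma> b - \<gamma> t) < \<delta>" "norm (\<gamma> a - \<gamma> t) < \<delta>"
        using nb na Ld[of "b - t"] Ld[of "t - a"] ab by auto
      then have jb: "joined_nearby \<zeta> (\<gamma> t) (\<gamma> b) ((1 + e) * norm (\<gamma> b - \<gamma> t) + 6 * (\<Sum>k\<in>?Z. norm (coord k (\<gamma> b))))"
        and ja: "joined_nearby \<zeta> (\<gamma> a) (\<gamma> t) ((1 + e) * norm (\<gamma> a - \<gamma> t) + 6 * (\<Sum>k\<in>?Z. norm (coord k (\<gamma> a))))"
        by (auto intro: \<delta>(2) joined_nearby_sym)
      have gap: "norm (coord k (\<gamma> b)) \<le> L * (g k b - g k t)" "norm (coord k (\<gamma> a)) \<le> L * (g k t - g k a)" if k: "k \<in> ?Z" for k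
      proof -
        have sub: "s \<in> W k" if "s \<in> {0..1}" "a \<le> s" "s \<le> b" "coord k (\<gamma> s) \<noteq> 0" for s
        proof -
          have "s \<in> ball t d0" using that ab by (auto simp: d_def dist_real_def)
          then show ?thesis using d0 k that by (auto simp: V_def W_def T_def)
        qed
        show "norm (coord k (\<gamma> b)) \<le> L * (g k b - g k t)" "norm (coord k (\<gamma> a)) \<le> L * (g k t - g k a)"
          unfolding g_def using lipschitz_gap[OF lk W, of k t a b k] sub k ab a0 by auto
      qed
      have "joined_nearby \<zeta> (\<gamma> a) (\<gamma> b) (((1 + e) * norm (\<gamma> a - \<gamma> t) + 6 * (\<Sum>k\<in>?Z. norm (coord k (\<gamma> a)))) +
          ((1 + e) * norm (\<gamma> b - \<gamma> t) + 6 * (\<Sum>k\<in>?Z. norm (coord k (\<gamma> b)))))"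
        by (rule joined_nearby_trans[OF ja _ jb]) (use e t lev in \<open>auto intro!: add_nonneg_nonneg sum_nonneg\<close>)
      moreover have "(1 + e) * norm (\<gamma> a - \<gamma> t) \<le> (1 + e) * (L * (t - a))" "(1 + e) * norm (\<gamma> b - \<gamma> t) \<le> (1 + e) * (L * (b - t))"
        using na nb e by (auto intro!: mult_left_mono)
      moreover have "(\<Sum>k\<in>?Z. norm (coord k (\<gamma> a))) \<le> L * (\<Sum>k\<in>UNIV. g k t - g k a)"
      proof -
        have "(\<Sum>k\<in>?Z. norm (coord k (\<gamma> a))) \<le> (\<Sum>k\<in>?Z. L * (g k t - g k a))" by (rule sum_mono) (rule gap)
        also have "\<dots> \<le> (\<Sum>k\<in>UNIV. L * (g k t - g k a))"
          by (rule sum_mono2) (use L gmono ab in auto)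
        finally show ?thesis by (simp add: sum_distrib_left)
      qed
      moreover have "(\<Sum>k\<in>?Z. norm (coord k (\<gamma> b))) \<le> L * (\<Sum>k\<in>UNIV. g k b - g k t)"
      proof -
        have "(\<Sum>k\<in>?Z. norm (coord k (\<gamma> b))) \<le> (\<Sum>k\<in>?Z. L * (g k b - g k t))" by (rule sum_mono) (rule gap)
        also have "\<dots> \<le> (\<Sum>k\<in>UNIV. L * (g k b - g k t))"
          by (rule sum_mono2) (use L gmono ab in auto)
        finally show ?thesis by (simp add: sum_distrib_left)
      qed
      moreover have "G b - G a = (1 + e) * (L * (t - a)) + 6 * (L * (\<Sum>k\<in>UNIV. g k t - g k a)) +
         ((1 + e) * (L * (b - t)) + 6 * (L * (\<Sum>k\<in>UNIV. g k b - g k t)))"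
        by (simp add: G_def sum_subtractf algebra_simps)
      ultimately show "joined_nearby \<zeta> (\<gamma> a) (\<gamma> b) (G b - G a)"
        by (elim joined_nearby_mono) linarith
    qed
    then show "\<exists>d>0. \<forall>a b. a \<le> t \<and> t \<le> b \<and> b - a < d \<longrightarrow> P a b" using d by blast
  qed simp
  then have j: "joined_nearby \<zeta> (\<gamma> 0) (\<gamma> 1) (G 1 - G 0)" by (simp add: P_def)
  \<comment> \<open>Each W k has measure at most e, so the total cost exceeds L by a fixed multiple
    of e only.\<close>
  have "G 1 - G 0 \<le> (1 + e) * L + 6 * L * (\<Sum>k\<in>(UNIV::'d set). e)"
  proof -
    have "g k 1 \<le> e" for k
    proof -
      have "g k 1 \<le> measure lebesgue (W k)"
        unfolding g_def time_in_def using W[of k] by (intro measure_mono_fmeasurable) (auto dest: fmeasurableD)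
      then show ?thesis using U(4)[of k] by (simp add: W_def)
    qed
    then have "6 * L * (\<Sum>k\<in>UNIV. g k 1) \<le> 6 * L * (\<Sum>k\<in>(UNIV::'d set). e)"
      using L by (intro mult_left_mono sum_mono) auto
    moreover have "6 * L * (\<Sum>k\<in>UNIV. g k 0) \<ge> 0" using L by (auto simp: g_def time_in_def intro!: mult_nonneg_nonneg sum_nonneg)
    ultimately show ?thesis by (simp add: G_def)
  qed
  then have "G 1 - G 0 \<le> L + (L + 6 * L * real CARD('d)) * e" by (simp add: algebra_simps)
  then show "joined_nearby \<zeta> (\<gamma> 0) (\<gamma> 1) (L + (L + 6 * L * real CARD('d)) * e)"
    using j joined_nearby_mono by blast
qed

end

section \<open>Continuity of the quotient distance and the tangent cone\<close>

context torus_reduction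
begin

definition qdist :: "('l \<Rightarrow>\<^sub>L (real ^ 3)) \<Rightarrow> 'd quat \<Rightarrow> 'd quat \<Rightarrow> real" where
  "qdist \<zeta> p q = quotient_dist \<iota> N \<zeta> (orbit N p) (orbit N q)"

lemma qdist_eq: "qdist \<zeta> p q = enn2real (qlen \<zeta> p q)"
  by (simp add: qdist_def quotient_dist_eq)

lemma qdist_nonneg: "0 \<le> qdist \<zeta> p q"
  by (simp add: qdist_eq)

lemma qlen_eq_qdist:
  "p \<in> level \<zeta> \<Longrightarrow> q \<in> level \<zeta> \<Longrightarrow> qlen \<zeta> p q = ennreal (qdist \<zeta> p q)"
  using qlen_finite[of p \<zeta> q] by (simp add: qdist_eq)

lemma qdist_le_iff:
  assumes "p \<in> level \<zeta>" "q \<in> level \<zeta>" "0 \<le> S"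
  shows "qlen \<zeta> p q \<le> ennreal S \<longleftrightarrow> qdist \<zeta> p q \<le> S"
  using assms by (simp add: qlen_eq_qdist)

lemma qdist_less_imp:
  assumes "p \<in> level \<zeta>" "q \<in> level \<zeta>" "qdist \<zeta> p q < S"
  shows "qlen \<zeta> p q < ennreal S"
  using assms qdist_nonneg[of \<zeta> p q] by (simp add: qlen_eq_qdist ennreal_less_iff)

lemma joined_nearby_torus_act:
  assumes j: "joined_nearby \<zeta> p (torus_act \<tau> q) S" and \<tau>: "\<tau> \<in> N"
  shows "joined_nearby \<zeta> p q S"
  unfolding joined_nearby_def
proof (intro allI impI)
  fix \<epsilon> :: real assume e: "\<epsilon> > 0"
  obtain \<delta> where d: "\<delta> > 0" "\<And>\<zeta>' p' q'. norm (\<zeta>' - \<zeta>) < \<delta> \<Longrightarrow> norm (p' - p) < \<delta> \<Longrightarrow>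
     norm (q' - torus_act \<tau> q) < \<delta> \<Longrightarrow> p' \<in> level \<zeta>' \<Longrightarrow> q' \<in> level \<zeta>' \<Longrightarrow> qlen \<zeta>' p' q' \<le> ennreal (S + \<epsilon>)"
    by (rule joined_nearbyE[OF j e]) blast
  show "\<exists>\<delta>>0. \<forall>\<zeta>' p' q'. norm (\<zeta>' - \<zeta>) < \<delta> \<longrightarrow> norm (p' - p) < \<delta> \<longrightarrow>
     norm (q' - q) < \<delta> \<longrightarrow> p' \<in> level \<zeta>' \<longrightarrow> q' \<in> level \<zeta>' \<longrightarrow> qlen \<zeta>' p' q' \<le> ennreal (S + \<epsilon>)"
  proof (intro exI[of _ \<delta>] conjI d(1) allI impI)
    fix \<zeta>' p' q' assume *: "norm (\<zeta>' - \<zeta>) < \<delta>" "norm (p' - p) < \<delta>" "norm (q' - q) < \<delta>"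
      "p' \<in> level \<zeta>'" "q' \<in> level \<zeta>'"
    have "qlen \<zeta>' p' (torus_act \<tau> q') \<le> ennreal (S + \<epsilon>)"
      using * level_set_torus_act[OF N_torus[OF \<tau>], of q' \<iota> \<zeta>']
      by (intro d(2)) (simp_all add: norm_torus_act_diff[OF N_torus[OF \<tau>]])
    then show "qlen \<zeta>' p' q' \<le> ennreal (S + \<epsilon>)"
      using qlen_orbit_cong[OF refl orbit_torus_act[OF \<tau>], of \<zeta>' p' q'] by simp
  qed
qed

text \<open>Joins the two halves: distances bounded along a convergent sequence yield a Lipschitz
  curve in the limit, which bounds the distances at all nearby points. Constant sequences give
  upper, arbitrary ones lower semicontinuity.\<close>

lemma joined_nearby_limit:
  assumes "\<And>i. p i \<in> level (\<zeta> i)"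
    and "\<zeta> \<longlonglongrightarrow> \<zeta>0" "p \<longlonglongrightarrow> p0" "q \<longlonglongrightarrow> q0" and "\<And>i. qlen (\<zeta> i) (p i) (q i) < ennreal S"
  shows "joined_nearby \<zeta>0 p0 q0 S"
proof -
  obtain \<gamma> :: "real \<Rightarrow> 'd quat" and \<tau> where g: "\<tau> \<in> N" "\<gamma> 0 = p0" "\<gamma> 1 = torus_act \<tau> q0" "S-lipschitz_on {0..1} \<gamma>"
    "\<And>t. t \<in> {0..1} \<Longrightarrow> \<gamma> t \<in> level \<zeta>0"
    by (rule limit_curve[OF assms]) blast
  have "joined_nearby \<zeta>0 (\<gamma> 0) (\<gamma> 1) S" by (rule joined_nearby_lipschitz[OF g(4,5)])
  then show ?thesis using joined_nearby_torus_act g by simp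
qed

lemma joined_nearby_le:
  assumes j: "joined_nearby \<zeta> p q S" and pq: "p \<in> level \<zeta>" "q \<in> level \<zeta>" and S: "S \<ge> 0"
  shows "qdist \<zeta> p q \<le> S"
proof (rule field_le_epsilon)
  fix e :: real assume e: "e > 0"
  obtain \<delta> where "\<delta> > 0" "\<And>\<zeta>' p' q'. norm (\<zeta>' - \<zeta>) < \<delta> \<Longrightarrow> norm (p' - p) < \<delta> \<Longrightarrow>
     norm (q' - q) < \<delta> \<Longrightarrow> p' \<in> level \<zeta>' \<Longrightarrow> q' \<in> level \<zeta>' \<Longrightarrow> qlen \<zeta>' p' q' \<le> ennreal (S + e)"
    by (rule joined_nearbyE[OF j e]) blast
  from this(2)[of \<zeta> p q] this(1) have "qlen \<zeta> p q \<le> ennreal (S + e)" using pq by simp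
  then show "qdist \<zeta> p q \<le> S + e"
    using qdist_le_iff[OF pq, of "S + e"] S e by (simp only: add_nonneg_nonneg less_imp_le)
qed

theorem qdist_continuous:
  assumes p: "\<And>i. p i \<in> level (\<zeta> i)" and q: "\<And>i. q i \<in> level (\<zeta> i)"
    and lim: "\<zeta> \<longlonglongrightarrow> \<zeta>0" "p \<longlonglongrightarrow> p0" "q \<longlonglongrightarrow> q0"
  shows "(\<lambda>i. qdist (\<zeta> i) (p i) (q i)) \<longlonglongrightarrow> qdist \<zeta>0 p0 q0"
proof -
  have p0: "p0 \<in> level \<zeta>0" and q0: "q0 \<in> level \<zeta>0"
    using closed_level_set_limit[OF p lim(2,1)] closed_level_set_limit[OF q lim(3,1)] by auto
  show ?thesis
  proof (rule order_tendstoI)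
    fix a assume "qdist \<zeta>0 p0 q0 < a"
    then obtain S where S: "qdist \<zeta>0 p0 q0 < S" "S < a" using dense by blast
    have S0: "S \<ge> 0" using S(1) qdist_nonneg[of \<zeta>0 p0 q0] by simp
    have "joined_nearby \<zeta>0 p0 q0 S"
      by (rule joined_nearby_limit[of "\<lambda>_. p0" "\<lambda>_. \<zeta>0" _ _ "\<lambda>_. q0"])
         (use p0 qdist_less_imp[OF p0 q0 S(1)] in auto)
    then obtain \<delta> where d: "\<delta> > 0" "\<And>\<zeta>' p' q'. norm (\<zeta>' - \<zeta>0) < \<delta> \<Longrightarrow> norm (p' - p0) < \<delta> \<Longrightarrow>
      norm (q' - q0) < \<delta> \<Longrightarrow> p' \<in> level \<zeta>' \<Longrightarrow> q' \<in> level \<zeta>' \<Longrightarrow> qlen \<zeta>' p' q' \<le> ennreal (S + (a - S) / 2)"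
      by (rule joined_nearbyE[of _ _ _ _ "(a - S) / 2"]) (use S(2) in auto)
    have "eventually (\<lambda>i. norm (\<zeta> i - \<zeta>0) < \<delta>) sequentially" "eventually (\<lambda>i. norm (p i - p0) < \<delta>) sequentially"
      "eventually (\<lambda>i. norm (q i - q0) < \<delta>) sequentially"
      using lim d(1) by (auto simp: tendsto_iff dist_norm)
    then show "eventually (\<lambda>i. qdist (\<zeta> i) (p i) (q i) < a) sequentially"
    proof eventually_elim
      case (elim i)
      have "qlen (\<zeta> i) (p i) (q i) \<le> ennreal (S + (a - S) / 2)" using elim p q by (intro d(2))
      then have "qdist (\<zeta> i) (p i) (q i) \<le> S + (a - S) / 2"
        using p q S0 S(2) by (subst (asm) qdist_le_iff) auto
      also have "\<dots> < a" using S(2) by (simp add: field_simps)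
      finally show ?case .
    qed
  next
    fix a assume a: "a < qdist \<zeta>0 p0 q0"
    show "eventually (\<lambda>i. a < qdist (\<zeta> i) (p i) (q i)) sequentially"
    proof (rule ccontr)
      assume "\<not> ?thesis"
      then have "infinite {i. \<not> a < qdist (\<zeta> i) (p i) (q i)}"
        unfolding eventually_sequentially infinite_nat_iff_unbounded_le by blast
      then obtain r where r: "strict_mono (r :: nat \<Rightarrow> nat)" "\<And>n. \<not> a < qdist (\<zeta> (r n)) (p (r n)) (q (r n))"
        using infinite_enumerate[of "{i. \<not> a < qdist (\<zeta> i) (p i) (q i)}"] by auto
      \<comment> \<open>\<open>joined_nearby_limit\<close> needs a strict bound along the
        subsequence, so S is put strictly between.\<close>
      obtain S where S: "a < S" "S < qdist \<zeta>0 p0 q0" using dense[OF a] by blast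
      have less: "qlen (\<zeta> (r n)) (p (r n)) (q (r n)) < ennreal S" for n
        using r(2)[of n] S(1) by (intro qdist_less_imp p q) auto
      have "joined_nearby \<zeta>0 p0 q0 S"
        by (rule joined_nearby_limit[of "\<lambda>n. p (r n)" "\<lambda>n. \<zeta> (r n)" _ _ "\<lambda>n. q (r n)"])
           (use p less LIMSEQ_subseq_LIMSEQ[OF _ r(1)] lim in \<open>auto simp: o_def\<close>)
      moreover have "S \<ge> 0" using r(2)[of 0] S(1) qdist_nonneg[of "\<zeta> (r 0)" "p (r 0)" "q (r 0)"] by linarith
      ultimately have "qdist \<zeta>0 p0 q0 \<le> S" by (intro joined_nearby_le p0 q0)
      then show False using S by simp
    qed
  qed
qed

text \<open>Continuity becomes uniform by compactness of balls; p' and q' inherit a bound from p and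
  q. The pairs compared lie on different level sets, as in an approximation of the cone by a nearby
  quotient.\<close>

lemma qdist_uniformly_continuous:
  assumes e: "e > 0"
  obtains \<delta> where "\<delta> > 0" "\<And>\<zeta>' p q p' q'. norm (\<zeta>' - \<zeta>) < \<delta> \<Longrightarrow> p \<in> level \<zeta>' \<Longrightarrow> q \<in> level \<zeta>' \<Longrightarrow>
    p' \<in> level \<zeta> \<Longrightarrow> q' \<in> level \<zeta> \<Longrightarrow> norm p \<le> R \<Longrightarrow> norm q \<le> R \<Longrightarrow>
    norm (p' - p) < \<delta> \<Longrightarrow> norm (q' - q) < \<delta> \<Longrightarrow> \<bar>qdist \<zeta> p' q' - qdist \<zeta>' p q\<bar> < e"
proof (rule ccontr)
  assume neg: "\<not> thesis"
  define bad where "bad \<delta> \<zeta>' p q p' q' \<longleftrightarrow> norm (\<zeta>' - \<zeta>) < \<delta> \<and> p \<in> level \<zeta>' \<and> q \<in> level \<zeta>' \<and>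
    p' \<in> level \<zeta> \<and> q' \<in> level \<zeta> \<and> norm p \<le> R \<and> norm q \<le> R \<and>
    norm (p' - p) < \<delta> \<and> norm (q' - q) < \<delta> \<and> \<not> \<bar>qdist \<zeta> p' q' - qdist \<zeta>' p q\<bar> < e" for \<delta> \<zeta>' p q p' q'
  have "\<exists>\<zeta>' p q p' q'. bad (inverse (real (Suc i))) \<zeta>' p q p' q'" for i
  proof (rule ccontr)
    assume "\<not> ?thesis"
    then show False
      using neg that[of "inverse (real (Suc i))"] unfolding bad_def by auto
  qed
  then obtain z p q p' q' where b: "\<And>i. bad (inverse (real (Suc i))) (z i) (p i) (q i) (p' i) (q' i)" by metis
  have "compact (cball (0 :: 'd quat) R \<times> cball (0 :: 'd quat) R)" by (intro compact_Times compact_cball)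
  then have "seq_compact (cball (0 :: 'd quat) R \<times> cball (0 :: 'd quat) R)" by (rule compact_imp_seq_compact)
  moreover have "\<forall>i. (p i, q i) \<in> cball 0 R \<times> cball 0 R" using b by (auto simp: bad_def)
  ultimately obtain l r where r: "strict_mono (r :: nat \<Rightarrow> nat)" "((\<lambda>i. (p i, q i)) \<circ> r) \<longlonglongrightarrow> l"
    by (rule seq_compactE)
  define p0 q0 where "p0 = fst l" and "q0 = snd l"
  have inv: "(\<lambda>i. inverse (real (Suc (r i)))) \<longlonglongrightarrow> 0"
    using LIMSEQ_subseq_LIMSEQ[OF LIMSEQ_inverse_real_of_nat r(1)] by (simp add: o_def)
  have pr: "(\<lambda>i. p (r i)) \<longlonglongrightarrow> p0" and qr: "(\<lambda>i. q (r i)) \<longlonglongrightarrow> q0"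
    using tendsto_fst[OF r(2)] tendsto_snd[OF r(2)] by (simp_all add: o_def p0_def q0_def)
  have small: "X \<longlonglongrightarrow> 0" if "\<And>i. norm (X i) < inverse (real (Suc (r i)))" for X :: "nat \<Rightarrow> 'x::real_normed_vector"
    by (rule Lim_null_comparison[OF _ inv]) (use that in \<open>auto intro!: always_eventually less_imp_le\<close>)
  have zr: "(\<lambda>i. z (r i)) \<longlonglongrightarrow> \<zeta>"
    using small[of "\<lambda>i. z (r i) - \<zeta>"] b by (subst Lim_null) (auto simp: bad_def)
  have "(\<lambda>i. p' (r i) - p (r i)) \<longlonglongrightarrow> 0" "(\<lambda>i. q' (r i) - q (r i)) \<longlonglongrightarrow> 0"
    using b by (auto intro!: small simp: bad_def)
  from tendsto_add[OF this(1) pr] tendsto_add[OF this(2) qr]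
  have pr': "(\<lambda>i. p' (r i)) \<longlonglongrightarrow> p0" and qr': "(\<lambda>i. q' (r i)) \<longlonglongrightarrow> q0" by simp_all
  have "(\<lambda>i. qdist (z (r i)) (p (r i)) (q (r i))) \<longlonglongrightarrow> qdist \<zeta> p0 q0"
    by (rule qdist_continuous[OF _ _ zr pr qr]) (use b in \<open>auto simp: bad_def\<close>)
  moreover have "(\<lambda>i. qdist \<zeta> (p' (r i)) (q' (r i))) \<longlonglongrightarrow> qdist \<zeta> p0 q0"
    by (rule qdist_continuous[OF _ _ tendsto_const pr' qr']) (use b in \<open>auto simp: bad_def\<close>)
  ultimately have "(\<lambda>i. qdist \<zeta> (p' (r i)) (q' (r i)) - qdist (z (r i)) (p (r i)) (q (r i))) \<longlonglongrightarrow> 0"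
    using tendsto_diff by fastforce
  then have "eventually (\<lambda>i. \<bar>qdist \<zeta> (p' (r i)) (q' (r i)) - qdist (z (r i)) (p (r i)) (q (r i))\<bar> < e) sequentially"
    using e by (simp add: tendsto_iff dist_real_def)
  then obtain i where "\<bar>qdist \<zeta> (p' (r i)) (q' (r i)) - qdist (z (r i)) (p (r i)) (q (r i))\<bar> < e"
    by (auto simp: eventually_sequentially)
  then show False using b[of "r i"] by (auto simp: bad_def)
qed

section \<open>Metric axioms of the quotient\<close>

lemma closed_orbit: "closed (orbit N q)"
proof -
  have nz: "\<tau> $ k \<noteq> 0" if "\<tau> \<in> N" for \<tau> k
    using N_torus[OF that] by (auto simp: torus_iff) (metis norm_zero zero_neq_one)
  have "continuous_on N (\<lambda>\<tau>. torus_act \<tau> q)"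
  proof (rule continuous_on_quatI)
    show "continuous_on N (\<lambda>\<tau>. coord k (torus_act \<tau> q))" for k
      unfolding coord_def torus_act_def fst_conv snd_conv vec_lambda_beta
      by (intro continuous_intros) (use nz in auto)
  qed
  then show ?thesis unfolding orbit_def using compact_N
    by (intro compact_imp_closed compact_continuous_image)
qed

lemma norm_le_qdist:
  assumes "p \<in> level \<zeta>" "q \<in> level \<zeta>" "qdist \<zeta> p q < S"
  obtains \<tau> where "\<tau> \<in> N" "norm (torus_act \<tau> q - p) \<le> S"
  using nearly_joined_norm[OF nearly_joined_qlen[OF qdist_less_imp[OF assms], of 1]] by auto

text \<open>The torus preserves the norm, so metric balls of the quotient come from bounded sets of
  the flat space.\<close>

lemma norm_le_norm_add_qdist:
  assumes "p \<in> level \<zeta>" "q \<in> level \<zeta>" "qdist \<zeta> p q < S"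
  shows "norm q \<le> norm p + S"
proof -
  obtain \<tau> where \<tau>: "\<tau> \<in> N" "norm (torus_act \<tau> q - p) \<le> S" by (rule norm_le_qdist[OF assms])
  have "norm q = norm (torus_act \<tau> q)" using N_torus[OF \<tau>(1)] by simp
  also have "\<dots> \<le> norm p + norm (torus_act \<tau> q - p)" by (metis add.commute norm_triangle_sub)
  finally show ?thesis using \<tau>(2) by simp
qed

lemma qdist_refl: "p \<in> level \<zeta> \<Longrightarrow> qdist \<zeta> p p = 0"
  by (simp add: qdist_eq qlen_refl)

text \<open>Distance 0 brings the orbit of q arbitrarily close to p, and orbits of the compact group
  N are closed.\<close>

lemma qdist_eq_zero:
  assumes pq: "p \<in> level \<zeta>" "q \<in> level \<zeta>" and 0: "qdist \<zeta> p q = 0"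
  shows "orbit N p = orbit N q"
proof (rule orbit_eqI)
  have "p \<in> closure (orbit N q)"
    unfolding closure_approachable
  proof (intro allI impI)
    fix e :: real assume e: "e > 0"
    obtain \<tau> where "\<tau> \<in> N" "norm (torus_act \<tau> q - p) \<le> e / 2"
      by (rule norm_le_qdist[OF pq, of "e / 2"]) (use e 0 in auto)
    then show "\<exists>y\<in>orbit N q. dist y p < e" using e by (intro bexI[of _ "torus_act \<tau> q"]) (auto simp: dist_norm)
  qed
  then show "p \<in> orbit N q" using closed_orbit by simp
qed

lemma Metric_space_hk_quotient: "Metric_space (hk_quotient \<iota> N \<zeta>) (quotient_dist \<iota> N \<zeta>)"
proof
  fix P Q R
  show "0 \<le> quotient_dist \<iota> N \<zeta> P Q" by (simp add: quotient_dist_def)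
  show "quotient_dist \<iota> N \<zeta> P Q = quotient_dist \<iota> N \<zeta> Q P"
  proof -
    \<comment> \<open>Symmetry is demanded for arbitrary sets P and Q, not only for orbits, so the
      argument works with the bare infima.\<close>
    have le: "(INF c\<in>{c. valid_path c \<and> path_image c \<subseteq> level \<zeta> \<and> pathstart c \<in> P \<and> pathfinish c \<in> Q}. quotient_length N c)
      \<le> (INF c\<in>{c. valid_path c \<and> path_image c \<subseteq> level \<zeta> \<and> pathstart c \<in> Q \<and> pathfinish c \<in> P}. quotient_length N c)" for P Q
    proof (rule INF_mono)
      fix c assume c: "c \<in> {c. valid_path c \<and> path_image c \<subseteq> level \<zeta> \<and> pathstart c \<in> Q \<and> pathfinish c \<in> P}"
      then show "\<exists>c'\<in>{c. valid_path c \<and> path_image c \<subseteq> level \<zeta> \<and> pathstart c \<in> P \<and> pathfinish c \<in> Q}.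
          quotient_length N c' \<le> quotient_length N c"
        using quotient_length_reverse[OF _ one_in_N, of c] by (intro bexI[of _ "reversepath c"]) auto
    qed
    show ?thesis unfolding quotient_dist_def by (intro arg_cong[of _ _ enn2real] antisym le)
  qed
  assume "P \<in> hk_quotient \<iota> N \<zeta>" "Q \<in> hk_quotient \<iota> N \<zeta>"
  then obtain p q where p: "p \<in> level \<zeta>" "P = orbit N p" and q: "q \<in> level \<zeta>" "Q = orbit N q"
    by (auto simp: hk_quotient_def)
  show "quotient_dist \<iota> N \<zeta> P Q = 0 \<longleftrightarrow> P = Q"
    using qdist_eq_zero[OF p(1) q(1)] qdist_refl[OF p(1)] by (auto simp: qdist_def p q)
  assume "R \<in> hk_quotient \<iota> N \<zeta>"
  then obtain r where r: "r \<in> level \<zeta>" "R = orbit N r" by (auto simp: hk_quotient_def)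
  have "ennreal (qdist \<zeta> p r) \<le> ennreal (qdist \<zeta> p q) + ennreal (qdist \<zeta> q r)"
    using qlen_triangle[of \<zeta> p r q] by (simp add: qlen_eq_qdist p q r)
  then have "qdist \<zeta> p r \<le> qdist \<zeta> p q + qdist \<zeta> q r"
    by (simp add: qdist_nonneg flip: ennreal_plus)
  then show "quotient_dist \<iota> N \<zeta> P R \<le> quotient_dist \<iota> N \<zeta> P Q + quotient_dist \<iota> N \<zeta> Q R"
    by (simp add: qdist_def p q r)
qed

section \<open>Rescaling and Gromov-Hausdorff approximation\<close>

lemma qdist_scaleR: "s > 0 \<Longrightarrow> qdist (s\<^sup>2 *\<^sub>R \<zeta>) (s *\<^sub>R p) (s *\<^sub>R q) = s * qdist \<zeta> p q"
  by (simp add: qdist_eq qlen_scaleR enn2real_mult)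

lemma zero_in_level_set: "0 \<in> level 0"
  by (simp add: level_set_iff)

lemma Metric_space_divide:
  assumes "Metric_space M d" "0 < c"
  shows "Metric_space M (\<lambda>x y. d x y / c :: real)"
proof -
  interpret Metric_space M d by fact
  show ?thesis
  proof
    fix x y z assume "x \<in> M" "y \<in> M" "z \<in> M"
    then have "d x z \<le> d x y + d y z" by (rule triangle)
    then show "d x z / c \<le> d x y / c + d y z / c" using assms(2) by (simp add: divide_right_mono flip: add_divide_distrib)
  qed (use assms(2) in \<open>auto simp: commute\<close>)
qed

text \<open>An orbit is sent to the orbit of any point of the cone close to a rescaled
  representative. Uniform continuity makes every such choice an almost isometry, so the
  approximating map need not be continuous.\<close>

theorem tangent_cone:
  "the_tangent_cone_at_infinity (hk_quotient \<iota> N \<zeta>) (quotient_dist \<iota> N \<zeta>)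
     (hk_quotient \<iota> N 0) (quotient_dist \<iota> N 0) (orbit N 0)"
  unfolding the_tangent_cone_at_infinity_def
proof (intro conjI ballI allI impI)
  obtain C where C: "C \<ge> 0" "\<And>\<zeta> \<zeta>' q. q \<in> level \<zeta> \<Longrightarrow>
    \<exists>q'\<in>level \<zeta>'. (norm (q' - q))\<^sup>2 \<le> C * norm (\<zeta>' - \<zeta>)"
    by (rule level_set_approx) blast
  show "hk_quotient \<iota> N \<zeta> \<noteq> {}"
    using C(2)[OF zero_in_level_set, of \<zeta>] by (auto simp: hk_quotient_def)
  fix P0 and \<rho> :: "nat \<Rightarrow> real"
  assume "P0 \<in> hk_quotient \<iota> N \<zeta>" and \<rho>: "(\<forall>i. 0 < \<rho> i) \<and> incseq \<rho> \<and> filterlim \<rho> at_top sequentially"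
  then obtain p0 where p0: "p0 \<in> level \<zeta>" "P0 = orbit N p0" by (auto simp: hk_quotient_def)
  let ?M = "hk_quotient \<iota> N \<zeta>" and ?Y = "hk_quotient \<iota> N 0"
  let ?d = "\<lambda>i x y. quotient_dist \<iota> N \<zeta> x y / \<rho> i" and ?e = "quotient_dist \<iota> N 0"
  have P0: "P0 \<in> ?M" using p0 by (simp add: hk_quotient_def)
  have orb0: "orbit N 0 \<in> ?Y" using zero_in_level_set by (simp add: hk_quotient_def)
  have Mi: "Metric_space ?M (?d i)" for i
    using \<rho> by (intro Metric_space_divide Metric_space_hk_quotient) auto
  note MY = Metric_space_hk_quotient[of 0]
  define s where "s i = 1 / \<rho> i" for i
  have s: "s i > 0" for i using \<rho> by (simp add: s_def)
  have s0: "s \<longlonglongrightarrow> 0"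
    unfolding s_def using \<rho> by (intro tendsto_divide_0[OF tendsto_const] filterlim_at_top_imp_at_infinity) auto
  show "pointed_GH_limit (\<lambda>_. ?M) ?d (\<lambda>_. P0) ?Y ?e (orbit N 0)"
    unfolding pointed_GH_limit_def
  proof (intro conjI allI impI Mi MY P0 orb0)
    fix r \<epsilon> :: real assume r: "r > 0" and e: "\<epsilon> > 0"
    \<comment> \<open>Bounds the norms of all rescaled representatives that occur: those of the
      r-ball, and those within \<delta> \<le> 1 of a cone point of norm at most r.\<close>
    define R where "R = norm p0 + r + 1"
    obtain \<delta>0 where d0: "\<delta>0 > 0" "\<And>\<zeta>' p q p' q'. norm (\<zeta>' - 0) < \<delta>0 \<Longrightarrow> p \<in> level \<zeta>' \<Longrightarrow> q \<in> level \<zeta>' \<Longrightarrow>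
      p' \<in> level 0 \<Longrightarrow> q' \<in> level 0 \<Longrightarrow> norm p \<le> R \<Longrightarrow> norm q \<le> R \<Longrightarrow>
      norm (p' - p) < \<delta>0 \<Longrightarrow> norm (q' - q) < \<delta>0 \<Longrightarrow> \<bar>qdist 0 p' q' - qdist \<zeta>' p q\<bar> < \<epsilon>"
      by (rule qdist_uniformly_continuous[OF e, of 0 R]) blast
    define \<delta> where "\<delta> = min \<delta>0 1"
    have d: "\<delta> > 0" "\<delta> \<le> \<delta>0" "\<delta> \<le> 1" using d0 by (auto simp: \<delta>_def)
    have lims: "(\<lambda>i. s i * norm p0) \<longlonglongrightarrow> 0" "(\<lambda>i. (s i)\<^sup>2 * norm \<zeta>) \<longlonglongrightarrow> 0" "(\<lambda>i. C * ((s i)\<^sup>2 * norm \<zeta>)) \<longlonglongrightarrow> 0"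
      using s0 by (auto intro!: tendsto_eq_intros)
    have "\<delta>\<^sup>2 > 0" using d by simp
    from order_tendstoD(2)[OF lims(1) d(1)] order_tendstoD(2)[OF lims(2) d(1)] order_tendstoD(2)[OF lims(3) this]
    show "eventually (\<lambda>i. \<exists>f. f ` Metric_space.mball ?M (?d i) P0 r \<subseteq> ?Y \<and> f P0 = orbit N 0 \<and>
        (\<forall>x \<in> Metric_space.mball ?M (?d i) P0 r. \<forall>y \<in> Metric_space.mball ?M (?d i) P0 r.
            \<bar>?e (f x) (f y) - ?d i x y\<bar> < \<epsilon>) \<and>
        Metric_space.mball ?Y ?e (orbit N 0) (r - \<epsilon>)
          \<subseteq> (\<Union>x \<in> Metric_space.mball ?M (?d i) P0 r. Metric_space.mball ?Y ?e (f x) \<epsilon>)) sequentially"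
    proof eventually_elim
      case (elim i)
      let ?s = "s i" and ?B = "Metric_space.mball ?M (?d i) P0 r"
      define \<xi> where "\<xi> = ?s\<^sup>2 *\<^sub>R \<zeta>"
      have \<xi>: "norm \<xi> < \<delta>" "C * norm \<xi> < \<delta>\<^sup>2" using elim by (simp_all add: \<xi>_def)
      have lev: "?s *\<^sub>R p \<in> level \<xi> \<longleftrightarrow> p \<in> level \<zeta>" for p
        unfolding \<xi>_def using s[of i] by (intro level_set_scaleR) simp
      have near1: "\<exists>q'\<in>level 0. norm (q' - q) < \<delta>" if q: "q \<in> level \<xi>" for q
      proof -
        obtain q' where "q' \<in> level 0" "(norm (q' - q))\<^sup>2 \<le> C * norm (0 - \<xi>)" using C(2)[OF q] by blast
        moreover then have "norm (q' - q) < \<delta>" using \<xi>(2) d(1) by (intro power2_less_imp_less[of _ \<delta>]) auto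
        ultimately show ?thesis by blast
      qed
      have near2: "\<exists>q'\<in>level \<xi>. norm (q' - q) < \<delta>" if q: "q \<in> level 0" for q
      proof -
        obtain q' where "q' \<in> level \<xi>" "(norm (q' - q))\<^sup>2 \<le> C * norm (\<xi> - 0)" using C(2)[OF q] by blast
        moreover then have "norm (q' - q) < \<delta>" using \<xi>(2) d(1) by (intro power2_less_imp_less[of _ \<delta>]) auto
        ultimately show ?thesis by blast
      qed
      have unif: "\<bar>qdist 0 p' q' - qdist \<xi> p q\<bar> < \<epsilon>"
        if "p \<in> level \<xi>" "q \<in> level \<xi>" "p' \<in> level 0" "q' \<in> level 0"
          "norm p \<le> R" "norm q \<le> R" "norm (p' - p) < \<delta>" "norm (q' - q) < \<delta>" for p q p' q'
        using that \<xi>(1) d by (intro d0(2)) auto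
      have dd: "?d i (orbit N p) (orbit N q) = qdist \<xi> (?s *\<^sub>R p) (?s *\<^sub>R q)" for p q
        using s[of i] by (simp add: \<xi>_def qdist_scaleR) (simp add: qdist_def s_def)
      define good where "good P Q \<longleftrightarrow> (\<exists>p q. p \<in> level \<zeta> \<and> P = orbit N p \<and> q \<in> level 0 \<and>
          Q = orbit N q \<and> norm (q - ?s *\<^sub>R p) < \<delta>)" for P Q
      \<comment> \<open>The relation \<open>good\<close> leaves the representatives free. The base
        point has to go exactly to the vertex, which \<open>good\<close> permits because s i * norm
        p0 < \<delta>.\<close>
      define f where "f P = (if P = P0 then orbit N 0 else SOME Q. good P Q)" for P
      have sp0: "norm (?s *\<^sub>R p0) < \<delta>" using elim s[of i] by simp
      have good: "good P (f P)" if P: "P \<in> ?M" for P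
      proof (cases "P = P0")
        case True
        have "norm (0 - ?s *\<^sub>R p0) < \<delta>" using sp0 by simp
        then show ?thesis
          using True p0 zero_in_level_set unfolding good_def f_def
          by (intro exI[of _ p0] exI[of _ 0]) simp
      next
        case False
        obtain p where p: "p \<in> level \<zeta>" "P = orbit N p" using P by (auto simp: hk_quotient_def)
        then obtain q where "q \<in> level 0" "norm (q - ?s *\<^sub>R p) < \<delta>" using near1 lev by blast
        then have "good P (orbit N q)" using p unfolding good_def by blast
        then show ?thesis using False by (simp add: f_def someI)
      qed
      have ball: "norm (?s *\<^sub>R p) \<le> R" if "orbit N p \<in> ?B" "p \<in> level \<zeta>" for p
      proof -
        have "qdist \<xi> (?s *\<^sub>R p0) (?s *\<^sub>R p) < r"
          using that(1) by (simp add: Metric_space.in_mball[OF Mi] p0 dd)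
        then have "norm (?s *\<^sub>R p) \<le> norm (?s *\<^sub>R p0) + r"
          using that p0 by (intro norm_le_norm_add_qdist) (auto simp: lev)
        then show ?thesis unfolding R_def using sp0 d(3) norm_ge_zero[of p0] by linarith
      qed
      have sub: "?B \<subseteq> ?M" by (rule Metric_space.mball_subset_mspace[OF Mi])
      show ?case
      proof (intro exI[of _ f] conjI ballI)
        show "f ` ?B \<subseteq> ?Y"
        proof (rule image_subsetI)
          fix P assume "P \<in> ?B"
          then have "good P (f P)" using sub by (intro good) blast
          then obtain q where "q \<in> level 0" "f P = orbit N q" unfolding good_def by blast
          then show "f P \<in> ?Y" by (simp add: hk_quotient_def)
        qed
        show "f P0 = orbit N 0" by (simp add: f_def)
      next
        fix P Q assume PQ: "P \<in> ?B" "Q \<in> ?B"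
        obtain p p' where p: "p \<in> level \<zeta>" "P = orbit N p" "p' \<in> level 0" "f P = orbit N p'"
            "norm (p' - ?s *\<^sub>R p) < \<delta>" using good[of P] sub PQ unfolding good_def by blast
        obtain q q' where q: "q \<in> level \<zeta>" "Q = orbit N q" "q' \<in> level 0" "f Q = orbit N q'"
            "norm (q' - ?s *\<^sub>R q) < \<delta>" using good[of Q] sub PQ unfolding good_def by blast
        have "\<bar>qdist 0 p' q' - qdist \<xi> (?s *\<^sub>R p) (?s *\<^sub>R q)\<bar> < \<epsilon>"
          using p q PQ ball by (intro unif) (auto simp: lev)
        then show "\<bar>?e (f P) (f Q) - ?d i P Q\<bar> < \<epsilon>"
          unfolding p(4) q(4) unfolding p(2) q(2) dd by (simp add: qdist_def)
      next
        show "Metric_space.mball ?Y ?e (orbit N 0) (r - \<epsilon>) \<subseteq> (\<Union>x \<in> ?B. Metric_space.mball ?Y ?e (f x) \<epsilon>)"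
        proof
          fix Q assume Q: "Q \<in> Metric_space.mball ?Y ?e (orbit N 0) (r - \<epsilon>)"
          then have "Q \<in> ?Y" by (simp add: Metric_space.in_mball[OF MY])
          then obtain q where q: "q \<in> level 0" "Q = orbit N q" by (auto simp: hk_quotient_def)
          have q0: "qdist 0 0 q < r - \<epsilon>" using Q by (simp add: Metric_space.in_mball[OF MY] q qdist_def)
          then have nq: "norm q \<le> r"
            using norm_le_norm_add_qdist[OF zero_in_level_set q(1) q0] e by simp
          \<comment> \<open>Almost surjectivity: q is moved to the level set of \<xi> and the
            rescaling undone. The gap between r - \<epsilon> and r keeps the resulting orbit inside
            the ball.\<close>
          obtain p' where p': "p' \<in> level \<xi>" "norm (p' - q) < \<delta>" using near2[OF q(1)] by blast
          define p where "p = (1 / ?s) *\<^sub>R p'"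
          have sp: "?s *\<^sub>R p = p'" using s[of i] by (simp add: p_def)
          have p: "p \<in> level \<zeta>" using p'(1) lev[of p] sp by simp
          have np': "norm p' \<le> R"
            unfolding R_def using norm_triangle_sub[of p' q] p'(2) nq d(3) norm_ge_zero[of p0] by linarith
          have nsp0: "norm (?s *\<^sub>R p0) \<le> R"
            unfolding R_def using sp0 d(3) r norm_ge_zero[of p0] by linarith
          have "\<bar>qdist 0 0 q - qdist \<xi> (?s *\<^sub>R p0) p'\<bar> < \<epsilon>"
            using p0 p' q zero_in_level_set sp0 np' nsp0
            by (intro unif) (auto simp: lev norm_minus_commute)
          then have "qdist \<xi> (?s *\<^sub>R p0) (?s *\<^sub>R p) < r" using q0 unfolding sp by linarith
          moreover have "orbit N p \<in> ?M" using p by (simp add: hk_quotient_def)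
          ultimately have PB: "orbit N p \<in> ?B"
            using P0 by (simp add: Metric_space.in_mball[OF Mi] p0 dd)
          then obtain p1 q1 where p1: "p1 \<in> level \<zeta>" "orbit N p = orbit N p1" "q1 \<in> level 0"
            "f (orbit N p) = orbit N q1" "norm (q1 - ?s *\<^sub>R p1) < \<delta>"
            using good[of "orbit N p"] sub unfolding good_def by blast
          \<comment> \<open>The choice behind f may have used another representative p1 of the same
            orbit. Moving q by the same \<tau> keeps its orbit, and comparison with the distance 0
            from p1 to itself gives the bound.\<close>
          have "p1 \<in> orbit N p" using p1(2) self_in_orbit by simp
          then obtain \<tau> where \<tau>: "\<tau> \<in> N" "p1 = torus_act \<tau> p" by (auto simp: orbit_def)
          have sp1: "?s *\<^sub>R p1 = torus_act \<tau> p'"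
            by (simp add: \<tau>(2) sp [symmetric] linear_cmul[OF linear_torus_act])
          have "\<bar>qdist 0 q1 (torus_act \<tau> q) - qdist \<xi> (?s *\<^sub>R p1) (?s *\<^sub>R p1)\<bar> < \<epsilon>"
          proof (rule unif)
            show "torus_act \<tau> q \<in> level 0"
              using q level_set_torus_act[OF N_torus[OF \<tau>(1)], of q \<iota> 0] by simp
            show "norm (?s *\<^sub>R p1) \<le> R" "norm (?s *\<^sub>R p1) \<le> R"
              unfolding sp1 using np' N_torus[OF \<tau>(1)] by simp_all
            show "norm (torus_act \<tau> q - ?s *\<^sub>R p1) < \<delta>"
              unfolding sp1 using p'(2) by (simp add: norm_torus_act_diff[OF N_torus[OF \<tau>(1)]] norm_minus_commute)
          qed (use p1 in \<open>simp_all add: lev\<close>)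
          then have "qdist 0 q1 (torus_act \<tau> q) < \<epsilon>" using p1(1) by (simp add: qdist_refl lev)
          then have "?e (f (orbit N p)) Q < \<epsilon>"
            by (simp add: qdist_def p1(4) q orbit_torus_act[OF \<tau>(1)])
          moreover have "f (orbit N p) \<in> ?Y" using p1(3,4) by (simp add: hk_quotient_def)
          ultimately have "Q \<in> Metric_space.mball ?Y ?e (f (orbit N p)) \<epsilon>"
            using \<open>Q \<in> ?Y\<close> by (simp add: Metric_space.in_mball[OF MY])
          then show "Q \<in> (\<Union>x \<in> ?B. Metric_space.mball ?Y ?e (f x) \<epsilon>)" using PB by blast
        qed
      qed
    qed
  qed
qed

end

theorem mainTheorem11:
  fixes N :: "(complex ^ 'd::finite) set"
    and u :: "'d \<Rightarrow> real ^ 'n::finite"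
    and \<iota> :: "'l::real_normed_vector \<Rightarrow> real ^ 'd"
  assumes "torus_data \<iota> u N"
    and "basis_hypothesis u"
  shows "\<exists>\<W> :: ('l \<Rightarrow>\<^sub>L (real ^ 3)) set set.
           finite \<W> \<and> (\<forall>W\<in>\<W>. subspace W \<and> W \<noteq> UNIV) \<and>
           (\<forall>\<zeta>. \<zeta> \<notin> \<Union>\<W> \<longrightarrow>
              the_tangent_cone_at_infinity
                (hk_quotient \<iota> N \<zeta>) (quotient_dist \<iota> N \<zeta>)
                (hk_quotient \<iota> N 0) (quotient_dist \<iota> N 0) (orbit N 0))"
proof -
  interpret torus_reduction \<iota> N
    using assms(1) by (intro torus_reduction.intro) (simp_all add: torus_data_def)
  show ?thesis by (rule exI[of _ "{}"]) (simp add: tangent_cone)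
qed

end
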